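(* Let $(X,d,\mu)$ be a metric-measure space with Borel regular doubling measure. Suppose that $(X,d)$ is complete and that $X$ supports a $p$-Poincaré inequality for some $p\in(1,\infty)$. Then there exists a constant $C\ge1$ such that for every $u\in N^{1,p}(X)$, $$C^{-1}g_u(x)\le\limsup_{k\to\infty}|T_ku(x)|\le C\,g_u(x)\quad\text{for $\mu$-a.e. }x\in X,$$ where $g_u\in L^p(X)$ denotes the minimal $p$-weak upper gradient of $u$.
   Context: All function spaces are real. Setting: $(X,d)$ is a metric space, $\mu$ is a Borel measure with $0<\mu(B)<\infty$ for every ball $B$; a ball is $B(x,r)=\{y:d(x,y)<r\}$ with prescribed center and radius $r>0$, and $\lambda B$ is the concentric ball with radius multiplied by $\lambda$. $\mu$ is Borel regular (every $\mu$-measurable set is contained in a Borel set of equal measure) and doubling: there is $C_d\ge1$ with $\mu(2B)\le C_d\,\mu(B)$ for every ball $B$. $L^1_{\rm loc}(X)$ denotes functions integrable on every ball; $u_B=\frac{1}{\mu(B)}\int_B u\,d\mu$. Curves and Sobolev space: $\Gamma(X)$ is the family of nonconstant rectifiable curves $\gamma:[a,b]\to X$; for Borel $\varrho\ge0$, $\int_\gamma\varrho\,ds$ is the integral with respect to arc length. For $\Gamma\subseteq\Gamma(X)$, $\mathrm{Mod}_p(\Gamma)=\inf\int_X\varrho^p\,d\mu$ over Borel $\varrho:X\to[0,\infty]$ with $\int_\gamma\varrho\,ds\ge1$ for all $\gamma\in\Gamma$; a property holds for $\mathrm{Mod}_p$-a.e. curve if the family of $\gamma\in\Gamma(X)$ where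 it fails has $\mathrm{Mod}_p$ zero. A Borel function $g:X\to[0,\infty]$ is an upper gradient (resp. $p$-weak upper gradient) of a Borel function $u:X\to[-\infty,\infty]$ if $|u(\gamma(a))-u(\gamma(b))|\le\int_\gamma g\,ds$ for every (resp. $\mathrm{Mod}_p$-a.e.) $\gamma\in\Gamma(X)$, with the convention $|(\pm\infty)-(\pm\infty)|=\infty$. $\widetilde N^{1,p}(X)$ is the set of Borel $u:X\to[-\infty,\infty]$ with $\|u\|_{N^{1,p}(X)}:=(\|u\|_{L^p(X)}^p+\inf_g\|g\|_{L^p(X)}^p)^{1/p}<\infty$, the infimum over all upper gradients $g$ of $u$; $N^{1,p}(X)=\widetilde N^{1,p}(X)/\!\sim$, where $u\sim v$ iff $\|u-v\|_{N^{1,p}(X)}=0$. Every $u\in N^{1,p}(X)$ has a minimal $p$-weak upper gradient $g_u\in L^p(X)$: a $p$-weak upper gradient of $u$ with $g_u\le g$ $\mu$-a.e. for every $p$-weak upper gradient $g\in L^p(X)$ of $u$; it is unique up to a.e. equality. Poincaré inequality: $X$ supports a $p$-Poincaré inequality if there are $c_{\mathrm{PI}}>0$, $\lambda\ge1$ such that $\frac1{\mu(B)}\int_B|u-u_B|\,d\mu\le c_{\mathrm{PI}}\operatorname{diam}(B)\big(\frac1{\mu(\lambda B)}\int_{\lambda B}g^p\,d\mu\big)^{1/p}$ for all balls $B$, all Borel $u\in L^1_{\rm loc}(X)$ and all upper gradients $g$ of $u$. Operators $T_k$: for each $k\in\mathbb Z$ fix a covering $\{B_i^k\}_{i=1}^{M(k)}$,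 $M(k)\in\mathbb N\cup\{\infty\}$, of $X$ by balls of radius $2^{-k}$ such that the balls $\frac15B_i^k$ are pairwise disjoint. $B_i^k$ and $B_j^k$ are neighbors, $B_i^k\sim B_j^k$, if $\operatorname{dist}(B_i^k,B_j^k)<2^{-k}$ (each ball is its own neighbor). The number of neighbors of a ball is bounded by a constant $N\in\mathbb N$ depending only on $C_d$. For $x\in X$ let $B^k[x]:=B_i^k$ where $i$ is the smallest index with $x\in B_i^k$. For $u\in L^1_{\rm loc}(X)$, $|T_ku(x)|:=2^k\sum_{j:B_j^k\sim B^k[x]}|u_{B^k[x]}-u_{B_j^k}|$. *)

theory Defs
  imports "HOL-Analysis.Analysis"
begin

section \<open>Powers and Lebesgue norms of extended nonnegative functions\<close>

text \<open>Used for exponents \<open>p > 0\<close> only, so that \<open>\<infinity>\<close> is mapped to \<open>\<infinity>\<close> and \<open>0\<close> to \<open>0\<close>.\<close>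

definition enn_powr :: "ennreal \<Rightarrow> real \<Rightarrow> ennreal" where
  "enn_powr x p = (if x = \<infinity> then \<infinity> else ennreal (enn2real x powr p))"

definition Lp_norm :: "'a measure \<Rightarrow> real \<Rightarrow> ('a \<Rightarrow> ennreal) \<Rightarrow> ennreal" where
  "Lp_norm M p f = enn_powr (\<integral>\<^sup>+x. enn_powr (f x) p \<partial>M) (1 / p)"

text \<open>On \<open>ereal\<close> every difference with \<open>\<infinity> - \<infinity>\<close> or \<open>(-\<infinity>) - (-\<infinity>)\<close> evaluates to \<open>\<infinity>\<close>, so
  \<open>ext_dist a b = \<infinity>\<close> whenever \<open>a\<close> or \<open>b\<close> is infinite; see \<open>ext_dist_infinite\<close> below.\<close>

definition ext_dist :: "ereal \<Rightarrow> ereal \<Rightarrow> ennreal" where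
  "ext_dist a b = e2ennreal \<bar>a - b\<bar>"

lemma ext_dist_infinite: "\<bar>a\<bar> = \<infinity> \<or> \<bar>b\<bar> = \<infinity> \<Longrightarrow> ext_dist a b = \<infinity>"
  by (cases a; cases b) (auto simp: ext_dist_def)

lemma ext_dist_real: "ext_dist (ereal a) (ereal b) = ennreal \<bar>a - b\<bar>"
  by (simp add: ext_dist_def)


section \<open>Metric measure spaces\<close>

text \<open>A measure may be given on a \<open>\<sigma>\<close>-algebra larger than the Borel one (for instance the
  Caratheodory-measurable sets of an outer measure).\<close>

definition borel_regular_measure :: "'a::metric_space measure \<Rightarrow> bool" where
  "borel_regular_measure M \<longleftrightarrow>
     space M = UNIV \<and> sets borel \<subseteq> sets M \<and>
     (\<forall>A\<in>sets M. \<exists>B\<in>sets borel. A \<subseteq> B \<and> emeasure M B = emeasure M A)"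

definition balls_pos_finite :: "'a::metric_space measure \<Rightarrow> bool" where
  "balls_pos_finite M \<longleftrightarrow>
     (\<forall>x r. 0 < r \<longrightarrow> 0 < emeasure M (ball x r) \<and> emeasure M (ball x r) < \<infinity>)"

definition doubling_measure :: "'a::metric_space measure \<Rightarrow> bool" where
  "doubling_measure M \<longleftrightarrow>
     (\<exists>Cd\<ge>1. \<forall>x r. 0 < r \<longrightarrow>
        emeasure M (ball x (2 * r)) \<le> ennreal Cd * emeasure M (ball x r))"

text \<open>Borel extended real functions integrable on every ball.\<close>

definition borel_L1_loc :: "'a::metric_space measure \<Rightarrow> ('a \<Rightarrow> ereal) set" where
  "borel_L1_loc M = {u \<in> borel_measurable borel.
     \<forall>x r. 0 < r \<longrightarrow> (\<integral>\<^sup>+y\<in>ball x r. e2ennreal \<bar>u y\<bar> \<partial>M) < \<infinity>}"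

text \<open>A function in \<open>borel_L1_loc M\<close> is finite almost everywhere, so that replacing its infinite
  values by \<open>0\<close> (by \<open>real_of_ereal\<close>) does not affect the mean value.\<close>

definition average :: "'a measure \<Rightarrow> 'a set \<Rightarrow> ('a \<Rightarrow> ereal) \<Rightarrow> real" where
  "average M B u = set_lebesgue_integral M B (\<lambda>x. real_of_ereal (u x)) / measure M B"


section \<open>Rectifiable curves and modulus\<close>

text \<open>The curve \<open>\<gamma> : [a,b] \<rightarrow> X\<close> is the triple \<open>(\<gamma>, a, b)\<close>; the values of \<open>\<gamma>\<close> outside \<open>[a,b]\<close>
  are irrelevant.\<close>

type_synonym 'a curve = "(real \<Rightarrow> 'a) \<times> real \<times> real"

definition curve_length :: "(real \<Rightarrow> 'a::metric_space) \<Rightarrow> real \<Rightarrow> real \<Rightarrow> ennreal" where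
  "curve_length \<gamma> a b =
     (SUP (n, t) \<in> {(n, t). t 0 = a \<and> t n = b \<and> (\<forall>i<n. t i \<le> t (Suc i))}.
        \<Sum>i<n::nat. ennreal (dist (\<gamma> (t i)) (\<gamma> (t (Suc i)))))"

definition rectifiable_curves :: "'a::metric_space curve set" where
  "rectifiable_curves = {(\<gamma>, a, b). a \<le> b \<and> continuous_on {a..b} \<gamma> \<and> curve_length \<gamma> a b < \<infinity> \<and>
     \<not> \<gamma> constant_on {a..b}}"

text \<open>The arc length parametrization on \<open>[0, \<ell>]\<close>, where \<open>\<ell>\<close> is the length of the curve. The point
  does not depend on the choice of \<open>t\<close>: a curve is constant on an interval on which its length
  function \<open>t \<mapsto> curve_length \<gamma> a t\<close> is constant.\<close>

definition arc_param :: "(real \<Rightarrow> 'a::metric_space) \<Rightarrow> real \<Rightarrow> real \<Rightarrow> real \<Rightarrow> 'a" where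
  "arc_param \<gamma> a b s = \<gamma> (SOME t. t \<in> {a..b} \<and> curve_length \<gamma> a t = ennreal s)"

definition curve_integral :: "('a::metric_space \<Rightarrow> ennreal) \<Rightarrow> 'a curve \<Rightarrow> ennreal" where
  "curve_integral \<rho> = (\<lambda>(\<gamma>, a, b).
     \<integral>\<^sup>+s\<in>{0..enn2real (curve_length \<gamma> a b)}. \<rho> (arc_param \<gamma> a b s) \<partial>lborel)"

definition curve_modulus :: "'a::metric_space measure \<Rightarrow> real \<Rightarrow> 'a curve set \<Rightarrow> ennreal" where
  "curve_modulus M p \<Gamma> =
     (INF \<rho> \<in> {\<rho> \<in> borel_measurable borel. \<forall>c\<in>\<Gamma>. 1 \<le> curve_integral \<rho> c}.
        \<integral>\<^sup>+x. enn_powr (\<rho> x) p \<partial>M)"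


section \<open>Upper gradients and the Newtonian space\<close>

definition grad_ineq :: "('a::metric_space \<Rightarrow> ereal) \<Rightarrow> ('a \<Rightarrow> ennreal) \<Rightarrow> 'a curve \<Rightarrow> bool" where
  "grad_ineq u g = (\<lambda>(\<gamma>, a, b). ext_dist (u (\<gamma> a)) (u (\<gamma> b)) \<le> curve_integral g (\<gamma>, a, b))"

definition upper_gradient :: "('a::metric_space \<Rightarrow> ereal) \<Rightarrow> ('a \<Rightarrow> ennreal) \<Rightarrow> bool" where
  "upper_gradient u g \<longleftrightarrow>
     g \<in> borel_measurable borel \<and> (\<forall>c\<in>rectifiable_curves. grad_ineq u g c)"

definition weak_upper_gradient ::
  "'a::metric_space measure \<Rightarrow> real \<Rightarrow> ('a \<Rightarrow> ereal) \<Rightarrow> ('a \<Rightarrow> ennreal) \<Rightarrow> bool" where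
  "weak_upper_gradient M p u g \<longleftrightarrow>
     g \<in> borel_measurable borel \<and>
     curve_modulus M p {c \<in> rectifiable_curves. \<not> grad_ineq u g c} = 0"

definition minimal_weak_upper_gradient ::
  "'a::metric_space measure \<Rightarrow> real \<Rightarrow> ('a \<Rightarrow> ereal) \<Rightarrow> ('a \<Rightarrow> ennreal) \<Rightarrow> bool" where
  "minimal_weak_upper_gradient M p u g \<longleftrightarrow>
     weak_upper_gradient M p u g \<and> Lp_norm M p g < \<infinity> \<and>
     (\<forall>h. weak_upper_gradient M p u h \<and> Lp_norm M p h < \<infinity> \<longrightarrow> (AE x in M. g x \<le> h x))"

definition newtonian_norm :: "'a::metric_space measure \<Rightarrow> real \<Rightarrow> ('a \<Rightarrow> ereal) \<Rightarrow> ennreal" where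
  "newtonian_norm M p u =
     enn_powr (enn_powr (Lp_norm M p (\<lambda>x. e2ennreal \<bar>u x\<bar>)) p
               + (INF g \<in> {g. upper_gradient u g}. enn_powr (Lp_norm M p g) p)) (1 / p)"

definition newtonian_functions :: "'a::metric_space measure \<Rightarrow> real \<Rightarrow> ('a \<Rightarrow> ereal) set" where
  "newtonian_functions M p = {u \<in> borel_measurable borel. newtonian_norm M p u < \<infinity>}"

definition newtonian_rel ::
  "'a::metric_space measure \<Rightarrow> real \<Rightarrow> (('a \<Rightarrow> ereal) \<times> ('a \<Rightarrow> ereal)) set" where
  "newtonian_rel M p = {(u, v). u \<in> newtonian_functions M p \<and> v \<in> newtonian_functions M p \<and>
     newtonian_norm M p (\<lambda>x. u x - v x) = 0}"

definition newtonian_space :: "'a::metric_space measure \<Rightarrow> real \<Rightarrow> ('a \<Rightarrow> ereal) set set" where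
  "newtonian_space M p = newtonian_functions M p // newtonian_rel M p"

definition poincare_inequality :: "'a::metric_space measure \<Rightarrow> real \<Rightarrow> bool" where
  "poincare_inequality M p \<longleftrightarrow>
     (\<exists>cPI>0. \<exists>\<sigma>\<ge>1. \<forall>x r. 0 < r \<longrightarrow>
        (\<forall>u\<in>borel_L1_loc M. \<forall>g. upper_gradient u g \<longrightarrow>
           (\<integral>\<^sup>+y\<in>ball x r. ext_dist (u y) (ereal (average M (ball x r) u)) \<partial>M)
               / emeasure M (ball x r)
           \<le> ennreal (cPI * diameter (ball x r)) *
              enn_powr ((\<integral>\<^sup>+y\<in>ball x (\<sigma> * r). enn_powr (g y) p \<partial>M)
                          / emeasure M (ball x (\<sigma> * r))) (1 / p)))"


section \<open>Dyadic coverings and the operators \<open>T\<^sub>k\<close>\<close>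

text \<open>At scale \<open>k\<close> the balls have centers \<open>z k i\<close> and radius \<open>2\<^sup>-\<^sup>k\<close>, where \<open>i\<close> runs through the
  \<open>m k\<close> (possibly infinitely many) natural numbers \<open>0, 1, \<dots>\<close> with \<open>enat i < m k\<close>.\<close>

definition cover_index :: "(int \<Rightarrow> enat) \<Rightarrow> int \<Rightarrow> nat set" where
  "cover_index m k = {i. enat i < m k}"

definition cover_ball :: "(int \<Rightarrow> nat \<Rightarrow> 'a::metric_space) \<Rightarrow> int \<Rightarrow> nat \<Rightarrow> 'a set" where
  "cover_ball z k i = ball (z k i) (2 powi (- k))"

definition dyadic_coverings :: "(int \<Rightarrow> enat) \<Rightarrow> (int \<Rightarrow> nat \<Rightarrow> 'a::metric_space) \<Rightarrow> bool" where
  "dyadic_coverings m z \<longleftrightarrow>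
     (\<forall>k. (\<Union>i\<in>cover_index m k. cover_ball z k i) = UNIV \<and>
          disjoint_family_on (\<lambda>i. ball (z k i) (1 / 5 * 2 powi (- k))) (cover_index m k))"

definition neighbors :: "(int \<Rightarrow> nat \<Rightarrow> 'a::metric_space) \<Rightarrow> int \<Rightarrow> nat \<Rightarrow> nat \<Rightarrow> bool" where
  "neighbors z k i j \<longleftrightarrow> setdist (cover_ball z k i) (cover_ball z k j) < 2 powi (- k)"

definition first_index ::
  "(int \<Rightarrow> enat) \<Rightarrow> (int \<Rightarrow> nat \<Rightarrow> 'a::metric_space) \<Rightarrow> int \<Rightarrow> 'a \<Rightarrow> nat" where
  "first_index m z k x = (LEAST i. i \<in> cover_index m k \<and> x \<in> cover_ball z k i)"

text \<open>The index set of the sum is finite for dyadic coverings of a doubling space.\<close>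

definition abs_T :: "'a::metric_space measure \<Rightarrow> (int \<Rightarrow> enat) \<Rightarrow> (int \<Rightarrow> nat \<Rightarrow> 'a) \<Rightarrow>
    int \<Rightarrow> ('a \<Rightarrow> ereal) \<Rightarrow> 'a \<Rightarrow> real" where
  "abs_T M m z k u x =
     2 powi k *
     (\<Sum>j \<in> {j \<in> cover_index m k. neighbors z k j (first_index m z k x)}.
        \<bar>average M (cover_ball z k (first_index m z k x)) u - average M (cover_ball z k j) u\<bar>)"


section \<open>Every Newtonian function represents a class\<close>

lemma enn_powr_inverse: "0 < p \<Longrightarrow> enn_powr (enn_powr x (1 / p)) p = x"
  by (cases x) (auto simp: enn_powr_def powr_powr)

lemma enn_powr_Lp_norm: "0 < p \<Longrightarrow> enn_powr (Lp_norm M p f) p = (\<integral>\<^sup>+x. enn_powr (f x) p \<partial>M)"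
  by (simp add: Lp_norm_def enn_powr_inverse)

lemma enn_powr_cmult:
  "0 < e \<Longrightarrow> 0 < p \<Longrightarrow> enn_powr (ennreal e * x) p = ennreal (e powr p) * enn_powr x p"
  by (cases x)
    (auto simp: enn_powr_def ennreal_mult_eq_top_iff ennreal_mult_top powr_mult
          simp flip: ennreal_mult)

lemma enn_powr_borel [measurable]: "(\<lambda>x. enn_powr x p) \<in> borel_measurable borel"
  unfolding enn_powr_def by measurable

lemma nn_integral_cmult_le: "c * (\<integral>\<^sup>+x. f x \<partial>M) \<le> (\<integral>\<^sup>+x. c * f x \<partial>M)"
proof -
  have "c * (\<integral>\<^sup>+x. f x \<partial>M) = (SUP s \<in> {s. simple_function M s \<and> s \<le> f}. c * integral\<^sup>S M s)"
    unfolding nn_integral_def by (rule SUP_mult_left_ennreal)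
  also have "\<dots> \<le> (\<integral>\<^sup>+x. c * f x \<partial>M)"
  proof (rule SUP_least)
    fix s assume "s \<in> {s. simple_function M s \<and> s \<le> f}"
    then have s: "simple_function M s" and "s \<le> f" by auto
    have "c * integral\<^sup>S M s = (\<integral>\<^sup>+x. c * s x \<partial>M)"
      using s by (simp add: nn_integral_cmult nn_integral_eq_simple_integral borel_measurable_simple_function)
    also have "\<dots> \<le> (\<integral>\<^sup>+x. c * f x \<partial>M)"
      using \<open>s \<le> f\<close> by (intro nn_integral_mono) (auto simp: le_fun_def intro: mult_left_mono)
    finally show "c * integral\<^sup>S M s \<le> (\<integral>\<^sup>+x. c * f x \<partial>M)" .
  qed
  finally show ?thesis .
qed

lemma curve_integral_cmult_le:
  "c * curve_integral g \<gamma> \<le> curve_integral (\<lambda>x. c * g x) \<gamma>"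
  using nn_integral_cmult_le
  by (cases \<gamma>) (auto simp: curve_integral_def mult.assoc intro: order_trans)

lemma upper_gradient_diff_self:
  assumes "upper_gradient u g" "0 < e"
  shows "upper_gradient (\<lambda>x. u x - u x) (\<lambda>x. ennreal e * g x)"
proof -
  have [measurable]: "g \<in> borel_measurable borel"
    using assms by (simp add: upper_gradient_def)
  have "grad_ineq (\<lambda>x. u x - u x) (\<lambda>x. ennreal e * g x) c" if "c \<in> rectifiable_curves" for c
  proof -
    obtain \<gamma> a b where c: "c = (\<gamma>, a, b)" by (cases c)
    have le: "ext_dist (u (\<gamma> a)) (u (\<gamma> b)) \<le> curve_integral g c"
      using assms that by (auto simp: upper_gradient_def grad_ineq_def c)
    show ?thesis
    proof (cases "\<bar>u (\<gamma> a)\<bar> = \<infinity> \<or> \<bar>u (\<gamma> b)\<bar> = \<infinity>")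
      case True
      with le have "curve_integral g c = \<infinity>"
        by (simp add: ext_dist_infinite top_unique)
      then have "curve_integral (\<lambda>x. ennreal e * g x) c = \<infinity>"
        using curve_integral_cmult_le [of "ennreal e" g c] \<open>0 < e\<close>
        by (simp add: ennreal_mult_top top_unique)
      then show ?thesis by (simp add: grad_ineq_def c)
    next
      case False
      then have "ext_dist (u (\<gamma> a) - u (\<gamma> a)) (u (\<gamma> b) - u (\<gamma> b)) = 0"
        by (auto simp: ext_dist_def e2ennreal_neg)
      then show ?thesis by (simp add: grad_ineq_def c)
    qed
  qed
  then show ?thesis by (simp add: upper_gradient_def)
qed

lemma newtonian_norm_diff_self:
  fixes M :: "'a::metric_space measure"
  assumes M: "sets borel \<subseteq> sets M" "space M = UNIV" and p: "0 < p"
    and u: "u \<in> newtonian_functions M p"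
  shows "newtonian_norm M p (\<lambda>x. u x - u x) = 0"
proof -
  have meas: "f \<in> borel_measurable M" if "f \<in> borel_measurable borel" for f :: "'a \<Rightarrow> ennreal"
    using that M by (auto simp: measurable_def)
  have [measurable]: "u \<in> borel_measurable borel"
    using u by (simp add: newtonian_functions_def)
  let ?I = "\<lambda>f. \<integral>\<^sup>+x. enn_powr (f x) p \<partial>M"
  have fin: "?I (\<lambda>x. e2ennreal \<bar>u x\<bar>) + (INF g \<in> {g. upper_gradient u g}. ?I g) < \<infinity>"
  proof -
    have "x < \<infinity>" if "enn_powr x (1 / p) < \<infinity>" for x
      using that by (auto simp: enn_powr_def less_top split: if_splits)
    then show ?thesis
      using u p unfolding newtonian_functions_def newtonian_norm_def
      by (simp only: enn_powr_Lp_norm mem_Collect_eq)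
  qed
  then have "(INF g \<in> {g. upper_gradient u g}. ?I g) < \<infinity>"
    by (auto simp: less_top [symmetric])
  then obtain g where g: "upper_gradient u g" and gI: "?I g < \<infinity>"
    by (auto simp: INF_less_iff)
  have [measurable]: "g \<in> borel_measurable borel"
    using g by (simp add: upper_gradient_def)
  have "?I (\<lambda>x. e2ennreal \<bar>u x\<bar>) \<noteq> \<infinity>" using fin by auto
  then have "AE x in M. enn_powr (e2ennreal \<bar>u x\<bar>) p \<noteq> \<infinity>"
    by (intro nn_integral_PInf_AE meas) measurable
  then have "AE x in M. enn_powr (e2ennreal \<bar>u x - u x\<bar>) p = 0"
  proof eventually_elim
    case (elim x)
    then show ?case
      using p by (cases "u x") (auto simp: enn_powr_def e2ennreal_neg)
  qed
  then have "?I (\<lambda>x. e2ennreal \<bar>u x - u x\<bar>) = (\<integral>\<^sup>+x. 0 \<partial>M)"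
    by (rule nn_integral_cong_AE)
  then have 1: "?I (\<lambda>x. e2ennreal \<bar>u x - u x\<bar>) = 0" by simp
  let ?J = "INF h \<in> {h. upper_gradient (\<lambda>x. u x - u x) h}. ?I h"
  have J: "?J \<le> ennreal d * ?I g" if "0 < d" for d
  proof -
    have d: "(d powr (1 / p)) powr p = d" using that p by (simp add: powr_powr)
    have "?J \<le> ?I (\<lambda>x. ennreal (d powr (1 / p)) * g x)"
    proof (intro INF_lower CollectI)
      show "upper_gradient (\<lambda>x. u x - u x) (\<lambda>x. ennreal (d powr (1 / p)) * g x)"
        by (rule upper_gradient_diff_self [OF g]) (use that in simp)
    qed
    also have "\<dots> = (\<integral>\<^sup>+x. ennreal d * enn_powr (g x) p \<partial>M)"
      using that p by (simp add: enn_powr_cmult d)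
    also have "\<dots> = ennreal d * ?I g"
      by (intro nn_integral_cmult meas) measurable
    finally show ?thesis .
  qed
  obtain K where K: "?I g = ennreal K" "0 \<le> K"
    using gI by (cases "?I g") auto
  have "?J \<le> 0 + ennreal e" if "0 < e" for e
  proof -
    have "?J \<le> ennreal (e / (K + 1)) * ennreal K"
      unfolding K(1) [symmetric] by (rule J) (use K that in simp)
    also have "\<dots> = ennreal (e / (K + 1) * K)"
      using K that by (intro ennreal_mult [symmetric]) auto
    also have "\<dots> \<le> ennreal e"
      using K that by (intro ennreal_leI) (simp add: field_simps)
    finally show ?thesis by simp
  qed
  then have "?J \<le> 0"
    by (rule ennreal_le_epsilon)
  then have J0: "?J = 0" by (simp only: le_zero_eq)
  show ?thesis
    unfolding newtonian_norm_def enn_powr_Lp_norm [OF p] 1 J0 by (simp add: enn_powr_def)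
qed

lemma Union_newtonian_space:
  assumes "borel_regular_measure M" "0 < p"
  shows "\<Union> (newtonian_space M p) = newtonian_functions M p"
proof -
  have "(u, u) \<in> newtonian_rel M p" if "u \<in> newtonian_functions M p" for u
    using assms that newtonian_norm_diff_self [of M p u]
    unfolding newtonian_rel_def borel_regular_measure_def by blast
  then show ?thesis
    by (auto simp: newtonian_space_def quotient_def) (auto simp: newtonian_rel_def)
qed

end

theory Submission
  imports Defs
begin

text \<open>
  Let \<open>A\<^sub>k f (x)\<close> denote the mean of \<open>f \<ge> 0\<close> over a fixed dilate of the ball \<open>B\<^sup>k[x]\<close>. The Poincare
  inequality gives \<open>|T\<^sub>k u|\<^sup>p \<le> K A\<^sub>k(g\<^sup>p)\<close> for every upper gradient \<open>g\<close>, and by the Vitali covering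
  argument \<open>limsup\<^sub>k A\<^sub>k f \<le> C f\<close> almost everywhere for integrable \<open>f\<close>. Since \<open>g\<^sub>u + \<epsilon>\<rho>\<close> is an upper
  gradient for some \<open>\<rho> \<in> L\<^sup>p\<close> and all \<open>\<epsilon> > 0\<close>, the upper bound follows.

  For the lower bound it suffices to exhibit \<open>2 limsup\<^sub>j |T\<^bsub>k(j)\<^esub> u|\<close>, along some subsequence, as a
  \<open>p\<close>-weak upper gradient of \<open>u\<close>. Points at distance less than \<open>2\<^sup>-\<^sup>k\<close> lie in neighbouring balls, so the
  dyadic averages \<open>v\<^sub>k(x) = u\<^sub>B\<close>, \<open>B = B\<^sup>k[x]\<close>, satisfy \<open>|v\<^sub>k(x) - v\<^sub>k(y)| \<le> 2\<^sup>-\<^sup>k |T\<^sub>k u(x)|\<close>. Chaining along a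
  curve in steps comparable to \<open>2\<^sup>-\<^sup>k\<close> and averaging over the starting point bounds the oscillation of
  \<open>v\<^sub>k\<close> by \<open>2 \<integral> |T\<^sub>k u| ds\<close>. To pass to the limit by reverse Fatou one needs a dominating function in
  \<open>L\<^sup>p\<close>: the excess \<open>(A\<^sub>k f - C f)\<^sup>+\<close> tends to zero in \<open>L\<^sup>1\<close>, hence it is summable along a subsequence.
\<close>


section \<open>Length and arc length parametrization of curves\<close>

text \<open>The natural majorant of all means of g^p is the maximal function of g^p. But g^p is
  merely in L^1, where the maximal function is of weak type only, so no integrable bound over all
  scales is to be expected. This is why a subsequence is used; it is harmless, since the limsup
  along it is at most the full limsup.

  Chaining from one fixed starting point yields a Riemann sum of |T_k u| along the curve, which the
  arc length integral does not control. Shifting the starting point over a short interval turns such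
  sums into integrals. It also removes a second obstacle: the dyadic averages converge at almost
  every point of a good curve, but perhaps not at its end points. The two short end pieces are paid
  for with an integrable upper gradient of u, whose integral over them vanishes in the limit.

  The 2 in the lower bound is a rounding loss: the number N of steps shorter than r that cross an
  interval of length eta >= r can be chosen with N r <= 2 eta.\<close>

definition partition_from :: "real \<Rightarrow> real \<Rightarrow> nat \<Rightarrow> (nat \<Rightarrow> real) \<Rightarrow> bool" where
  "partition_from a b n t \<longleftrightarrow> t 0 = a \<and> t n = b \<and> (\<forall>i<n. t i \<le> t (Suc i))"

definition chord_sum :: "(real \<Rightarrow> 'a::metric_space) \<Rightarrow> nat \<Rightarrow> (nat \<Rightarrow> real) \<Rightarrow> ennreal" where
  "chord_sum \<gamma> n t = (\<Sum>i<n. ennreal (dist (\<gamma> (t i)) (\<gamma> (t (Suc i)))))"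

lemma chord_sum_le_length: "partition_from a b n t \<Longrightarrow> chord_sum \<gamma> n t \<le> curve_length \<gamma> a b"
  unfolding curve_length_def chord_sum_def partition_from_def
  by (rule SUP_upper2 [of "(n, t)"]) auto

lemma curve_length_leI:
  assumes "\<And>n t. partition_from a b n t \<Longrightarrow> chord_sum \<gamma> n t \<le> L"
  shows "curve_length \<gamma> a b \<le> L"
  unfolding curve_length_def
  by (rule SUP_least) (use assms in \<open>auto simp: chord_sum_def partition_from_def\<close>)

lemma partition_from_2: "a \<le> b \<Longrightarrow> partition_from a b 1 (\<lambda>i. if i = 0 then a else b)"
  by (auto simp: partition_from_def)

lemma dist_le_curve_length: "a \<le> b \<Longrightarrow> ennreal (dist (\<gamma> a) (\<gamma> b)) \<le> curve_length \<gamma> a b"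
  using chord_sum_le_length [OF partition_from_2, of a b \<gamma>] by (simp add: chord_sum_def)

text \<open>The two partitions share the point b, so gluing adds no chord at the junction.\<close>

lemma partition_from_append:
  assumes "partition_from a b n t" "partition_from b c n' t'"
  obtains t'' where "partition_from a c (n + n') t''"
    and "chord_sum \<gamma> (n + n') t'' = chord_sum \<gamma> n t + chord_sum \<gamma> n' t'"
proof -
  define t'' where "t'' i = (if i \<le> n then t i else t' (i - n))" for i
  have shift: "t'' (n + i) = t' i" for i
    using assms by (auto simp: t''_def partition_from_def)
  have "partition_from a c (n + n') t''"
    unfolding partition_from_def
  proof (intro conjI allI impI)
    show "t'' 0 = a" "t'' (n + n') = c"
      using assms shift [of n'] by (auto simp: t''_def partition_from_def)
    fix i assume i: "i < n + n'"
    show "t'' i \<le> t'' (Suc i)"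
    proof (cases "i < n")
      case True
      then show ?thesis using assms by (auto simp: t''_def partition_from_def)
    next
      case False
      then obtain j where "i = n + j" by (metis le_add_diff_inverse not_le)
      then show ?thesis
        using shift [of j] shift [of "Suc j"] i assms by (auto simp: partition_from_def)
    qed
  qed
  moreover have "chord_sum \<gamma> (n + n') t'' = chord_sum \<gamma> n t + chord_sum \<gamma> n' t'"
  proof -
    have "chord_sum \<gamma> (n + n') t'' = chord_sum \<gamma> n t'' + (\<Sum>i<n'. ennreal (dist (\<gamma> (t'' (n + i))) (\<gamma> (t'' (n + Suc i)))))"
      unfolding chord_sum_def by (induction n') (auto simp: algebra_simps)
    also have "chord_sum \<gamma> n t'' = chord_sum \<gamma> n t"
      unfolding chord_sum_def by (intro sum.cong) (auto simp: t''_def)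
    finally show ?thesis by (simp only: shift chord_sum_def)
  qed
  ultimately show ?thesis by (rule that)
qed

lemma curve_length_superadditive:
  assumes "a \<le> b" "b \<le> c"
  shows "curve_length \<gamma> a b + curve_length \<gamma> b c \<le> curve_length \<gamma> a c"
proof -
  let ?P = "\<lambda>a b. {(n, t). partition_from a b n t}"
  have *: "curve_length \<gamma> a b = (SUP q \<in> ?P a b. chord_sum \<gamma> (fst q) (snd q))" for a b
    unfolding curve_length_def partition_from_def chord_sum_def by (simp add: case_prod_beta)
  \<comment> \<open>A sum of two suprema is a double supremum only over nonempty index sets; this is
    where a <= b and b <= c enter.\<close>
  have ne: "?P a b \<noteq> {}" "?P b c \<noteq> {}" using partition_from_2 assms by auto
  have "curve_length \<gamma> a b + curve_length \<gamma> b c =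
      (SUP q' \<in> ?P b c. SUP q \<in> ?P a b. chord_sum \<gamma> (fst q) (snd q) + chord_sum \<gamma> (fst q') (snd q'))"
    unfolding * using ne by (simp add: ennreal_SUP_add_left ennreal_SUP_add_right)
  also have "\<dots> \<le> curve_length \<gamma> a c"
  proof (intro SUP_least, clarsimp)
    fix n t n' t' assume "partition_from a b n t" "partition_from b c n' t'"
    then show "chord_sum \<gamma> n t + chord_sum \<gamma> n' t' \<le> curve_length \<gamma> a c"
      using partition_from_append [of a b n t c n' t'] chord_sum_le_length by metis
  qed
  finally show ?thesis .
qed

section \<open>Additivity and semicontinuity of the length\<close>

lemma partition_from_Suc:
  "partition_from a c (Suc n) t \<longleftrightarrow> partition_from a (t n) n t \<and> t n \<le> c \<and> t (Suc n) = c"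
  by (auto simp: partition_from_def less_Suc_eq)

lemma partition_from_le: "partition_from a b n t \<Longrightarrow> a \<le> b"
proof (induction n arbitrary: b)
  case 0
  then show ?case by (simp add: partition_from_def)
next
  case (Suc n)
  then have "a \<le> t n" "t n \<le> b" by (simp_all add: partition_from_Suc)
  then show ?case by (rule order_trans)
qed

lemma chord_sum_Suc:
  "chord_sum \<gamma> (Suc n) t = chord_sum \<gamma> n t + ennreal (dist (\<gamma> (t n)) (\<gamma> (t (Suc n))))"
  by (simp add: chord_sum_def)

text \<open>For the upper estimate, b is inserted into the step that jumps over it, which can only
  increase the chord sum by the triangle inequality. The induction strips off the steps beyond b one
  at a time.\<close>

lemma curve_length_additive:
  assumes "a \<le> b" "b \<le> c"
  shows "curve_length \<gamma> a c = curve_length \<gamma> a b + curve_length \<gamma> b c"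
proof (rule antisym [OF curve_length_leI curve_length_superadditive [OF assms]])
  fix n t assume "partition_from a c n t"
  then show "chord_sum \<gamma> n t \<le> curve_length \<gamma> a b + curve_length \<gamma> b c"
    using assms
  proof (induction n arbitrary: c)
    case 0
    then show ?case by (simp add: chord_sum_def)
  next
    case (Suc n)
    then have p: "partition_from a (t n) n t" "t n \<le> c" "t (Suc n) = c"
      by (simp_all add: partition_from_Suc)
    show ?case
    proof (cases "b \<le> t n")
      case True
      then have "chord_sum \<gamma> (Suc n) t \<le> curve_length \<gamma> a b + curve_length \<gamma> b (t n) + curve_length \<gamma> (t n) c"
        unfolding chord_sum_Suc p(3)
        by (intro add_mono Suc.IH p Suc.prems dist_le_curve_length)
      also have "\<dots> \<le> curve_length \<gamma> a b + curve_length \<gamma> b c"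
        using curve_length_superadditive [of b "t n" c \<gamma>] True p by (auto simp: add.assoc intro: add_left_mono)
      finally show ?thesis .
    next
      case False
      have "dist (\<gamma> (t n)) (\<gamma> c) \<le> dist (\<gamma> (t n)) (\<gamma> b) + dist (\<gamma> b) (\<gamma> c)"
        by (rule dist_triangle)
      then have "ennreal (dist (\<gamma> (t n)) (\<gamma> c)) \<le> ennreal (dist (\<gamma> (t n)) (\<gamma> b)) + ennreal (dist (\<gamma> b) (\<gamma> c))"
        by (simp flip: ennreal_plus)
      also have "\<dots> \<le> curve_length \<gamma> (t n) b + curve_length \<gamma> b c"
        using False Suc.prems by (intro add_mono dist_le_curve_length) auto
      finally have "chord_sum \<gamma> (Suc n) t \<le> curve_length \<gamma> a (t n) + (curve_length \<gamma> (t n) b + curve_length \<gamma> b c)"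
        unfolding chord_sum_Suc p(3) by (intro add_mono chord_sum_le_length p)
      also have "\<dots> \<le> curve_length \<gamma> a b + curve_length \<gamma> b c"
        using curve_length_superadditive [of a "t n" b \<gamma>] False partition_from_le [OF p(1)]
        by (auto simp: add.assoc [symmetric] intro: add_right_mono)
      finally show ?thesis .
    qed
  qed
qed

text \<open>Only the last chord of a partition reaches c. By continuity its end point can be moved
  slightly to the left, and the moved partition belongs to an interval for which the bound L is
  assumed.\<close>

lemma curve_length_lsc:
  assumes \<gamma>: "continuous_on {a..c} \<gamma>" and "a < c" and L: "\<And>t. a \<le> t \<Longrightarrow> t < c \<Longrightarrow> curve_length \<gamma> a t \<le> L"
  shows "curve_length \<gamma> a c \<le> L"
proof (rule curve_length_leI)
  fix n t assume "partition_from a c n t"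
  then show "chord_sum \<gamma> n t \<le> L"
  proof (induction n)
    case 0
    then show ?case by (simp add: chord_sum_def)
  next
    case (Suc n)
    then have p: "partition_from a (t n) n t" "t n \<le> c" "t (Suc n) = c"
      by (simp_all add: partition_from_Suc)
    show ?case
    proof (cases "t n = c")
      case True
      then show ?thesis using Suc.IH p by (simp add: chord_sum_Suc)
    next
      case False
      then have lt: "t n < c" and le: "a \<le> t n" using p partition_from_le by auto
      have "(\<gamma> \<longlongrightarrow> \<gamma> c) (at_left c)"
        using \<gamma> \<open>a < c\<close> by (simp add: continuous_on_Icc_at_leftD)
      then have "((\<lambda>s. chord_sum \<gamma> n t + ennreal (dist (\<gamma> (t n)) (\<gamma> s))) \<longlongrightarrow>
          chord_sum \<gamma> n t + ennreal (dist (\<gamma> (t n)) (\<gamma> c))) (at_left c)"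
        by (intro tendsto_intros tendsto_ennrealI) auto
      moreover have "\<forall>\<^sub>F s in at_left c. chord_sum \<gamma> n t + ennreal (dist (\<gamma> (t n)) (\<gamma> s)) \<le> L"
      proof (subst eventually_at_left_field, intro exI conjI allI impI)
        fix s assume s: "t n < s" "s < c"
        have "chord_sum \<gamma> n t + ennreal (dist (\<gamma> (t n)) (\<gamma> s)) \<le> curve_length \<gamma> a (t n) + curve_length \<gamma> (t n) s"
          using s by (intro add_mono chord_sum_le_length p dist_le_curve_length) auto
        also have "\<dots> \<le> curve_length \<gamma> a s"
          using s le by (intro curve_length_superadditive) auto
        also have "\<dots> \<le> L" using s le by (intro L) auto
        finally show "chord_sum \<gamma> n t + ennreal (dist (\<gamma> (t n)) (\<gamma> s)) \<le> L" .
      qed (use lt in auto)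
      ultimately have "chord_sum \<gamma> n t + ennreal (dist (\<gamma> (t n)) (\<gamma> c)) \<le> L"
        by (rule tendsto_upperbound) simp
      then show ?thesis by (simp add: chord_sum_Suc p)
    qed
  qed
qed

text \<open>Reversal transfers semicontinuity from the right end point to the left one. One
  inequality is enough, because reversing twice restores the curve.\<close>

lemma curve_length_reverse_le:
  "curve_length \<gamma> a b \<le> curve_length (\<lambda>x. \<gamma> (- x)) (- b) (- a)"
proof (rule curve_length_leI)
  fix n t assume p: "partition_from a b n t"
  have "t (n - Suc i) \<le> t (n - i)" if "i < n" for i
    using p that by (metis Suc_diff_Suc diff_less partition_from_def zero_less_Suc less_nat_zero_code not_gr_zero)
  with p have "partition_from (- b) (- a) n (\<lambda>i. - t (n - i))"
    by (auto simp: partition_from_def)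
  moreover have "chord_sum (\<lambda>x. \<gamma> (- x)) n (\<lambda>i. - t (n - i)) = chord_sum \<gamma> n t"
    unfolding chord_sum_def
    by (subst sum.nat_diff_reindex [symmetric], intro sum.cong) (auto simp: dist_commute Suc_diff_Suc)
  ultimately show "chord_sum \<gamma> n t \<le> curve_length (\<lambda>x. \<gamma> (- x)) (- b) (- a)"
    using chord_sum_le_length by metis
qed

lemma curve_length_reverse:
  "curve_length (\<lambda>x. \<gamma> (- x)) (- b) (- a) = curve_length \<gamma> a b"
  using curve_length_reverse_le [of \<gamma> a b] curve_length_reverse_le [of "\<lambda>x. \<gamma> (- x)" "- b" "- a"]
  by (simp add: antisym)

lemma curve_length_lsc':
  assumes \<gamma>: "continuous_on {a..c} \<gamma>" and "a < c" and L: "\<And>t. a < t \<Longrightarrow> t \<le> c \<Longrightarrow> curve_length \<gamma> t c \<le> L"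
  shows "curve_length \<gamma> a c \<le> L"
proof -
  have "curve_length (\<lambda>x. \<gamma> (- x)) (- c) (- a) \<le> L"
  proof (rule curve_length_lsc)
    show "continuous_on {- c..- a} (\<lambda>x. \<gamma> (- x))"
      by (rule continuous_on_compose2 [OF \<gamma>]) (auto intro: continuous_intros)
    fix t assume "- c \<le> t" "t < - a"
    then show "curve_length (\<lambda>x. \<gamma> (- x)) (- c) t \<le> L"
      using L [of "- t"] curve_length_reverse [of \<gamma> c "- t"] by auto
  qed (use \<open>a < c\<close> in auto)
  then show ?thesis by (simp add: curve_length_reverse)
qed

lemma curve_length_refl [simp]: "curve_length \<gamma> a a = 0"
proof -
  have "chord_sum \<gamma> n t = 0" if "partition_from a a n t" for n t
    using that
  proof (induction n)
    case (Suc n)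
    then have "partition_from a (t n) n t" "t n \<le> a" "t (Suc n) = a"
      by (simp_all add: partition_from_Suc)
    with partition_from_le [of a "t n" n t] Suc show ?case by (simp add: chord_sum_Suc)
  qed (simp add: chord_sum_def)
  then have "curve_length \<gamma> a a \<le> 0" by (intro curve_length_leI) simp
  then show ?thesis by simp
qed

text \<open>At the supremum T of the parameters with length at most s, semicontinuity from the left
  gives a value at most s. Semicontinuity of the remaining length from the right, combined with
  additivity, gives a value at least s.\<close>

lemma curve_length_IVT:
  assumes \<gamma>: "continuous_on {a..b} \<gamma>" and "a \<le> b" and fin: "curve_length \<gamma> a b < \<infinity>"
    and s: "s \<le> curve_length \<gamma> a b"
  shows "\<exists>t\<in>{a..b}. curve_length \<gamma> a t = s"
proof -
  let ?S = "{t\<in>{a..b}. curve_length \<gamma> a t \<le> s}"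
  define T where "T = Sup ?S"
  have aS: "a \<in> ?S" using \<open>a \<le> b\<close> by simp
  have bdd: "bdd_above ?S" by (rule bdd_aboveI [of _ b]) auto
  have T: "a \<le> T" "T \<le> b"
    unfolding T_def using aS bdd by (auto intro: cSup_upper) (use aS in \<open>auto intro!: cSup_least\<close>)
  have mono: "curve_length \<gamma> a t \<le> curve_length \<gamma> a t'" if "a \<le> t" "t \<le> t'" for t t'
    using curve_length_additive [OF that, of \<gamma>] by simp
  have below: "curve_length \<gamma> a t \<le> s" if t: "a \<le> t" "t < T" for t
  proof -
    have "?S \<noteq> {}" using aS by blast
    then obtain t' where t': "t' \<in> ?S" "t < t'"
      using less_cSupD [of ?S t] t(2) unfolding T_def by blast
    have "curve_length \<gamma> a t \<le> curve_length \<gamma> a t'" using t(1) t'(2) by (intro mono) auto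
    also have "\<dots> \<le> s" using t' by blast
    finally show ?thesis .
  qed
  have "curve_length \<gamma> a T \<le> s"
  proof (cases "a < T")
    case True
    show ?thesis
    proof (rule curve_length_lsc [OF continuous_on_subset [OF \<gamma>] True])
      show "{a..T} \<subseteq> {a..b}" using T by auto
    qed (rule below)
  qed (use T in simp)
  moreover have "s \<le> curve_length \<gamma> a T"
  proof (cases "T < b")
    case True
    \<comment> \<open>Beyond T the length exceeds s, so what remains is at most the total minus s.
      Finiteness of the total makes this subtraction in \<open>ennreal\<close> reversible.\<close>
    have "curve_length \<gamma> T b \<le> curve_length \<gamma> a b - s"
    proof (rule curve_length_lsc' [OF continuous_on_subset [OF \<gamma>] True])
      fix t assume t: "T < t" "t \<le> b"
      have "\<not> curve_length \<gamma> a t \<le> s"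
      proof
        assume "curve_length \<gamma> a t \<le> s"
        then have "t \<le> T" unfolding T_def using T t by (intro cSup_upper bdd) auto
        with t show False by simp
      qed
      then have "s + curve_length \<gamma> t b \<le> curve_length \<gamma> a b"
        using curve_length_additive [of a t b \<gamma>] T t by (auto intro: add_right_mono)
      then show "curve_length \<gamma> t b \<le> curve_length \<gamma> a b - s"
        using s fin by (subst ennreal_le_minus_iff) (auto simp: add.commute)
    qed (use T in auto)
    then have "s + curve_length \<gamma> T b \<le> curve_length \<gamma> a b"
      using s fin by (subst (asm) ennreal_le_minus_iff) (auto simp: add.commute top_unique)
    then have "s + curve_length \<gamma> T b \<le> curve_length \<gamma> a T + curve_length \<gamma> T b"
      using curve_length_additive [of a T b \<gamma>] T by simp
    moreover have "curve_length \<gamma> T b < \<infinity>"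
      using curve_length_additive [of a T b \<gamma>] T fin by (simp add: less_top)
    ultimately show ?thesis by (auto simp: ennreal_add_left_cancel_le add.commute)
  next
    case False
    then show ?thesis using s T by simp
  qed
  ultimately show ?thesis using T by (intro bexI [of _ T]) auto
qed

section \<open>Arc length parametrization\<close>

lemma curve_length_zero_imp_eq:
  assumes "a \<le> t" "t \<le> t'" "curve_length \<gamma> a t' = curve_length \<gamma> a t" "curve_length \<gamma> a t < \<infinity>"
  shows "\<gamma> t = \<gamma> t'"
proof -
  have "curve_length \<gamma> a t + curve_length \<gamma> t t' = curve_length \<gamma> a t + 0"
    using curve_length_additive [of a t t' \<gamma>] assms by simp
  then have "curve_length \<gamma> t t' = 0"
    using assms(4) by (subst (asm) ennreal_add_left_cancel) auto
  then show ?thesis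
    using dist_le_curve_length [of t t' \<gamma>] assms by simp
qed

text \<open>The choice made by \<open>SOME\<close> is immaterial: two parameters with equal length
  value bound a stretch of length zero.\<close>

lemma arc_param_eq:
  assumes "t \<in> {a..b}" "curve_length \<gamma> a t = ennreal s"
  shows "arc_param \<gamma> a b s = \<gamma> t"
proof -
  define t' where "t' = (SOME t. t \<in> {a..b} \<and> curve_length \<gamma> a t = ennreal s)"
  have t': "t' \<in> {a..b} \<and> curve_length \<gamma> a t' = ennreal s"
    unfolding t'_def by (rule someI [of _ t]) (use assms in auto)
  have "\<gamma> t' = \<gamma> t"
  proof (cases "t \<le> t'")
    case True
    then have "\<gamma> t = \<gamma> t'"
      by (intro curve_length_zero_imp_eq [of a]) (use t' assms in auto)
    then show ?thesis ..
  next
    case False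
    then show ?thesis
      by (intro curve_length_zero_imp_eq [of a]) (use t' assms in auto)
  qed
  then show ?thesis by (simp add: arc_param_def t'_def)
qed

text \<open>All later work along a curve takes place on [0, l]. The last clause carries the upper
  gradient inequality over to subarcs; there \<open>\<rho>\<close> is Borel because the integral is
  shifted by a change of variables.\<close>

lemma rectifiable_curve_arc_length:
  assumes "(\<gamma>, a, b) \<in> rectifiable_curves"
  obtains l \<sigma> where "0 < l" "\<sigma> 0 = \<gamma> a" "\<sigma> l = \<gamma> b" "\<And>s t. dist (\<sigma> s) (\<sigma> t) \<le> \<bar>s - t\<bar>"
    and "\<And>\<rho>. curve_integral \<rho> (\<gamma>, a, b) = (\<integral>\<^sup>+s\<in>{0..l}. \<rho> (\<sigma> s) \<partial>lborel)"
    and "\<And>s1 s2. 0 \<le> s1 \<Longrightarrow> s1 < s2 \<Longrightarrow> s2 \<le> l \<Longrightarrow>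
      \<exists>t1 t2. (\<gamma>, t1, t2) \<in> rectifiable_curves \<and> \<gamma> t1 = \<sigma> s1 \<and> \<gamma> t2 = \<sigma> s2 \<and>
        (\<forall>\<rho>\<in>borel_measurable borel.
          curve_integral \<rho> (\<gamma>, t1, t2) = (\<integral>\<^sup>+s\<in>{s1..s2}. \<rho> (\<sigma> s) \<partial>lborel))"
proof -
  have ab: "a \<le> b" and cont: "continuous_on {a..b} \<gamma>" and fin: "curve_length \<gamma> a b < \<infinity>"
    and nc: "\<not> \<gamma> constant_on {a..b}"
    using assms by (auto simp: rectifiable_curves_def)
  define l where "l = enn2real (curve_length \<gamma> a b)"
  have L: "curve_length \<gamma> a b = ennreal l"
    using fin by (simp add: l_def)
  have part: "curve_length \<gamma> a t + curve_length \<gamma> t b = ennreal l" if "t \<in> {a..b}" for t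
    using curve_length_additive [of a t b \<gamma>] that L by simp
  have "0 < l"
  proof (rule ccontr)
    assume "\<not> 0 < l"
    then have "l = 0"
      using enn2real_nonneg [of "curve_length \<gamma> a b"] by (simp add: l_def)
    have "\<gamma> t = \<gamma> a" if t: "t \<in> {a..b}" for t
    proof -
      have "curve_length \<gamma> a t = 0"
        using part [OF t] unfolding \<open>l = 0\<close> by simp
      then show ?thesis
        using dist_le_curve_length [of a t \<gamma>] t by simp
    qed
    then have "\<gamma> constant_on {a..b}"
      unfolding constant_on_def by (intro exI [of _ "\<gamma> a"] ballI)
    with nc show False by contradiction
  qed
  have "\<exists>t. t \<in> {a..b} \<and> curve_length \<gamma> a t = ennreal s" if "s \<in> {0..l}" for s
    using curve_length_IVT [OF cont ab fin, of "ennreal s"] that L by (auto simp: ennreal_leI)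
  then obtain \<tau> where \<tau>: "\<And>s. s \<in> {0..l} \<Longrightarrow> \<tau> s \<in> {a..b}"
    and len: "\<And>s. s \<in> {0..l} \<Longrightarrow> curve_length \<gamma> a (\<tau> s) = ennreal s"
    by metis
  have arc: "arc_param \<gamma> a b s = \<gamma> (\<tau> s)" if "s \<in> {0..l}" for s
    using \<tau> [OF that] len [OF that] by (rule arc_param_eq)
  have \<tau>_less: "\<tau> s < \<tau> s'" if "0 \<le> s" "s < s'" "s' \<le> l" for s s'
  proof (rule ccontr)
    assume "\<not> \<tau> s < \<tau> s'"
    then have "curve_length \<gamma> a (\<tau> s) = curve_length \<gamma> a (\<tau> s') + curve_length \<gamma> (\<tau> s') (\<tau> s)"
      using \<tau> [of s'] that by (intro curve_length_additive) auto
    then have "ennreal s' \<le> ennreal s"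
      using len [of s] len [of s'] that by simp
    then show False using that by simp
  qed
  have len2: "curve_length \<gamma> (\<tau> s) (\<tau> s') = ennreal (s' - s)" if "0 \<le> s" "s < s'" "s' \<le> l" for s s'
  proof -
    have "curve_length \<gamma> a (\<tau> s) + curve_length \<gamma> (\<tau> s) (\<tau> s') = curve_length \<gamma> a (\<tau> s')"
      using \<tau> [of s] \<tau>_less [OF that] that by (intro curve_length_additive [symmetric]) auto
    also have "\<dots> = ennreal s + ennreal (s' - s)"
      using that len [of s'] by (simp flip: ennreal_plus)
    finally show ?thesis
      using len [of s] that by (simp add: ennreal_add_left_cancel)
  qed
  \<comment> \<open>Clamping the parameter makes \<open>\<sigma>\<close> 1-Lipschitz on the whole
    line, hence continuous and Borel there.\<close>
  define \<sigma> where "\<sigma> s = \<gamma> (\<tau> (max 0 (min l s)))" for s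
  have \<sigma>: "\<sigma> s = \<gamma> (\<tau> s)" if "s \<in> {0..l}" for s
    using that by (simp add: \<sigma>_def min_absorb2 max_absorb2)
  have lip1: "dist (\<gamma> (\<tau> s)) (\<gamma> (\<tau> s')) \<le> s' - s" if "0 \<le> s" "s \<le> s'" "s' \<le> l" for s s'
  proof (cases "s = s'")
    case False
    then have "ennreal (dist (\<gamma> (\<tau> s)) (\<gamma> (\<tau> s'))) \<le> ennreal (s' - s)"
      using len2 [of s s'] dist_le_curve_length [of "\<tau> s" "\<tau> s'" \<gamma>] \<tau>_less [of s s'] that by simp
    then show ?thesis using that by simp
  qed simp
  have lip: "dist (\<sigma> s) (\<sigma> t) \<le> \<bar>s - t\<bar>" for s t
  proof -
    have *: "dist (\<sigma> s) (\<sigma> t) \<le> t - s" if "s \<le> t" for s t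
    proof -
      have "dist (\<sigma> s) (\<sigma> t) \<le> max 0 (min l t) - max 0 (min l s)"
        unfolding \<sigma>_def using that \<open>0 < l\<close> by (intro lip1) auto
      also have "\<dots> \<le> t - s" using that by auto
      finally show ?thesis .
    qed
    show ?thesis
      using * [of s t] * [of t s] by (cases "s \<le> t") (auto simp: dist_commute)
  qed
  have "continuous_on UNIV \<sigma>"
    using lip by (intro lipschitz_on_continuous_on [of 1] lipschitz_onI) (auto simp: dist_real_def)
  then have [measurable]: "\<sigma> \<in> borel_measurable borel"
    by (rule borel_measurable_continuous_onI)
  show thesis
  proof (rule that [of l \<sigma>])
    have "arc_param \<gamma> a b 0 = \<gamma> a" "arc_param \<gamma> a b l = \<gamma> b"
      using ab L by (auto intro!: arc_param_eq)
    then show "\<sigma> 0 = \<gamma> a" "\<sigma> l = \<gamma> b"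
      using \<open>0 < l\<close> by (simp_all add: \<sigma> arc)
    show "curve_integral \<rho> (\<gamma>, a, b) = (\<integral>\<^sup>+s\<in>{0..l}. \<rho> (\<sigma> s) \<partial>lborel)" for \<rho>
      unfolding curve_integral_def
      by (auto simp: l_def [symmetric] \<sigma> arc split: split_indicator intro!: nn_integral_cong)
    show "0 < l" by fact
    show "dist (\<sigma> s) (\<sigma> t) \<le> \<bar>s - t\<bar>" for s t by (rule lip)
    fix s1 s2 :: real assume s: "0 \<le> s1" "s1 < s2" "s2 \<le> l"
    let ?t1 = "\<tau> s1" and ?t2 = "\<tau> s2"
    have less: "?t1 < ?t2" by (rule \<tau>_less) (use s in auto)
    have in_ab: "a \<le> ?t1" "?t2 \<le> b" using \<tau> [of s1] \<tau> [of s2] s by auto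
    have len12: "curve_length \<gamma> ?t1 ?t2 = ennreal (s2 - s1)"
      using s by (rule len2)
    have "\<not> \<gamma> constant_on {?t1..?t2}"
    proof
      assume "\<gamma> constant_on {?t1..?t2}"
      then obtain x where x: "\<And>t. t \<in> {?t1..?t2} \<Longrightarrow> \<gamma> t = x" by (auto simp: constant_on_def)
      have "chord_sum \<gamma> n t = 0" if p: "partition_from ?t1 ?t2 n t" for n t
      proof -
        have "?t1 \<le> t i \<and> t i \<le> ?t2" if "i \<le> n" for i
        proof -
          have "t j \<le> t k" if "j \<le> k" "k \<le> n" for j k
            using that(1,2)
            by (induction rule: dec_induct) (use p in \<open>auto simp: partition_from_def intro: order_trans\<close>)
          from this [of 0 i] this [of i n] that p show ?thesis
            by (auto simp: partition_from_def)
        qed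
        then show ?thesis unfolding chord_sum_def by (intro sum.neutral ballI) (simp add: x)
      qed
      then have "curve_length \<gamma> ?t1 ?t2 \<le> 0" by (intro curve_length_leI) simp
      with len12 s show False by simp
    qed
    then have rect: "(\<gamma>, ?t1, ?t2) \<in> rectifiable_curves"
      using less in_ab continuous_on_subset [OF cont, of "{?t1..?t2}"]
      by (auto simp: rectifiable_curves_def len12)
    \<comment> \<open>The length function of the subarc is that of the curve minus s1, so its arc
      length parametrization is a shift of \<open>\<sigma>\<close>.\<close>
    have arc12: "arc_param \<gamma> ?t1 ?t2 r = \<sigma> (s1 + r)" if r: "r \<in> {0..s2 - s1}" for r
    proof -
      have "\<tau> (s1 + r) \<in> {?t1..?t2}"
      proof (cases "r = 0 \<or> r = s2 - s1")
        case True
        then show ?thesis using less by auto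
      next
        case False
        then show ?thesis
          using \<tau>_less [of s1 "s1 + r"] \<tau>_less [of "s1 + r" s2] s r by auto
      qed
      moreover have "curve_length \<gamma> ?t1 (\<tau> (s1 + r)) = ennreal r"
      proof (cases "r = 0")
        case False
        then show ?thesis using len2 [of s1 "s1 + r"] r s by auto
      qed simp
      ultimately have "arc_param \<gamma> ?t1 ?t2 r = \<gamma> (\<tau> (s1 + r))" by (rule arc_param_eq)
      also have "\<dots> = \<sigma> (s1 + r)" using s r by (intro \<sigma> [symmetric]) auto
      finally show ?thesis .
    qed
    have "curve_integral \<rho> (\<gamma>, ?t1, ?t2) = (\<integral>\<^sup>+s\<in>{s1..s2}. \<rho> (\<sigma> s) \<partial>lborel)"
      if [measurable]: "\<rho> \<in> borel_measurable borel" for \<rho>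
    proof -
      have "curve_integral \<rho> (\<gamma>, ?t1, ?t2) = (\<integral>\<^sup>+s\<in>{0..s2 - s1}. \<rho> (arc_param \<gamma> ?t1 ?t2 s) \<partial>lborel)"
        using s by (simp add: curve_integral_def len12)
      also have "\<dots> = (\<integral>\<^sup>+s. \<rho> (\<sigma> (s1 + 1 * s)) * indicator {s1..s2} (s1 + 1 * s) \<partial>lborel)"
        by (intro nn_integral_cong) (auto simp: arc12 split: split_indicator)
      also have "\<dots> = (\<integral>\<^sup>+s\<in>{s1..s2}. \<rho> (\<sigma> s) \<partial>lborel)"
        using nn_integral_real_affine [of "\<lambda>s. \<rho> (\<sigma> s) * indicator {s1..s2} s" 1 s1] by simp
      finally show ?thesis .
    qed
    then show "\<exists>t1 t2. (\<gamma>, t1, t2) \<in> rectifiable_curves \<and> \<gamma> t1 = \<sigma> s1 \<and> \<gamma> t2 = \<sigma> s2 \<and>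
        (\<forall>\<rho>\<in>borel_measurable borel.
          curve_integral \<rho> (\<gamma>, t1, t2) = (\<integral>\<^sup>+s\<in>{s1..s2}. \<rho> (\<sigma> s) \<partial>lborel))"
      using rect \<sigma> [of s1] \<sigma> [of s2] s by auto
  qed
qed


section \<open>Chaining on an interval\<close>

text \<open>With i0 the least index, i d < x < (i0 + N) d leaves only N values for i. The strict
  inequalities matter: closed intervals would allow N + 1.\<close>

lemma card_overlapping_translates:
  fixes d x :: real
  assumes "0 < d"
  shows "card {i. i < n \<and> real i * d < x \<and> x < real i * d + real N * d} \<le> N" (is "card ?S \<le> N")
proof (cases "?S = {}")
  case False
  have fin: "finite ?S" by simp
  define i0 where "i0 = Min ?S"
  have i0: "i0 \<in> ?S" unfolding i0_def by (rule Min_in [OF fin False])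
  have "?S \<subseteq> {i0..<i0 + N}"
  proof
    fix i assume i: "i \<in> ?S"
    have "i0 \<le> i" unfolding i0_def using fin i by (rule Min_le)
    moreover have "real i * d < real (i0 + N) * d"
      using i i0 by (auto simp: algebra_simps)
    then have "i < i0 + N" using \<open>0 < d\<close> by (simp flip: of_nat_add)
    ultimately show "i \<in> {i0..<i0 + N}" by simp
  qed
  then have "card ?S \<le> card {i0..<i0 + N}" by (intro card_mono) auto
  then show ?thesis by simp
next
  case True
  show ?thesis unfolding True by simp
qed

text \<open>The chain s, s + d, s + 2 d, ... reaches s + (l - eta) after n = (J - 1) N steps.
  Integration over s turns each step into an integral over a translate of an interval of length eta
  = N d, and every point lies in at most N of these translates. The resulting factor is r N.\<close>

lemma chaining_average:
  fixes v :: "real \<Rightarrow> real" and \<tau> :: "real \<Rightarrow> ennreal"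
  assumes [measurable]: "v \<in> borel_measurable borel" "\<tau> \<in> borel_measurable borel"
    and J: "1 \<le> J" and l: "0 < l" and \<eta>: "\<eta> = l / real J" and r: "0 < r" "r \<le> \<eta>"
    and osc: "\<And>s t. s \<in> {0..l} \<Longrightarrow> t \<in> {0..l} \<Longrightarrow> \<bar>s - t\<bar> < r \<Longrightarrow>
      ennreal \<bar>v s - v t\<bar> \<le> ennreal r * \<tau> s"
  shows "(\<integral>\<^sup>+s\<in>{0<..<\<eta>}. ennreal \<bar>v s - v (s + (l - \<eta>))\<bar> \<partial>lborel)
    \<le> ennreal (2 * \<eta>) * (\<integral>\<^sup>+s\<in>{0..l}. \<tau> s \<partial>lborel)"
proof -
  \<comment> \<open>Adding 1 to the floor makes d strictly smaller than r, as \<open>osc\<close>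
    demands. Since N d = eta and l = J eta, the chain ends exactly at s + (l - eta).\<close>
  define N where "N = nat \<lfloor>\<eta> / r\<rfloor> + 1"
  define d where "d = \<eta> / real N"
  define n where "n = (J - 1) * N"
  have "0 < \<eta>" using r by simp
  have N: "\<eta> / r < real N" "real N \<le> \<eta> / r + 1"
  proof -
    have "real (nat \<lfloor>\<eta> / r\<rfloor>) = of_int \<lfloor>\<eta> / r\<rfloor>" using \<open>0 < \<eta>\<close> r by simp
    then show "\<eta> / r < real N" "real N \<le> \<eta> / r + 1"
      unfolding N_def by linarith+
  qed
  have N0: "0 < real N" by (simp add: N_def)
  have dr: "d < r" using N N0 r by (simp add: d_def field_simps)
  have "0 < d" using N0 \<open>0 < \<eta>\<close> by (simp add: d_def)
  \<comment> \<open>Origin of the factor 2: rounding up costs at most one further step, which is at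
    most eta / r.\<close>
  have "1 \<le> \<eta> / r" using r by simp
  then have "real N \<le> 2 * (\<eta> / r)" using N by linarith
  then have rN: "r * real N \<le> 2 * \<eta>" using r by (simp add: field_simps)
  have Nd: "real N * d = \<eta>" using N0 by (simp add: d_def)
  have l_eq: "l = real J * \<eta>" using J by (simp add: \<eta>)
  have nd: "real n * d = l - \<eta>"
    using J by (simp add: n_def l_eq Nd [symmetric] of_nat_diff algebra_simps)
  have id: "real i * d + \<eta> \<le> l" if "i < n" for i
  proof -
    have "real i * d \<le> real n * d" using that \<open>0 < d\<close> by simp
    then show ?thesis using nd by simp
  qed
  have chain: "ennreal \<bar>v s - v (s + real k * d)\<bar> \<le> (\<Sum>i<k. ennreal r * \<tau> (s + real i * d))"
    if s: "0 < s" "s < \<eta>" and "k \<le> n" for s k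
    using \<open>k \<le> n\<close>
  proof (induction k)
    case (Suc k)
    have "s + real k * d \<in> {0..l}" "s + real (Suc k) * d \<in> {0..l}"
    proof -
      have "real (Suc k) * d \<le> real n * d" "real k * d \<le> real n * d" using Suc.prems \<open>0 < d\<close> by simp_all
      then show "s + real k * d \<in> {0..l}" "s + real (Suc k) * d \<in> {0..l}"
        using nd s \<open>0 < d\<close> by auto
    qed
    then have step: "ennreal \<bar>v (s + real k * d) - v (s + real (Suc k) * d)\<bar> \<le> ennreal r * \<tau> (s + real k * d)"
      using dr \<open>0 < d\<close> by (intro osc) (auto simp: algebra_simps)
    have "ennreal \<bar>v s - v (s + real (Suc k) * d)\<bar>
        \<le> ennreal (\<bar>v s - v (s + real k * d)\<bar> + \<bar>v (s + real k * d) - v (s + real (Suc k) * d)\<bar>)"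
      by (intro ennreal_leI) linarith
    also have "\<dots> = ennreal \<bar>v s - v (s + real k * d)\<bar> + ennreal \<bar>v (s + real k * d) - v (s + real (Suc k) * d)\<bar>"
      by simp
    also have "\<dots> \<le> (\<Sum>i<k. ennreal r * \<tau> (s + real i * d)) + ennreal r * \<tau> (s + real k * d)"
      using Suc.prems by (intro add_mono Suc.IH step) simp
    finally show ?case by simp
  qed simp
  have "(\<integral>\<^sup>+s\<in>{0<..<\<eta>}. ennreal \<bar>v s - v (s + (l - \<eta>))\<bar> \<partial>lborel)
      \<le> (\<integral>\<^sup>+s. (\<Sum>i<n. ennreal r * (\<tau> (s + real i * d) * indicator {0<..<\<eta>} s)) \<partial>lborel)"
    using chain [of _ n] unfolding nd
    by (intro nn_integral_mono) (auto split: split_indicator)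
  also have "\<dots> = (\<Sum>i<n. ennreal r * (\<integral>\<^sup>+s. \<tau> (s + real i * d) * indicator {0<..<\<eta>} s \<partial>lborel))"
    by (simp add: nn_integral_sum nn_integral_cmult)
  also have "\<dots> = (\<Sum>i<n. ennreal r * (\<integral>\<^sup>+x. \<tau> x * indicator {real i * d<..<real i * d + \<eta>} x \<partial>lborel))"
  proof (intro sum.cong refl arg_cong2 [where f = "(*)"])
    fix i
    have "(\<integral>\<^sup>+x. \<tau> x * indicator {real i * d<..<real i * d + \<eta>} x \<partial>lborel)
        = (\<integral>\<^sup>+s. \<tau> (real i * d + 1 * s) * indicator {real i * d<..<real i * d + \<eta>} (real i * d + 1 * s) \<partial>lborel)"
      using nn_integral_real_affine [of "\<lambda>x. \<tau> x * indicator {real i * d<..<real i * d + \<eta>} x" 1 "real i * d"]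
      by simp
    also have "\<dots> = (\<integral>\<^sup>+s. \<tau> (s + real i * d) * indicator {0<..<\<eta>} s \<partial>lborel)"
      by (intro nn_integral_cong) (auto simp: add.commute split: split_indicator)
    finally show "(\<integral>\<^sup>+s. \<tau> (s + real i * d) * indicator {0<..<\<eta>} s \<partial>lborel)
      = (\<integral>\<^sup>+x. \<tau> x * indicator {real i * d<..<real i * d + \<eta>} x \<partial>lborel)" ..
  qed
  also have "\<dots> = ennreal r * (\<integral>\<^sup>+x. (\<Sum>i<n. \<tau> x * indicator {real i * d<..<real i * d + \<eta>} x) \<partial>lborel)"
    by (subst nn_integral_sum) (measurable, simp only: sum_distrib_left)
  also have "\<dots> \<le> ennreal r * (\<integral>\<^sup>+x. ennreal (real N) * (\<tau> x * indicator {0..l} x) \<partial>lborel)"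
  proof (intro mult_left_mono nn_integral_mono)
    fix x
    have "(\<Sum>i<n. indicator {real i * d<..<real i * d + \<eta>} x) \<le> (ennreal (real N) * indicator {0..l} x :: ennreal)"
    proof (cases "x \<in> {0..l}")
      case True
      have "(\<Sum>i<n. indicator {real i * d<..<real i * d + \<eta>} x :: ennreal)
          = (\<Sum>i<n. if real i * d < x \<and> x < real i * d + real N * d then 1 else 0)"
        by (intro sum.cong) (auto simp: Nd)
      also have "\<dots> = of_nat (card {i. i < n \<and> real i * d < x \<and> x < real i * d + real N * d})"
        by (subst sum.inter_filter [symmetric]) (auto simp: Collect_conj_eq lessThan_def)
      also have "\<dots> \<le> of_nat N"
        using card_overlapping_translates [OF \<open>0 < d\<close>] by (intro of_nat_mono)
      finally show ?thesis using True by (simp add: ennreal_of_nat_eq_real_of_nat)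
    next
      case False
      have "x \<notin> {real i * d<..<real i * d + \<eta>}" if "i < n" for i
      proof -
        have "0 \<le> real i * d" using \<open>0 < d\<close> by simp
        then show ?thesis using id [OF that] False by auto
      qed
      then have "(\<Sum>i<n. indicator {real i * d<..<real i * d + \<eta>} x :: ennreal) = 0"
        by (intro sum.neutral) auto
      then show ?thesis by simp
    qed
    then have "\<tau> x * (\<Sum>i<n. indicator {real i * d<..<real i * d + \<eta>} x) \<le> \<tau> x * (ennreal (real N) * indicator {0..l} x)"
      by (rule mult_left_mono) simp
    then show "(\<Sum>i<n. \<tau> x * indicator {real i * d<..<real i * d + \<eta>} x) \<le> ennreal (real N) * (\<tau> x * indicator {0..l} x)"
      by (simp add: sum_distrib_left mult_ac)
  qed simp
  also have "\<dots> = ennreal (r * real N) * (\<integral>\<^sup>+x\<in>{0..l}. \<tau> x \<partial>lborel)"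
    using r by (simp add: nn_integral_cmult ennreal_mult mult.assoc)
  also have "\<dots> \<le> ennreal (2 * \<eta>) * (\<integral>\<^sup>+x\<in>{0..l}. \<tau> x \<partial>lborel)"
    using rN by (intro mult_right_mono ennreal_leI) auto
  finally show ?thesis .
qed

text \<open>Fatou's lemma treats the oscillation of the limit w, reverse Fatou the right hand side.
  The values w 0 and w l need not be limits of the v j, so they are compared with w s and w (s + D)
  for s near 0, at the price of the integrals of G over two end pieces.\<close>

lemma chaining_limit:
  fixes w :: "real \<Rightarrow> real" and v :: "nat \<Rightarrow> real \<Rightarrow> real" and \<tau> :: "nat \<Rightarrow> real \<Rightarrow> ennreal"
  assumes [measurable]: "w \<in> borel_measurable borel" "\<And>j. v j \<in> borel_measurable borel"
      "\<And>j. \<tau> j \<in> borel_measurable borel" "G \<in> borel_measurable borel" "\<Phi> \<in> borel_measurable borel"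
      "E \<in> sets borel"
    and l: "0 < l" and r: "\<And>j. 0 < r j" "r \<longlonglongrightarrow> 0"
    and osc: "\<And>j s t. s \<in> {0..l} \<Longrightarrow> t \<in> {0..l} \<Longrightarrow> \<bar>s - t\<bar> < r j \<Longrightarrow>
      ennreal \<bar>v j s - v j t\<bar> \<le> ennreal (r j) * \<tau> j s"
    and null: "AE s in lborel. s \<notin> E \<inter> {0..l}"
    and lim: "\<And>s. s \<in> {0..l} \<Longrightarrow> s \<notin> E \<Longrightarrow> (\<lambda>j. v j s) \<longlonglongrightarrow> w s"
    and G: "(\<integral>\<^sup>+s\<in>{0..l}. G s \<partial>lborel) < \<infinity>" 
    and \<Phi>: "(\<integral>\<^sup>+s\<in>{0..l}. \<Phi> s \<partial>lborel) < \<infinity>" "\<And>j s. s \<in> {0..l} \<Longrightarrow> \<tau> j s \<le> \<Phi> s"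
    and wG: "\<And>s t. 0 \<le> s \<Longrightarrow> s < t \<Longrightarrow> t \<le> l \<Longrightarrow> ennreal \<bar>w s - w t\<bar> \<le> (\<integral>\<^sup>+x\<in>{s..t}. G x \<partial>lborel)"
  shows "ennreal \<bar>w 0 - w l\<bar> \<le> 2 * (\<integral>\<^sup>+s\<in>{0..l}. limsup (\<lambda>j. \<tau> j s) \<partial>lborel)"
proof -
  define H where "H = (\<integral>\<^sup>+s\<in>{0..l}. limsup (\<lambda>j. \<tau> j s) \<partial>lborel)"
  define \<omega> where "\<omega> J = (\<integral>\<^sup>+x\<in>{0..l / real (Suc J)}. G x \<partial>lborel) +
    (\<integral>\<^sup>+x\<in>{l - l / real (Suc J)..l}. G x \<partial>lborel)" for J
  have "limsup (\<lambda>j. \<integral>\<^sup>+s\<in>{0..l}. \<tau> j s \<partial>lborel) \<le> (\<integral>\<^sup>+s. limsup (\<lambda>j. \<tau> j s * indicator {0..l} s) \<partial>lborel)"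
    by (rule nn_integral_limsup [of _ _ "\<lambda>s. \<Phi> s * indicator {0..l} s"])
      (use \<Phi> in \<open>auto split: split_indicator\<close>)
  also have "\<dots> = H"
    unfolding H_def by (intro nn_integral_cong) (auto simp: Limsup_const split: split_indicator)
  finally have limsup_le: "limsup (\<lambda>j. \<integral>\<^sup>+s\<in>{0..l}. \<tau> j s \<partial>lborel) \<le> H" .
  have bound: "ennreal \<bar>w 0 - w l\<bar> \<le> \<omega> J + 2 * H" for J
  proof -
    define \<eta> where "\<eta> = l / real (Suc J)"
    have \<eta>: "0 < \<eta>" "\<eta> \<le> l" using l by (auto simp: \<eta>_def field_simps)
    define D where "D = l - \<eta>"
    have D: "0 \<le> D" "D + \<eta> = l" using \<eta> by (auto simp: D_def)
    \<comment> \<open>Translates of null sets are null, so for almost every s both s and s + D avoid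
      the exceptional set.\<close>
    have "AE s in lborel. D + 1 * s \<notin> E \<inter> {0..l}"
      by (rule AE_borel_affine [OF _ _ null]) auto
    with null have ae: "AE s in lborel. ennreal \<bar>w s - w (s + D)\<bar> * indicator {0<..<\<eta>} s
        = liminf (\<lambda>j. ennreal \<bar>v j s - v j (s + D)\<bar> * indicator {0<..<\<eta>} s)"
    proof eventually_elim
      case (elim s)
      show ?case
      proof (cases "s \<in> {0<..<\<eta>}")
        case True
        then have "s \<in> {0..l}" "s + D \<in> {0..l}" using D \<eta> by auto
        with elim have "(\<lambda>j. v j s) \<longlonglongrightarrow> w s" "(\<lambda>j. v j (s + D)) \<longlonglongrightarrow> w (s + D)"
          by (auto intro!: lim simp: add.commute)
        then have "(\<lambda>j. ennreal \<bar>v j s - v j (s + D)\<bar>) \<longlonglongrightarrow> ennreal \<bar>w s - w (s + D)\<bar>"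
          by (intro tendsto_ennrealI tendsto_intros)
        then have "liminf (\<lambda>j. ennreal \<bar>v j s - v j (s + D)\<bar>) = ennreal \<bar>w s - w (s + D)\<bar>"
          by (intro lim_imp_Liminf) simp
        then show ?thesis using True by simp
      qed (simp add: Liminf_const)
    qed
    have "(\<integral>\<^sup>+s\<in>{0<..<\<eta>}. ennreal \<bar>w s - w (s + D)\<bar> \<partial>lborel)
        = (\<integral>\<^sup>+s. liminf (\<lambda>j. ennreal \<bar>v j s - v j (s + D)\<bar> * indicator {0<..<\<eta>} s) \<partial>lborel)"
      by (rule nn_integral_cong_AE [OF ae])
    also have "\<dots> \<le> liminf (\<lambda>j. \<integral>\<^sup>+s\<in>{0<..<\<eta>}. ennreal \<bar>v j s - v j (s + D)\<bar> \<partial>lborel)"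
      by (intro nn_integral_liminf) measurable
    also have "\<dots> \<le> liminf (\<lambda>j. ennreal (2 * \<eta>) * (\<integral>\<^sup>+s\<in>{0..l}. \<tau> j s \<partial>lborel))"
    proof (rule Liminf_mono)
      have "\<forall>\<^sub>F j in sequentially. r j < \<eta>"
        using r(2) \<eta>(1) by (rule order_tendstoD)
      then show "\<forall>\<^sub>F j in sequentially. (\<integral>\<^sup>+s\<in>{0<..<\<eta>}. ennreal \<bar>v j s - v j (s + D)\<bar> \<partial>lborel)
          \<le> ennreal (2 * \<eta>) * (\<integral>\<^sup>+s\<in>{0..l}. \<tau> j s \<partial>lborel)"
      proof eventually_elim
        case (elim j)
        show ?case
          unfolding D_def using elim osc [of _ _ j]
          by (intro chaining_average [where J = "Suc J" and r = "r j"]) (auto simp: \<eta>_def l r)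
      qed
    qed
    also have "\<dots> \<le> limsup (\<lambda>j. ennreal (2 * \<eta>) * (\<integral>\<^sup>+s\<in>{0..l}. \<tau> j s \<partial>lborel))"
      by (rule Liminf_le_Limsup) simp
    also have "\<dots> = ennreal (2 * \<eta>) * limsup (\<lambda>j. \<integral>\<^sup>+s\<in>{0..l}. \<tau> j s \<partial>lborel)"
      by (rule Limsup_compose_continuous_mono)
        (auto intro!: ennreal_continuous_on_cmult continuous_on_id monoI mult_left_mono)
    also have "\<dots> \<le> ennreal (2 * \<eta>) * H" by (intro mult_left_mono limsup_le) simp
    finally have main: "(\<integral>\<^sup>+s\<in>{0<..<\<eta>}. ennreal \<bar>w s - w (s + D)\<bar> \<partial>lborel) \<le> ennreal (2 * \<eta>) * H" .
    have pt: "ennreal \<bar>w 0 - w l\<bar> \<le> \<omega> J + ennreal \<bar>w s - w (s + D)\<bar>" if s: "s \<in> {0<..<\<eta>}" for s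
    proof -
      have "ennreal \<bar>w 0 - w s\<bar> \<le> (\<integral>\<^sup>+x\<in>{0..s}. G x \<partial>lborel)"
        using s \<eta> by (intro wG) auto
      also have "\<dots> \<le> (\<integral>\<^sup>+x\<in>{0..\<eta>}. G x \<partial>lborel)"
        using s by (intro nn_integral_mono) (auto split: split_indicator)
      finally have 1: "ennreal \<bar>w 0 - w s\<bar> \<le> (\<integral>\<^sup>+x\<in>{0..\<eta>}. G x \<partial>lborel)" .
      have "ennreal \<bar>w (s + D) - w l\<bar> \<le> (\<integral>\<^sup>+x\<in>{s + D..l}. G x \<partial>lborel)"
        using s \<eta> D by (intro wG) auto
      also have "\<dots> \<le> (\<integral>\<^sup>+x\<in>{l - \<eta>..l}. G x \<partial>lborel)"
        using s D by (intro nn_integral_mono) (auto split: split_indicator)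
      finally have 2: "ennreal \<bar>w (s + D) - w l\<bar> \<le> (\<integral>\<^sup>+x\<in>{l - \<eta>..l}. G x \<partial>lborel)" .
      have "ennreal \<bar>w 0 - w l\<bar> \<le> ennreal (\<bar>w 0 - w s\<bar> + \<bar>w (s + D) - w l\<bar> + \<bar>w s - w (s + D)\<bar>)"
        by (intro ennreal_leI) linarith
      also have "\<dots> = ennreal \<bar>w 0 - w s\<bar> + ennreal \<bar>w (s + D) - w l\<bar> + ennreal \<bar>w s - w (s + D)\<bar>"
        by simp
      also have "\<dots> \<le> \<omega> J + ennreal \<bar>w s - w (s + D)\<bar>"
        unfolding \<omega>_def \<eta>_def [symmetric] by (intro add_mono 1 2 order_refl)
      finally show ?thesis .
    qed
    have const: "(\<integral>\<^sup>+s\<in>{0<..<\<eta>}. c \<partial>lborel) = ennreal \<eta> * c" for c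
      using \<eta> by (simp add: nn_integral_cmult_indicator mult.commute)
    \<comment> \<open>Averaging the pointwise bound over s; the factor eta cancels in the
      end.\<close>
    have "ennreal \<eta> * ennreal \<bar>w 0 - w l\<bar> = (\<integral>\<^sup>+s\<in>{0<..<\<eta>}. ennreal \<bar>w 0 - w l\<bar> \<partial>lborel)"
      by (simp add: const)
    also have "\<dots> \<le> (\<integral>\<^sup>+s. \<omega> J * indicator {0<..<\<eta>} s + ennreal \<bar>w s - w (s + D)\<bar> * indicator {0<..<\<eta>} s \<partial>lborel)"
      using pt by (intro nn_integral_mono) (auto split: split_indicator)
    also have "\<dots> = ennreal \<eta> * \<omega> J + (\<integral>\<^sup>+s\<in>{0<..<\<eta>}. ennreal \<bar>w s - w (s + D)\<bar> \<partial>lborel)"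
      by (subst nn_integral_add) (auto simp: const)
    also have "\<dots> \<le> ennreal \<eta> * \<omega> J + ennreal (2 * \<eta>) * H"
      by (intro add_left_mono main)
    also have "\<dots> = ennreal \<eta> * (\<omega> J + 2 * H)"
      using \<eta> by (simp add: ennreal_mult distrib_left mult_ac)
    finally show ?thesis
      using \<eta> by (simp add: ennreal_mult_le_mult_iff)
  qed
  \<comment> \<open>The end pieces shrink to the points 0 and l, which are Lebesgue null, and G is
    an integrable majorant.\<close>
  have "(\<lambda>J. \<integral>\<^sup>+x\<in>{0..l / real (Suc J)}. G x \<partial>lborel) \<longlonglongrightarrow> (\<integral>\<^sup>+x. 0 \<partial>(lborel :: real measure))"
  proof (rule nn_integral_dominated_convergence [where w = "\<lambda>x. G x * indicator {0..l} x" and u' = "\<lambda>x. 0"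
        and u = "\<lambda>J x. G x * indicator {0..l / real (Suc J)} x"])
    have le: "l / real (Suc J) \<le> l" for J using l by (simp add: field_simps)
    show "AE x in lborel. G x * indicator {0..l / real (Suc J)} x \<le> G x * indicator {0..l} x" for J
      using le [of J] by (auto split: split_indicator)
    have conv: "(\<lambda>J. l / real (Suc J)) \<longlonglongrightarrow> 0"
      by (rule LIMSEQ_Suc) (rule lim_const_over_n)
    show "AE x in lborel. (\<lambda>J. G x * indicator {0..l / real (Suc J)} x) \<longlonglongrightarrow> 0"
      using AE_lborel_singleton [of 0]
    proof eventually_elim
      case (elim x)
      have "\<forall>\<^sub>F J in sequentially. x \<notin> {0..l / real (Suc J)}"
      proof (cases "x < 0")
        case False
        then have "\<forall>\<^sub>F J in sequentially. l / real (Suc J) < x"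
          using elim by (intro order_tendstoD(2) [OF conv]) auto
        then show ?thesis by eventually_elim auto
      qed auto
      then have "\<forall>\<^sub>F J in sequentially. G x * indicator {0..l / real (Suc J)} x = 0"
        by eventually_elim auto
      then show ?case by (rule tendsto_eventually)
    qed
  qed (use G in auto)
  moreover have "(\<lambda>J. \<integral>\<^sup>+x\<in>{l - l / real (Suc J)..l}. G x \<partial>lborel) \<longlonglongrightarrow> (\<integral>\<^sup>+x. 0 \<partial>(lborel :: real measure))"
  proof (rule nn_integral_dominated_convergence [where w = "\<lambda>x. G x * indicator {0..l} x" and u' = "\<lambda>x. 0"
        and u = "\<lambda>J x. G x * indicator {l - l / real (Suc J)..l} x"])
    have le: "l / real (Suc J) \<le> l" for J using l by (simp add: field_simps)
    show "AE x in lborel. G x * indicator {l - l / real (Suc J)..l} x \<le> G x * indicator {0..l} x" for J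
      using le [of J] by (auto split: split_indicator)
    have conv: "(\<lambda>J. l - l / real (Suc J)) \<longlonglongrightarrow> l - 0"
      by (intro tendsto_diff tendsto_const) (rule LIMSEQ_Suc, rule lim_const_over_n)
    show "AE x in lborel. (\<lambda>J. G x * indicator {l - l / real (Suc J)..l} x) \<longlonglongrightarrow> 0"
      using AE_lborel_singleton [of l]
    proof eventually_elim
      case (elim x)
      have "\<forall>\<^sub>F J in sequentially. x \<notin> {l - l / real (Suc J)..l}"
      proof (cases "l < x")
        case False
        then have "\<forall>\<^sub>F J in sequentially. x < l - l / real (Suc J)"
          using elim by (intro order_tendstoD(1) [OF conv]) auto
        then show ?thesis by eventually_elim auto
      qed auto
      then have "\<forall>\<^sub>F J in sequentially. G x * indicator {l - l / real (Suc J)..l} x = 0"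
        by eventually_elim auto
      then show ?case by (rule tendsto_eventually)
    qed
  qed (use G in auto)
  ultimately have "(\<lambda>J. \<omega> J + 2 * H) \<longlonglongrightarrow> 0 + 0 + 2 * H"
    unfolding \<omega>_def by (intro tendsto_intros) auto
  then have "ennreal \<bar>w 0 - w l\<bar> \<le> 0 + 0 + 2 * H"
    by (rule tendsto_lowerbound) (use bound in auto)
  then show ?thesis by (simp add: H_def)
qed


section \<open>Regularity of finite Borel measures and Vitali covering\<close>

text \<open>The sets with this approximation property form a sigma-algebra containing the closed
  sets. Complementation exchanges the inner and the outer set, so both must be carried through the
  induction.\<close>

lemma finite_borel_measure_regular:
  fixes N :: "'a::metric_space measure"
  assumes sets: "sets N = sets borel" and fin: "emeasure N UNIV < \<infinity>" and B: "B \<in> sets borel" and "0 < (e::real)"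
  shows "\<exists>F U. closed F \<and> open U \<and> F \<subseteq> B \<and> B \<subseteq> U \<and> emeasure N (U - F) < ennreal e"
proof -
  have [measurable_cong]: "sets N = sets borel" by (rule sets)
  have finite: "emeasure N A \<noteq> \<infinity>" for A
    using emeasure_mono [of A UNIV N] fin by (auto simp: sets top_unique)
  have "B \<in> sigma_sets UNIV (Collect closed)"
    using B by (simp add: borel_eq_closed)
  then show ?thesis
    using \<open>0 < e\<close>
  proof (induction arbitrary: e)
    case (Basic C)
    show ?case
    \<comment> \<open>By convention \<open>infdist\<close> to the empty set is 0, so the
      neighbourhoods used below would not shrink to it.\<close>
    proof (cases "C = {}")
      case True
      then show ?thesis using Basic by (intro exI [of _ "{}"]) auto
    next
      case False
      define U where "U n = {x. infdist x C < 1 / real (Suc n)}" for n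
      have "open (U n)" for n
        unfolding U_def by (intro open_Collect_less continuous_intros)
      have "closed C" using Basic by simp
      have "(\<Inter>n. U n - C) = {}"
      proof (rule ccontr)
        assume "(\<Inter>n. U n - C) \<noteq> {}"
        then obtain x where x: "\<And>n. infdist x C < 1 / real (Suc n)" "x \<notin> C"
          by (auto simp: U_def)
        have "0 < infdist x C"
          using x(2) \<open>closed C\<close> False by (metis in_closed_iff_infdist_zero infdist_nonneg order_le_less)
        then obtain n where "1 / real (Suc n) < infdist x C" using nat_approx_posE by blast
        with x(1) [of n] show False by simp
      qed
      then have "emeasure N (\<Inter>n. U n - C) < ennreal e"
        using Basic.prems by (simp del: INT_simps INF_eq_bot_iff)
      moreover have "(\<lambda>n. emeasure N (U n - C)) \<longlonglongrightarrow> emeasure N (\<Inter>n. U n - C)"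
      proof (rule Lim_emeasure_decseq)
        show "range (\<lambda>n. U n - C) \<subseteq> sets N"
          using \<open>closed C\<close> \<open>\<And>n. open (U n)\<close> by (auto simp: sets)
        show "decseq (\<lambda>n. U n - C)"
        proof (rule decseq_SucI)
          fix n
          have "1 / real (Suc (Suc n)) \<le> 1 / real (Suc n)" by (simp add: field_simps)
          then show "U (Suc n) - C \<subseteq> U n - C" by (force simp: U_def)
        qed
      qed (rule finite)
      ultimately have "\<forall>\<^sub>F n in sequentially. emeasure N (U n - C) < ennreal e"
        by (intro order_tendstoD(2))
      then obtain n where "emeasure N (U n - C) < ennreal e"
        by (auto simp: eventually_sequentially)
      moreover have "C \<subseteq> U n" by (auto simp: U_def)
      ultimately show ?thesis
        using \<open>closed C\<close> \<open>open (U n)\<close> by blast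
    qed
  next
    case Empty
    then show ?case by (intro exI [of _ "{}"]) auto
  next
    case (Compl A)
    obtain F U where FU: "closed F" "open U" "F \<subseteq> A" "A \<subseteq> U" "emeasure N (U - F) < ennreal e"
      using Compl.IH [OF Compl.prems] by (elim exE conjE)
    moreover have "- F - - U = U - F" by auto
    ultimately show ?case
      by (intro exI [of _ "- U"] exI [of _ "- F"]) (auto simp: closed_Compl open_Compl Compl_eq_Diff_UNIV [symmetric])
  next
    case (Union A)
    \<comment> \<open>A union of infinitely many closed sets need not be closed. The errors sum to e
      / 2, which leaves room to keep only finitely many \<open>F i\<close> by continuity from
      above.\<close>
    have "\<exists>F U. closed F \<and> open U \<and> F \<subseteq> A i \<and> A i \<subseteq> U \<and> emeasure N (U - F) < ennreal (e / 2 * (1 / 2) ^ Suc i)" for i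
      using Union.prems by (intro Union.IH) auto
    then obtain F U where FU: "\<And>i. closed (F i)" "\<And>i. open (U i)" "\<And>i. F i \<subseteq> A i" "\<And>i. A i \<subseteq> U i"
        and less: "\<And>i. emeasure N (U i - F i) < ennreal (e / 2 * (1 / 2) ^ Suc i)"
      by metis
    have [measurable]: "F i \<in> sets borel" "U i \<in> sets borel" for i
      using FU by auto
    let ?D = "\<lambda>n. (\<Union>i. U i) - (\<Union>i<n. F i)"
    have "emeasure N ((\<Union>i. U i) - (\<Union>i. F i)) \<le> emeasure N (\<Union>i. U i - F i)"
      by (intro emeasure_mono) auto
    also have "\<dots> \<le> (\<Sum>i. emeasure N (U i - F i))"
      by (intro emeasure_subadditive_countably) auto
    also have "\<dots> \<le> (\<Sum>i. ennreal (e / 2 * (1 / 2) ^ Suc i))"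
      using less by (intro suminf_le less_imp_le) auto
    also have "\<dots> = ennreal (e / 2)"
      using sums_mult [OF power_half_series, of "e / 2"] Union.prems
      by (intro suminf_ennreal_eq) auto
    also have "\<dots> < ennreal e"
      using Union.prems by (intro ennreal_lessI) auto
    finally have lt: "emeasure N ((\<Union>i. U i) - (\<Union>i. F i)) < ennreal e" .
    have "(\<lambda>n. emeasure N (?D n)) \<longlonglongrightarrow> emeasure N (\<Inter>n. ?D n)"
    proof (rule Lim_emeasure_decseq)
      show "range ?D \<subseteq> sets N" by auto
      show "decseq ?D" by (rule decseq_SucI) auto
    qed (rule finite)
    moreover have "(\<Inter>n. ?D n) = (\<Union>i. U i) - (\<Union>i. F i)" by auto
    ultimately have "\<forall>\<^sub>F n in sequentially. emeasure N (?D n) < ennreal e"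
      using lt by (intro order_tendstoD(2)) auto
    then obtain n where n: "emeasure N (?D n) < ennreal e"
      by (auto simp: eventually_sequentially)
    have "closed (\<Union>i<n. F i)" "open (\<Union>i. U i)" using FU by auto
    moreover have "(\<Union>i<n. F i) \<subseteq> (\<Union>i. A i)" "(\<Union>i. A i) \<subseteq> (\<Union>i. U i)"
      by (intro UN_mono FU subset_UNIV)+
    ultimately show ?case
      by (intro exI [of _ "\<Union>i<n. F i"] exI [of _ "\<Union>i. U i"] conjI n)
  qed
qed

text \<open>Zorn's lemma is applied to disjoint families such that every ball of I meeting the
  family meets a member of at least half its radius. The fivefold dilate of that member contains the
  ball, since r i + r i + r j <= 5 r j.\<close>

lemma vitali_covering:
  fixes c :: "'i \<Rightarrow> 'a::metric_space"
  assumes r: "\<And>i. i \<in> I \<Longrightarrow> 0 < r i" "\<And>i. i \<in> I \<Longrightarrow> r i \<le> (R :: real)"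
  obtains D where "D \<subseteq> I" "disjoint_family_on (\<lambda>i. ball (c i) (r i)) D"
    and "\<And>i. i \<in> I \<Longrightarrow> \<exists>j\<in>D. ball (c i) (r i) \<subseteq> ball (c j) (5 * r j)"
proof -
  let ?B = "\<lambda>i. ball (c i) (r i)"
  define \<Omega> where "\<Omega> = {D. D \<subseteq> I \<and> disjoint_family_on ?B D \<and>
    (\<forall>i\<in>I. (\<exists>j\<in>D. ?B i \<inter> ?B j \<noteq> {}) \<longrightarrow> (\<exists>j\<in>D. ?B i \<inter> ?B j \<noteq> {} \<and> r i \<le> 2 * r j))}"
  have "\<exists>M\<in>\<Omega>. \<forall>X\<in>\<Omega>. M \<subseteq> X \<longrightarrow> X = M"
  proof (rule subset_Zorn_nonempty)
    have "{} \<in> \<Omega>" by (auto simp: \<Omega>_def disjoint_family_on_def)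
    then show "\<Omega> \<noteq> {}" by blast
    fix \<C> assume "\<C> \<noteq> {}" and chain: "subset.chain \<Omega> \<C>"
    have sub: "D \<in> \<Omega>" if "D \<in> \<C>" for D using chain that by (auto simp: subset_chain_def)
    have "disjoint_family_on ?B (\<Union>\<C>)"
      unfolding disjoint_family_on_def
    proof (intro ballI impI)
      fix i j assume ij: "i \<in> \<Union>\<C>" "j \<in> \<Union>\<C>" "i \<noteq> j"
      then obtain D D' where "D \<in> \<C>" "i \<in> D" "D' \<in> \<C>" "j \<in> D'" by blast
      then obtain D'' where "D'' \<in> \<C>" "i \<in> D''" "j \<in> D''"
        using chain unfolding subset_chain_def by blast
      then show "?B i \<inter> ?B j = {}"
        using sub [of D''] ij(3) by (auto simp: \<Omega>_def disjoint_family_on_def)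
    qed
    moreover have "\<Union>\<C> \<subseteq> I"
    proof (rule Union_least)
      fix D assume "D \<in> \<C>"
      from sub [OF this] show "D \<subseteq> I" by (simp add: \<Omega>_def)
    qed
    moreover have "\<exists>j\<in>\<Union>\<C>. ?B i \<inter> ?B j \<noteq> {} \<and> r i \<le> 2 * r j"
      if "i \<in> I" "\<exists>j\<in>\<Union>\<C>. ?B i \<inter> ?B j \<noteq> {}" for i
    proof -
      from that obtain D where "D \<in> \<C>" "\<exists>j\<in>D. ?B i \<inter> ?B j \<noteq> {}" by blast
      with sub [of D] \<open>i \<in> I\<close> show ?thesis unfolding \<Omega>_def by blast
    qed
    ultimately show "\<Union>\<C> \<in> \<Omega>" unfolding \<Omega>_def by blast
  qed
  then obtain D where D: "D \<in> \<Omega>" and max: "\<And>X. X \<in> \<Omega> \<Longrightarrow> D \<subseteq> X \<Longrightarrow> X = D" by blast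
  have DI: "D \<subseteq> I" and disj: "disjoint_family_on ?B D"
    and big: "\<And>i. i \<in> I \<Longrightarrow> \<exists>j\<in>D. ?B i \<inter> ?B j \<noteq> {} \<Longrightarrow> \<exists>j\<in>D. ?B i \<inter> ?B j \<noteq> {} \<and> r i \<le> 2 * r j"
    using D unfolding \<Omega>_def by blast+
  \<comment> \<open>If some balls missed the maximal family, one of them with more than half the
    supremal radius could be added to it. The bound R makes the supremum finite.\<close>
  define S where "S = {i\<in>I. \<forall>j\<in>D. ?B i \<inter> ?B j = {}}"
  have "S = {}"
  proof (rule ccontr)
    assume "S \<noteq> {}"
    have bdd: "bdd_above (r ` S)" using r by (intro bdd_aboveI [of _ R]) (auto simp: S_def)
    have pos: "0 < r i" if "i \<in> S" for i using that r by (auto simp: S_def)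
    have "Sup (r ` S) / 2 < Sup (r ` S)"
    proof -
      obtain i where "i \<in> S" using \<open>S \<noteq> {}\<close> by blast
      then have "0 < Sup (r ` S)"
        using pos [of i] bdd by (intro less_le_trans [OF _ cSup_upper [of "r i"]]) auto
      then show ?thesis by simp
    qed
    then obtain i0 where i0: "i0 \<in> S" "Sup (r ` S) / 2 < r i0"
      using less_cSupD [of "r ` S" "Sup (r ` S) / 2"] \<open>S \<noteq> {}\<close> by blast
    have half: "r i \<le> 2 * r i0" if "i \<in> S" for i
    proof -
      have "r i \<le> Sup (r ` S)" using that bdd by (intro cSup_upper) auto
      then show ?thesis using i0 by simp
    qed
    have i0I: "i0 \<in> I" and i0D: "\<And>j. j \<in> D \<Longrightarrow> ?B i0 \<inter> ?B j = {}"
      using i0 by (auto simp: S_def)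
    have "insert i0 D \<in> \<Omega>"
      unfolding \<Omega>_def
    proof (intro CollectI conjI ballI impI)
      show "insert i0 D \<subseteq> I" using DI i0I by blast
      show "disjoint_family_on ?B (insert i0 D)"
        using disj i0D unfolding disjoint_family_on_def by blast
      fix i assume i: "i \<in> I" "\<exists>j\<in>insert i0 D. ?B i \<inter> ?B j \<noteq> {}"
      show "\<exists>j\<in>insert i0 D. ?B i \<inter> ?B j \<noteq> {} \<and> r i \<le> 2 * r j"
      proof (cases "i \<in> S")
        case True
        then have "?B i \<inter> ?B i0 \<noteq> {}" using i by (auto simp: S_def)
        with half [OF True] show ?thesis by blast
      next
        case False
        then have "\<exists>j\<in>D. ?B i \<inter> ?B j \<noteq> {}" using i by (auto simp: S_def)
        from big [OF i(1) this] show ?thesis by blast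
      qed
    qed
    then have "i0 \<in> D" using max [of "insert i0 D"] by blast
    from i0D [OF this] pos [OF i0(1)] show False by auto
  qed
  show thesis
  proof (rule that [OF DI disj])
    fix i assume i: "i \<in> I"
    then have "\<exists>j\<in>D. ?B i \<inter> ?B j \<noteq> {}" using \<open>S = {}\<close> by (auto simp: S_def)
    from big [OF i this] obtain j w where j: "j \<in> D" "r i \<le> 2 * r j" and w: "w \<in> ?B i" "w \<in> ?B j" by blast
    have "ball (c i) (r i) \<subseteq> ball (c j) (5 * r j)"
    proof
      fix y assume y: "y \<in> ball (c i) (r i)"
      have "dist (c j) y \<le> dist (c j) w + dist (c i) w + dist (c i) y"
        using dist_triangle [of "c j" y w] dist_triangle [of w y "c i"] by (simp add: dist_commute)
      also have "\<dots> < 5 * r j" using y w j by simp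
      finally show "y \<in> ball (c j) (5 * r j)" by simp
    qed
    with j(1) show "\<exists>j\<in>D. ball (c i) (r i) \<subseteq> ball (c j) (5 * r j)" by blast
  qed
qed


section \<open>Means over dyadic balls in a doubling space\<close>

text \<open>The limit superior in the theorem runs over integers; only nonnegative scales matter for
  it, so sequences over the natural numbers suffice.\<close>

lemma at_top_int_filtermap: "(at_top :: int filter) = filtermap int sequentially"
proof (rule filter_eqI)
  fix P :: "int \<Rightarrow> bool"
  have "(\<exists>N. \<forall>k\<ge>N. P k) \<longleftrightarrow> (\<exists>N. \<forall>n\<ge>N. P (int n))" (is "?L \<longleftrightarrow> ?R")
  proof
    assume ?L
    then obtain N where "\<And>k. k \<ge> N \<Longrightarrow> P k" by blast
    then show ?R by (intro exI [of _ "nat N"]) auto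
  next
    assume ?R
    then obtain N where N: "\<And>n. n \<ge> N \<Longrightarrow> P (int n)" by blast
    have "P k" if "k \<ge> int N" for k
      using N [of "nat k"] that by (simp add: le_nat_iff)
    then show ?L by blast
  qed
  then show "eventually P at_top = eventually P (filtermap int sequentially)"
    by (simp add: eventually_filtermap eventually_at_top_linorder)
qed

lemma Limsup_at_top_int: "Limsup at_top (f :: int \<Rightarrow> ennreal) = limsup (\<lambda>n. f (int n))"
  by (simp add: at_top_int_filtermap Limsup_filtermap_eq)

lemma two_powi_pos: "0 < (2::real) powi k"
  by simp

lemma two_powi_minus_nat: "(2::real) powi (- int n) = (1 / 2) ^ n"
  by (simp add: power_int_minus power_one_over inverse_eq_divide)

lemma ball_borel [measurable]: "ball x r \<in> sets borel"
  by simp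

text \<open>Splits the excess when f = g + (f - g): the summand f - g contributes its mean b, while
  its share d - c of the subtracted term is given up. Finiteness of c permits the cancellation in
  \<open>ennreal\<close>.\<close>

lemma ennreal_add_minus_le: "(c::ennreal) < \<infinity> \<Longrightarrow> c \<le> d \<Longrightarrow> (a + b) - d \<le> (a - c) + b"
proof -
  assume c: "c < \<infinity>" "c \<le> d"
  have "(a + b) - d \<le> (a + b) - c" using c(2) by (rule ennreal_minus_mono [OF order_refl])
  also have "\<dots> \<le> ((a - c) + c + b) - c"
  proof (intro ennreal_minus_mono add_right_mono order_refl)
    show "a \<le> a - c + c"
      by (cases "c \<le> a") (auto simp: diff_add_cancel_ennreal not_le intro: add_increasing less_imp_le)
  qed
  also have "\<dots> = (a - c) + b"
  proof -
    have "((a - c) + c + b) = c + ((a - c) + b)" by (simp add: ac_simps)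
    then show ?thesis using c(1) by (simp only:) (simp add: ennreal_add_diff_cancel_left)
  qed
  finally show ?thesis .
qed

lemma ennreal_less_add_pos: "(c::ennreal) < \<infinity> \<Longrightarrow> 0 < d \<Longrightarrow> c < c + d"
  by (cases c; cases d) (auto simp: ennreal_less_iff simp flip: ennreal_plus)

section \<open>Dilated dyadic balls, their means and their overlap\<close>

locale dyadic_doubling =
  fixes M :: "'a::metric_space measure" and m :: "int \<Rightarrow> enat" and z :: "int \<Rightarrow> nat \<Rightarrow> 'a"
  assumes reg: "borel_regular_measure M"
    and balls: "balls_pos_finite M"
    and doubling: "doubling_measure M"
    and coverings: "dyadic_coverings m z"
begin

abbreviation idx :: "int \<Rightarrow> 'a \<Rightarrow> nat" where "idx \<equiv> first_index m z"

definition dball :: "real \<Rightarrow> int \<Rightarrow> nat \<Rightarrow> 'a set" where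
  "dball a k i = ball (z k i) (a * 2 powi (- k))"

text \<open>Like \<open>abs_T\<close>, the mean depends on x only through the index of its ball; the
  center of the averaging ball is in general not x.\<close>

definition mean :: "real \<Rightarrow> int \<Rightarrow> ('a \<Rightarrow> ennreal) \<Rightarrow> 'a \<Rightarrow> ennreal" where
  "mean a k f x = (\<integral>\<^sup>+y\<in>dball a k (idx k x). f y \<partial>M) / emeasure M (dball a k (idx k x))"

lemma space_M [simp]: "space M = UNIV"
  using reg by (simp add: borel_regular_measure_def)

lemma sets_M: "A \<in> sets borel \<Longrightarrow> A \<in> sets M"
  using reg by (auto simp: borel_regular_measure_def)

text \<open>M may have more measurable sets than the Borel ones; composition with the identity
  carries Borel measurability over to M.\<close>

lemma ident_measurable: "(\<lambda>x. x) \<in> measurable M borel"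
  by (rule measurableI) (auto simp: sets_M)

lemma meas_M: "f \<in> borel_measurable borel \<Longrightarrow> f \<in> borel_measurable M"
  by (rule measurable_compose [OF ident_measurable])

lemma ball_pos: "0 < r \<Longrightarrow> 0 < emeasure M (ball x r)"
  using balls unfolding balls_pos_finite_def by blast

lemma ball_finite: "emeasure M (ball x r) < \<infinity>"
proof (cases "0 < r")
  case True
  then show ?thesis using balls unfolding balls_pos_finite_def by blast
qed (simp add: ball_empty)

lemma doubling_iterate:
  obtains C :: real where "1 \<le> C" "\<And>x r. 0 < r \<Longrightarrow> emeasure M (ball x (a * r)) \<le> ennreal C * emeasure M (ball x r)"
proof -
  obtain Cd where Cd: "1 \<le> Cd" and d: "\<And>x r. 0 < r \<Longrightarrow> emeasure M (ball x (2 * r)) \<le> ennreal Cd * emeasure M (ball x r)"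
    using doubling by (auto simp: doubling_measure_def)
  obtain n where n: "a < 2 ^ n" using real_arch_pow [of 2 a] by auto
  have "emeasure M (ball x (2 ^ n * r)) \<le> ennreal (Cd ^ n) * emeasure M (ball x r)" if "0 < r" for x r
  proof (induction n)
    case (Suc n)
    have "emeasure M (ball x (2 ^ Suc n * r)) \<le> ennreal Cd * emeasure M (ball x (2 ^ n * r))"
      using d [of "2 ^ n * r" x] that by (simp add: mult.assoc)
    also have "\<dots> \<le> ennreal Cd * (ennreal (Cd ^ n) * emeasure M (ball x r))"
      by (intro mult_left_mono Suc.IH) simp
    finally show ?case using Cd by (simp add: ennreal_mult mult.assoc)
  qed simp
  moreover have "emeasure M (ball x (a * r)) \<le> emeasure M (ball x (2 ^ n * r))" if "0 < r" for x r
    using n that by (intro emeasure_mono subset_ball) (auto simp: sets_M)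
  ultimately show ?thesis
    using that [of "Cd ^ n"] Cd by (meson one_le_power order_trans)
qed

lemma covered: "\<exists>i. i \<in> cover_index m k \<and> x \<in> cover_ball z k i"
  using coverings unfolding dyadic_coverings_def by blast

lemma idx_in: "idx k x \<in> cover_index m k" and idx_ball: "x \<in> cover_ball z k (idx k x)"
  using LeastI_ex [OF covered, of k x] by (auto simp: first_index_def)

lemma dist_idx: "dist (z k (idx k x)) x < 2 powi (- k)"
  using idx_ball [of x k] by (simp add: cover_ball_def)

lemma idx_measurable [measurable]: "idx k \<in> measurable borel (count_space UNIV)"
proof -
  have [measurable]: "cover_ball z k i \<in> sets borel" for i by (simp add: cover_ball_def)
  show ?thesis unfolding first_index_def by measurable
qed

lemma dball_borel [measurable]: "dball a k i \<in> sets borel"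
  by (simp add: dball_def)

lemma dball_sets [measurable]: "dball a k i \<in> sets M"
  by (simp add: sets_M)

text \<open>The mean factors through the index function, which takes natural numbers as values, so f
  may be arbitrary.\<close>

lemma mean_measurable [measurable]: "mean a k f \<in> borel_measurable borel"
proof -
  have "(\<lambda>i. (\<integral>\<^sup>+y\<in>dball a k i. f y \<partial>M) / emeasure M (dball a k i)) \<circ> idx k \<in> borel_measurable borel"
    by (rule measurable_comp [OF idx_measurable]) simp
  then show ?thesis by (simp add: mean_def comp_def cong: measurable_cong)
qed

lemma dball_pos: "0 < a \<Longrightarrow> 0 < emeasure M (dball a k i)"
  by (simp add: dball_def ball_pos)

lemma dball_finite: "emeasure M (dball a k i) < \<infinity>"
  using ball_finite by (simp add: dball_def)

text \<open>Packing argument: the balls of one fifth of the radius are disjoint and lie in one ball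
  around x, and by doubling each of them carries a fixed portion of the measure of that
  ball.\<close>

lemma bounded_overlap:
  obtains N :: nat where "\<And>k x. finite {i \<in> cover_index m k. dist (z k i) x < a * 2 powi (- k)}"
    "\<And>k x. card {i \<in> cover_index m k. dist (z k i) x < a * 2 powi (- k)} \<le> N"
proof -
  \<comment> \<open>The lower bound 1 keeps the auxiliary radii positive for every real a.\<close>
  define b where "b = max a 1"
  obtain C where C: "1 \<le> C" "\<And>x r. 0 < r \<Longrightarrow> emeasure M (ball x (((2 * b + 1) * 5) * r)) \<le> ennreal C * emeasure M (ball x r)"
    using doubling_iterate [of "(2 * b + 1) * 5"] by blast
  \<comment> \<open>Finite subsets come first, since \<open>card\<close> is 0 on infinite sets; the
    uniform bound then rules out an infinite index set.\<close>
  have main: "card F \<le> nat \<lfloor>C\<rfloor>"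
    if F: "finite F" "F \<subseteq> {i \<in> cover_index m k. dist (z k i) x < a * 2 powi (- k)}" for F k x
  proof -
    let ?r = "(2::real) powi (- k)" 
    let ?X = "ball x ((b + 1) * ?r)"
    let ?S = "\<lambda>i. ball (z k i) (1 / 5 * ?r)"
    have near: "dist (z k i) x < b * ?r" if "i \<in> F" for i
    proof -
      have "dist (z k i) x < a * ?r" using that F by auto
      also have "\<dots> \<le> b * ?r" by (intro mult_right_mono) (auto simp: b_def)
      finally show ?thesis .
    qed
    have disj: "disjoint_family_on ?S F"
      using coverings F unfolding dyadic_coverings_def disjoint_family_on_def by blast
    have "of_nat (card F) * emeasure M ?X = (\<Sum>i\<in>F. emeasure M ?X)" by simp
    also have "\<dots> \<le> (\<Sum>i\<in>F. ennreal C * emeasure M (?S i))"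
    proof (rule sum_mono)
      fix i assume "i \<in> F"
      have "?X \<subseteq> ball (z k i) ((2 * b + 1) * ?r)"
      proof
        fix y assume "y \<in> ?X"
        then have "dist (z k i) y < b * ?r + (b + 1) * ?r"
          using near [OF \<open>i \<in> F\<close>] dist_triangle [of "z k i" y x] by simp
        then show "y \<in> ball (z k i) ((2 * b + 1) * ?r)" by (simp add: algebra_simps)
      qed
      then have "emeasure M ?X \<le> emeasure M (ball (z k i) ((2 * b + 1) * ?r))"
        by (intro emeasure_mono sets_M) auto
      also have "\<dots> \<le> ennreal C * emeasure M (?S i)"
      proof -
        have "(2 * b + 1) * 5 * (1 / 5 * ?r) = (2 * b + 1) * ?r" by simp
        then show ?thesis using C(2) [of "1 / 5 * ?r" "z k i"] two_powi_pos [of "- k"] by (simp only:)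
      qed
      finally show "emeasure M ?X \<le> ennreal C * emeasure M (?S i)" .
    qed
    also have "\<dots> = ennreal C * emeasure M (\<Union>i\<in>F. ?S i)"
      using F disj by (subst sum_emeasure [symmetric]) (auto simp: sum_distrib_left sets_M)
    also have "\<dots> \<le> ennreal C * emeasure M ?X"
    proof (intro mult_left_mono emeasure_mono sets_M)
      show "(\<Union>i\<in>F. ?S i) \<subseteq> ?X"
      proof clarify
        fix i y assume "i \<in> F" "y \<in> ?S i"
        then have "dist (z k i) y < 1 / 5 * ?r" by simp
        moreover have "dist x (z k i) < b * ?r" using near [OF \<open>i \<in> F\<close>] by (simp add: dist_commute)
        ultimately have "dist x y < b * ?r + 1 * ?r"
          using dist_triangle [of x y "z k i"] two_powi_pos [of "- k"] by linarith
        then show "y \<in> ?X" by (simp add: algebra_simps)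
      qed
    qed auto
    finally have "of_nat (card F) * emeasure M ?X \<le> ennreal C * emeasure M ?X" .
    moreover have "0 < emeasure M ?X"
      by (rule ball_pos) (simp add: b_def add_pos_pos max_def)
    moreover have "emeasure M ?X < \<infinity>" by (rule ball_finite)
    ultimately have "of_nat (card F) \<le> ennreal C"
      using ennreal_mult_le_mult_iff [of "emeasure M ?X" "of_nat (card F)" "ennreal C"]
      by (simp add: mult.commute less_top [symmetric])
    then have "real (card F) \<le> C"
      using C(1) by (simp add: ennreal_of_nat_eq_real_of_nat)
    then show ?thesis by linarith
  qed
  show thesis
  proof (rule that [of "nat \<lfloor>C\<rfloor>"])
    fix k x
    let ?I = "{i \<in> cover_index m k. dist (z k i) x < a * 2 powi (- k)}"
    show "finite ?I"
    proof (rule ccontr)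
      assume "infinite ?I"
      then obtain F where "finite F" "card F = Suc (nat \<lfloor>C\<rfloor>)" "F \<subseteq> ?I"
        using infinite_arbitrarily_large by blast
      with main [of F k x] show False by simp
    qed
    then show "card ?I \<le> nat \<lfloor>C\<rfloor>" by (intro main) auto
  qed
qed

text \<open>L^1 boundedness of the averaging operators, uniformly in the scale. The level sets of
  the index partition the space and, as a >= 1, lie inside the dilated balls. So the mean integrates
  over a level set to at most the integral of f over its ball, and the overlap of the balls costs
  the factor N.\<close>

lemma nn_integral_mean_le:
  assumes "1 \<le> a"
  obtains N :: nat where "\<And>k f. f \<in> borel_measurable borel \<Longrightarrow>
    (\<integral>\<^sup>+x. mean a k f x \<partial>M) \<le> of_nat N * (\<integral>\<^sup>+x. f x \<partial>M)"
proof -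
  obtain N where fin: "\<And>k x. finite {i \<in> cover_index m k. dist (z k i) x < a * 2 powi (- k)}"
    and N: "\<And>k x. card {i \<in> cover_index m k. dist (z k i) x < a * 2 powi (- k)} \<le> N"
    using bounded_overlap by blast
  have "(\<integral>\<^sup>+x. mean a k f x \<partial>M) \<le> of_nat N * (\<integral>\<^sup>+x. f x \<partial>M)"
    if [measurable]: "f \<in> borel_measurable borel" for k f
  proof -
    have [measurable]: "f \<in> borel_measurable M" by (rule meas_M) fact
    define J where "J i = (\<integral>\<^sup>+y\<in>dball a k i. f y \<partial>M)" for i
    define Q where "Q i = {x. idx k x = i}" for i
    have [measurable]: "Q i \<in> sets M" for i
      unfolding Q_def by (rule sets_M) measurable
    have one: "(\<Sum>i. g i * indicator (Q i) x) = g (idx k x)" for g :: "nat \<Rightarrow> ennreal" and x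
    proof -
      have "(\<Sum>i. g i * indicator (Q i) x) = (\<Sum>i\<in>{idx k x}. g i * indicator (Q i) x)"
        by (rule suminf_finite) (auto simp: Q_def)
      then show ?thesis by (simp add: Q_def)
    qed
    have "(\<integral>\<^sup>+x. mean a k f x \<partial>M) = (\<integral>\<^sup>+x. (\<Sum>i. J i / emeasure M (dball a k i) * indicator (Q i) x) \<partial>M)"
      by (simp only: one mean_def J_def)
    also have "\<dots> = (\<Sum>i. J i / emeasure M (dball a k i) * emeasure M (Q i))"
      by (simp add: nn_integral_suminf nn_integral_cmult_indicator)
    also have "\<dots> \<le> (\<Sum>i. if i \<in> cover_index m k then J i else 0)"
    proof (rule suminf_le)
      fix i
      show "J i / emeasure M (dball a k i) * emeasure M (Q i) \<le> (if i \<in> cover_index m k then J i else 0)"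
      proof (cases "i \<in> cover_index m k")
        case True
        have "Q i \<subseteq> dball a k i"
        proof
          fix x assume "x \<in> Q i"
          then have "dist (z k i) x < 1 * 2 powi (- k)" using dist_idx [of k x] by (simp add: Q_def)
          also have "\<dots> \<le> a * 2 powi (- k)" using assms by (intro mult_right_mono) auto
          finally show "x \<in> dball a k i" by (simp add: dball_def)
        qed
        then have "emeasure M (Q i) \<le> emeasure M (dball a k i)"
          by (intro emeasure_mono) auto
        then have "J i / emeasure M (dball a k i) * emeasure M (Q i)
            \<le> J i / emeasure M (dball a k i) * emeasure M (dball a k i)"
          by (intro mult_left_mono) auto
        also have "\<dots> = J i"
          using dball_pos [of a k i] dball_finite [of a k i] assms
          by (simp add: ennreal_divide_times ennreal_times_divide mult.commute ennreal_mult_divide_eq)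
        finally show ?thesis using True by simp
      next
        case False
        then have "Q i = {}" using idx_in by (auto simp: Q_def)
        then show ?thesis by simp
      qed
    qed auto
    also have "\<dots> = (\<Sum>i. \<integral>\<^sup>+x. f x * indicator {x. i \<in> cover_index m k \<and> x \<in> dball a k i} x \<partial>M)"
      by (intro suminf_cong) (auto simp: J_def intro!: nn_integral_cong split: split_indicator)
    also have "\<dots> = (\<integral>\<^sup>+x. (\<Sum>i. f x * indicator {x. i \<in> cover_index m k \<and> x \<in> dball a k i} x) \<partial>M)"
      by (subst nn_integral_suminf) auto
    also have "\<dots> \<le> (\<integral>\<^sup>+x. of_nat N * f x \<partial>M)"
    proof (rule nn_integral_mono)
      fix x
      let ?I = "{i \<in> cover_index m k. dist (z k i) x < a * 2 powi (- k)}"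
      have "(\<Sum>i. f x * indicator {x. i \<in> cover_index m k \<and> x \<in> dball a k i} x)
          = (\<Sum>i\<in>?I. f x * indicator {x. i \<in> cover_index m k \<and> x \<in> dball a k i} x)"
        by (rule suminf_finite [OF fin]) (auto simp: dball_def)
      also have "\<dots> = (\<Sum>i\<in>?I. f x)" by (intro sum.cong) (auto simp: dball_def)
      also have "\<dots> = of_nat (card ?I) * f x" by simp
      also have "\<dots> \<le> of_nat N * f x" by (intro mult_right_mono of_nat_mono N) simp
      finally show "(\<Sum>i. f x * indicator {x. i \<in> cover_index m k \<and> x \<in> dball a k i} x) \<le> of_nat N * f x" .
    qed
    also have "\<dots> = of_nat N * (\<integral>\<^sup>+x. f x \<partial>M)" by (rule nn_integral_cmult) measurable
    finally show ?thesis .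
  qed
  then show thesis by (rule that)
qed

end


section \<open>Differentiation of integrals\<close>

context dyadic_doubling
begin

lemma dball_eventually_subset:
  assumes "open U" "x \<in> U"
  shows "\<forall>\<^sub>F n in sequentially. dball a (int n) (idx (int n) x) \<subseteq> U"
proof -
  obtain e where e: "0 < e" "ball x e \<subseteq> U"
    using assms by (auto simp: open_contains_ball)
  \<comment> \<open>One radius for the distance from x to the center, and |a| radii for the dilated
    ball.\<close>
  have "(\<lambda>n. (\<bar>a\<bar> + 1) * (1 / 2) ^ n) \<longlonglongrightarrow> (\<bar>a\<bar> + 1) * 0"
    by (intro tendsto_intros LIMSEQ_power_zero) simp
  then have "\<forall>\<^sub>F n in sequentially. (\<bar>a\<bar> + 1) * (1 / 2) ^ n < e"
    using e by (intro order_tendstoD(2)) auto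
  then show ?thesis
  proof eventually_elim
    case (elim n)
    let ?r = "(2::real) powi (- int n)"
    have r: "?r = (1 / 2) ^ n" by (rule two_powi_minus_nat)
    have "dball a (int n) (idx (int n) x) \<subseteq> ball x e"
    proof
      fix y assume "y \<in> dball a (int n) (idx (int n) x)"
      then have "dist (z (int n) (idx (int n) x)) y < a * ?r" by (simp add: dball_def)
      moreover have "a * ?r \<le> \<bar>a\<bar> * ?r" by (intro mult_right_mono) auto
      moreover have "dist x (z (int n) (idx (int n) x)) < ?r"
        using dist_idx [of "int n" x] by (simp add: dist_commute)
      ultimately have "dist x y < \<bar>a\<bar> * ?r + ?r"
        using dist_triangle [of x y "z (int n) (idx (int n) x)"] by linarith
      also have "\<dots> = (\<bar>a\<bar> + 1) * (1 / 2) ^ n" unfolding r by (simp add: algebra_simps)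
      finally show "y \<in> ball x e" using elim by simp
    qed
    with e show ?case by blast
  qed
qed

text \<open>The balls inside an open U containing E on which f has mean at least t cover E. Disjoint
  ones among them have fivefold dilates that still cover E, so t M(E) <= C nu(U), where nu has
  density f with respect to M. As U approximates E with respect to nu, the right side is close to C
  nu(E) <= C s M(E), and C s < t forces M(E) = 0.\<close>

lemma density_null_set:
  assumes a: "1 \<le> a" and C: "1 \<le> C" "\<And>x r. 0 < r \<Longrightarrow> emeasure M (ball x (5 * r)) \<le> ennreal C * emeasure M (ball x r)"
    and f: "f \<in> borel_measurable borel" "(\<integral>\<^sup>+x. f x \<partial>M) < \<infinity>"
    and st: "0 \<le> s" "C * s < t"
    and E: "E \<in> sets borel" "emeasure M E < \<infinity>"
    and Ef: "\<And>x. x \<in> E \<Longrightarrow> f x \<le> ennreal s"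
    and Et: "\<And>x. x \<in> E \<Longrightarrow> ennreal t < limsup (\<lambda>n. mean a (int n) f x)"
  shows "emeasure M E = 0"
proof -
  have [measurable]: "f \<in> borel_measurable M" by (rule meas_M) fact
  have "0 < a" using a by simp
  \<comment> \<open>The push-forward along the identity restricts the measure to the Borel sets, as
    the regularity lemma requires.\<close>
  define \<nu> where "\<nu> = distr (density M f) borel (\<lambda>x. x)"
  have \<nu>_sets: "sets \<nu> = sets borel" by (simp add: \<nu>_def)
  have id: "(\<lambda>x. x) \<in> measurable (density M f) borel"
    using ident_measurable by simp
  have \<nu>: "emeasure \<nu> A = (\<integral>\<^sup>+x\<in>A. f x \<partial>M)" if "A \<in> sets borel" for A
    using that sets_M [OF that] unfolding \<nu>_def by (simp add: emeasure_distr [OF id] emeasure_density)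
  have \<nu>_fin: "emeasure \<nu> UNIV < \<infinity>" using f by (simp add: \<nu>)
  have bound: "ennreal t * emeasure M E \<le> ennreal (C * s) * emeasure M E + ennreal C * ennreal e" if "0 < e" for e :: real
  proof -
    obtain F U where FU: "closed F" "open U" "F \<subseteq> E" "E \<subseteq> U" "emeasure \<nu> (U - F) < ennreal e"
      using finite_borel_measure_regular [OF \<nu>_sets \<nu>_fin E(1) \<open>0 < e\<close>] by (elim exE conjE)
    define I where "I = {(n, i). dball a (int n) i \<subseteq> U \<and>
      ennreal t * emeasure M (dball a (int n) i) \<le> (\<integral>\<^sup>+y\<in>dball a (int n) i. f y \<partial>M)}"
    define c where "c q = z (int (fst q)) (snd q)" for q
    define r where "r q = a * 2 powi (- int (fst q))" for q :: "nat \<times> nat"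
    have r_pos: "0 < r q" for q using \<open>0 < a\<close> by (simp add: r_def)
    have r_le: "r q \<le> a" for q
      using \<open>0 < a\<close> unfolding r_def two_powi_minus_nat
      by (intro mult_right_le_one_le power_le_one) auto
    obtain D where D: "D \<subseteq> I" "disjoint_family_on (\<lambda>q. ball (c q) (r q)) D"
      and cov: "\<And>q. q \<in> I \<Longrightarrow> \<exists>j\<in>D. ball (c q) (r q) \<subseteq> ball (c j) (5 * r j)"
      by (rule vitali_covering [of I r a c, OF r_pos r_le]) (rule that)
    have ball_eq: "dball a (int n) i = ball (c (n, i)) (r (n, i))" for n i
      by (simp add: dball_def c_def r_def)
    have D_U: "ball (c q) (r q) \<subseteq> U" if "q \<in> D" for q
      using subsetD [OF D(1) that] by (cases q) (simp add: I_def ball_eq)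
    \<comment> \<open>The members of D are pairs of natural numbers, enumerated by
      \<open>prod_decode\<close>; other codes give empty sets.\<close>
    define B where "B n = (if prod_decode n \<in> D then ball (c (prod_decode n)) (r (prod_decode n)) else {})" for n
    define B5 where "B5 n = (if prod_decode n \<in> D then ball (c (prod_decode n)) (5 * r (prod_decode n)) else {})" for n
    have meas: "B n \<in> sets M" "B5 n \<in> sets M" for n
      by (auto simp: B_def B5_def intro: sets_M)
    have disj: "disjoint_family B"
      unfolding disjoint_family_on_def
    proof (intro ballI impI)
      fix n n' :: nat assume "n \<noteq> n'"
      then have "prod_decode n \<noteq> prod_decode n'" by (simp add: prod_decode_eq)
      then show "B n \<inter> B n' = {}"
        using D(2) unfolding B_def disjoint_family_on_def by auto
    qed
    have "E \<subseteq> (\<Union>n. B5 n)"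
    proof
      fix x assume x: "x \<in> E"
      have "\<exists>\<^sub>F n in sequentially. ennreal t < mean a (int n) f x"
      proof (rule ccontr)
        assume "\<not> ?thesis"
        then have "\<forall>\<^sub>F n in sequentially. mean a (int n) f x \<le> ennreal t"
          by (simp add: frequently_def not_less)
        then have "limsup (\<lambda>n. mean a (int n) f x) \<le> ennreal t"
          by (rule Limsup_bounded)
        with Et [OF x] show False by simp
      qed
      moreover have "\<forall>\<^sub>F n in sequentially. dball a (int n) (idx (int n) x) \<subseteq> U"
        using FU x by (intro dball_eventually_subset) auto
      ultimately have "\<exists>\<^sub>F n in sequentially. ennreal t < mean a (int n) f x \<and> dball a (int n) (idx (int n) x) \<subseteq> U"
        by (rule frequently_eventually_frequently)
      from frequently_ex [OF this]
      obtain n where n: "ennreal t < mean a (int n) f x" "dball a (int n) (idx (int n) x) \<subseteq> U"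
        by (elim exE conjE)
      have "ennreal t * emeasure M (dball a (int n) (idx (int n) x))
          \<le> mean a (int n) f x * emeasure M (dball a (int n) (idx (int n) x))"
        using n by (intro mult_right_mono) auto
      also have "\<dots> = (\<integral>\<^sup>+y\<in>dball a (int n) (idx (int n) x). f y \<partial>M)"
        using dball_pos [of a "int n" "idx (int n) x"] dball_finite [of a "int n" "idx (int n) x"] \<open>0 < a\<close>
        by (simp add: mean_def ennreal_divide_times)
      finally have "(n, idx (int n) x) \<in> I" using n by (simp add: I_def)
      from cov [OF this] obtain j where j: "j \<in> D" "dball a (int n) (idx (int n) x) \<subseteq> ball (c j) (5 * r j)"
        by (auto simp: ball_eq)
      have "dist (z (int n) (idx (int n) x)) x < 1 * 2 powi (- int n)" using dist_idx by simp
      also have "\<dots> \<le> a * 2 powi (- int n)" using a by (intro mult_right_mono) auto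
      finally have "x \<in> dball a (int n) (idx (int n) x)" by (simp add: dball_def)
      with j have "x \<in> B5 (prod_encode j)" by (auto simp: B5_def)
      then show "x \<in> (\<Union>n. B5 n)" by blast
    qed
    then have "emeasure M E \<le> emeasure M (\<Union>n. B5 n)"
      using meas by (intro emeasure_mono) auto
    also have "\<dots> \<le> (\<Sum>n. emeasure M (B5 n))"
      using meas by (intro emeasure_subadditive_countably) auto
    also have "\<dots> \<le> (\<Sum>n. ennreal C * emeasure M (B n))"
      using C r_pos by (intro suminf_le) (auto simp: B_def B5_def)
    also have "\<dots> = ennreal C * (\<Sum>n. emeasure M (B n))" by simp
    finally have "ennreal t * emeasure M E \<le> ennreal t * (ennreal C * (\<Sum>n. emeasure M (B n)))"
      by (rule mult_left_mono) simp
    also have "\<dots> = ennreal C * (\<Sum>n. ennreal t * emeasure M (B n))"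
      by (simp add: mult_ac)
    also have "\<dots> \<le> ennreal C * (\<Sum>n. emeasure \<nu> (B n))"
    proof (intro mult_left_mono suminf_le)
      fix n
      show "ennreal t * emeasure M (B n) \<le> emeasure \<nu> (B n)"
      proof (cases "prod_decode n \<in> D")
        case True
        obtain k i where ki: "prod_decode n = (k, i)" by (cases "prod_decode n")
        with True D have "(k, i) \<in> I" by auto
        then have "ennreal t * emeasure M (dball a (int k) i) \<le> emeasure \<nu> (dball a (int k) i)"
          by (simp add: I_def \<nu>)
        then show ?thesis using True ki by (simp add: B_def ball_eq)
      qed (simp add: B_def)
    qed auto
    also have "(\<Sum>n. emeasure \<nu> (B n)) = emeasure \<nu> (\<Union>n. B n)"
      by (rule suminf_emeasure [OF _ disj]) (auto simp: \<nu>_sets B_def)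
    also have "\<dots> \<le> emeasure \<nu> U"
    proof (rule emeasure_mono)
      show "(\<Union>n. B n) \<subseteq> U" using D_U by (intro UN_least) (auto simp: B_def)
    qed (use FU in \<open>auto simp: \<nu>_sets\<close>)
    also have "\<dots> \<le> emeasure \<nu> E + emeasure \<nu> (U - F)"
    proof -
      have "emeasure \<nu> U \<le> emeasure \<nu> (E \<union> (U - F))"
        using FU E by (intro emeasure_mono) (auto simp: \<nu>_sets)
      also have "\<dots> \<le> emeasure \<nu> E + emeasure \<nu> (U - F)"
        using FU E by (intro emeasure_subadditive) (auto simp: \<nu>_sets)
      finally show ?thesis .
    qed
    also have "\<dots> \<le> ennreal s * emeasure M E + ennreal e"
    proof (intro add_mono)
      have "emeasure \<nu> E \<le> (\<integral>\<^sup>+x\<in>E. ennreal s \<partial>M)"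
        unfolding \<nu> [OF E(1)] using Ef by (intro nn_integral_mono) (auto split: split_indicator)
      also have "\<dots> = ennreal s * emeasure M E"
        using sets_M [OF E(1)] by (simp add: nn_integral_cmult_indicator)
      finally show "emeasure \<nu> E \<le> ennreal s * emeasure M E" .
    qed (use FU in auto)
    also have "ennreal C * (ennreal s * emeasure M E + ennreal e) = ennreal (C * s) * emeasure M E + ennreal C * ennreal e"
      using C(1) st by (simp add: distrib_left ennreal_mult mult.assoc)
    finally show ?thesis by (auto simp: mult_left_mono)
  qed
  obtain \<mu> where \<mu>: "emeasure M E = ennreal \<mu>" "0 \<le> \<mu>"
    using E(2) by (cases "emeasure M E") auto
  have "0 \<le> C * s" using st(1) C(1) by simp
  then have t0: "0 < t" using st(2) by linarith
  have "t * \<mu> \<le> C * s * \<mu> + e" if "0 < e" for e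
  proof -
    have "ennreal t * ennreal \<mu> \<le> ennreal (C * s) * ennreal \<mu> + ennreal C * ennreal (e / C)"
      using bound [of "e / C"] that C(1) unfolding \<mu>(1) by simp
    also have "ennreal C * ennreal (e / C) = ennreal e"
      using that C(1) by (simp flip: ennreal_mult)
    also have "ennreal (C * s) * ennreal \<mu> + ennreal e = ennreal (C * s * \<mu> + e)"
      using that C(1) st \<mu>(2) by (simp flip: ennreal_mult ennreal_plus)
    also have "ennreal t * ennreal \<mu> = ennreal (t * \<mu>)"
      using t0 \<mu>(2) by (simp flip: ennreal_mult)
    finally show ?thesis
      using that C(1) st \<mu>(2) by (subst (asm) ennreal_le_iff) auto
  qed
  then have "t * \<mu> \<le> C * s * \<mu>" by (rule field_le_epsilon)
  then have "\<mu> = 0" using st \<mu>(2) by (simp add: mult_le_cancel_right)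
  then show ?thesis using \<mu> by simp
qed

text \<open>The set where the inequality fails is a countable union of null sets, indexed by
  rationals s, t with C s < t and by balls that make their measure finite.\<close>

lemma limsup_mean_le:
  assumes a: "1 \<le> a"
  obtains C :: real where "1 \<le> C" "\<And>f. f \<in> borel_measurable borel \<Longrightarrow> (\<integral>\<^sup>+x. f x \<partial>M) < \<infinity> \<Longrightarrow>
    AE x in M. limsup (\<lambda>n. mean a (int n) f x) \<le> ennreal C * f x"
proof -
  obtain C where C: "1 \<le> C" "\<And>x r. 0 < r \<Longrightarrow> emeasure M (ball x (5 * r)) \<le> ennreal C * emeasure M (ball x r)"
    using doubling_iterate by blast
  have "AE x in M. limsup (\<lambda>n. mean a (int n) f x) \<le> ennreal C * f x"
    if f [measurable]: "f \<in> borel_measurable borel" and fin: "(\<integral>\<^sup>+x. f x \<partial>M) < \<infinity>" for f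
  proof -
    \<comment> \<open>Any base point will do; the type has at least one element.\<close>
    obtain x0 :: 'a where True by simp
    define E where "E s t R = {x \<in> ball x0 (real R). f x \<le> ennreal (of_rat s) \<and>
      ennreal (of_rat t) < limsup (\<lambda>n. mean a (int n) f x)}" for s t :: rat and R :: nat
    have E: "E s t R \<in> sets borel" for s t R unfolding E_def by measurable
    have "AE x in M. 0 \<le> s \<and> C * of_rat s < of_rat t \<longrightarrow> x \<notin> E s t R" for s t R
    proof (cases "0 \<le> s \<and> C * of_rat s < of_rat t")
      case True
      have "emeasure M (E s t R) \<le> emeasure M (ball x0 (real R))"
        by (intro emeasure_mono sets_M) (auto simp: E_def)
      also have "\<dots> < \<infinity>" by (rule ball_finite)
      finally have "emeasure M (E s t R) < \<infinity>" .
      then have "emeasure M (E s t R) = 0"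
        using True by (intro density_null_set [OF a C f fin, of "of_rat s" "of_rat t"] E) (auto simp: E_def)
      then have "E s t R \<in> null_sets M" using sets_M [OF E] by (intro null_setsI)
      from AE_not_in [OF this] show ?thesis by eventually_elim auto
    qed auto
    then have "AE x in M. \<forall>s t R. 0 \<le> s \<and> C * of_rat s < of_rat t \<longrightarrow> x \<notin> E s t R"
      unfolding AE_all_countable by blast
    then show ?thesis
    proof eventually_elim
      case (elim x)
      show ?case
      proof (rule ccontr)
        assume "\<not> ?thesis"
        then have less: "ennreal C * f x < limsup (\<lambda>n. mean a (int n) f x)" (is "_ < ?L") by simp
        then have "f x < \<infinity>" using C(1) by (cases "f x") (auto simp: ennreal_mult_top)
        then obtain y where y: "f x = ennreal y" "0 \<le> y" by (cases "f x") auto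
        obtain u where u: "ennreal C * f x < ennreal u" "ennreal u < ?L"
        proof -
          from dense [OF less] obtain w where w: "ennreal C * f x < w" "w < ?L" by blast
          then show ?thesis using that by (cases w) auto
        qed
        have Cy: "C * y < u"
          using u(1) C(1) y by (simp add: ennreal_less_iff flip: ennreal_mult)
        obtain t where t: "C * y < of_rat t" "of_rat t < u" using of_rat_dense [OF Cy] by blast
        have "y < of_rat t / C" using t C(1) by (simp add: field_simps)
        then obtain s where s: "y < of_rat s" "of_rat s < of_rat t / C" using of_rat_dense by blast
        have s0: "0 \<le> s" using s(1) y(2) by (metis less_eq_real_def order_le_less_trans zero_le_of_rat_iff)
        have st: "C * of_rat s < of_rat t" using s C(1) by (simp add: field_simps)
        have "ennreal (of_rat t) \<le> ennreal u" using t by (intro ennreal_leI) simp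
        with u have "ennreal (of_rat t) < ?L" by simp
        moreover have "f x \<le> ennreal (of_rat s)" using s y by (simp add: ennreal_leI)
        moreover obtain R :: nat where "dist x0 x < real R" using reals_Archimedean2 by blast
        ultimately have "x \<in> E s t R" by (simp add: E_def)
        with elim s0 st show False by blast
      qed
    qed
  qed
  with C(1) show thesis by (rule that)
qed

lemma mean_restrict_eq:
  assumes "x \<in> U" "open U"
  shows "\<forall>\<^sub>F n in sequentially. mean a (int n) (\<lambda>y. f y * indicator U y) x = mean a (int n) f x"
  using dball_eventually_subset [OF assms(2,1), of a]
proof eventually_elim
  case (elim n)
  have "(\<integral>\<^sup>+y\<in>dball a (int n) (idx (int n) x). f y * indicator U y \<partial>M) = (\<integral>\<^sup>+y\<in>dball a (int n) (idx (int n) x). f y \<partial>M)"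
    using elim by (intro nn_integral_cong) (auto split: split_indicator)
  then show ?case by (simp add: mean_def)
qed

text \<open>Meant for functions such as |u - q|, which are integrable on balls only. Cutting f off
  outside an open ball leaves the means at its points unchanged at all sufficiently small
  scales.\<close>

lemma limsup_mean_le_local:
  assumes a: "1 \<le> a"
  obtains C :: real where "1 \<le> C" "\<And>f. f \<in> borel_measurable borel \<Longrightarrow>
    (\<And>x r. (\<integral>\<^sup>+y\<in>ball x r. f y \<partial>M) < \<infinity>) \<Longrightarrow>
    AE x in M. limsup (\<lambda>n. mean a (int n) f x) \<le> ennreal C * f x"
proof -
  obtain C where C: "1 \<le> C" and *: "\<And>f. f \<in> borel_measurable borel \<Longrightarrow> (\<integral>\<^sup>+x. f x \<partial>M) < \<infinity> \<Longrightarrow>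
    AE x in M. limsup (\<lambda>n. mean a (int n) f x) \<le> ennreal C * f x"
    using limsup_mean_le [OF a] by blast
  have "AE x in M. limsup (\<lambda>n. mean a (int n) f x) \<le> ennreal C * f x"
    if f [measurable]: "f \<in> borel_measurable borel" and fin: "\<And>x r. (\<integral>\<^sup>+y\<in>ball x r. f y \<partial>M) < \<infinity>" for f
  proof -
    obtain x0 :: 'a where True by simp
    define g where "g R y = f y * indicator (ball x0 (real R)) y" for R y
    have "AE x in M. limsup (\<lambda>n. mean a (int n) (g R) x) \<le> ennreal C * g R x" for R
      using fin by (intro *) (auto simp: g_def [abs_def])
    then have "AE x in M. \<forall>R. limsup (\<lambda>n. mean a (int n) (g R) x) \<le> ennreal C * g R x"
      by (simp add: AE_all_countable)
    then show ?thesis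
    proof eventually_elim
      case (elim x)
      obtain R :: nat where R: "dist x0 x < real R" using reals_Archimedean2 by blast
      have "limsup (\<lambda>n. mean a (int n) f x) = limsup (\<lambda>n. mean a (int n) (g R) x)"
        using mean_restrict_eq [of x "ball x0 (real R)" a f] R
        by (intro Limsup_eq) (auto simp: g_def [abs_def] elim: eventually_mono)
      also have "\<dots> \<le> ennreal C * g R x" using elim by blast
      also have "\<dots> = ennreal C * f x" using R by (simp add: g_def)
      finally show ?case .
    qed
  qed
  with C(1) show thesis by (rule that)
qed

text \<open>Subtraction is truncated, so the integrand is the positive part. A bounded function with
  bounded support has means with an integrable majorant, so dominated convergence applies.
  Truncation reduces the general case to this one, the remainder being controlled by the uniform L^1
  bound.\<close>

lemma mean_excess_tendsto_0:
  assumes a: "1 \<le> a"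
  obtains C :: real where "1 \<le> C" "\<And>f. f \<in> borel_measurable borel \<Longrightarrow> (\<integral>\<^sup>+x. f x \<partial>M) < \<infinity> \<Longrightarrow>
    (\<lambda>n. \<integral>\<^sup>+x. mean a (int n) f x - ennreal C * f x \<partial>M) \<longlonglongrightarrow> 0"
proof -
  obtain C where C: "1 \<le> C" and *: "\<And>f. f \<in> borel_measurable borel \<Longrightarrow> (\<integral>\<^sup>+x. f x \<partial>M) < \<infinity> \<Longrightarrow>
    AE x in M. limsup (\<lambda>n. mean a (int n) f x) \<le> ennreal C * f x"
    using limsup_mean_le [OF a] by blast
  obtain N where N: "\<And>k f. f \<in> borel_measurable borel \<Longrightarrow>
    (\<integral>\<^sup>+x. mean a k f x \<partial>M) \<le> of_nat N * (\<integral>\<^sup>+x. f x \<partial>M)"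
    using nn_integral_mean_le [OF a] by blast
  have "(\<lambda>n. \<integral>\<^sup>+x. mean a (int n) f x - ennreal C * f x \<partial>M) \<longlonglongrightarrow> 0"
    if f [measurable]: "f \<in> borel_measurable borel" and fin: "(\<integral>\<^sup>+x. f x \<partial>M) < \<infinity>" for f
  proof -
    have fM [measurable]: "f \<in> borel_measurable M" by (rule meas_M) fact
    have [measurable]: "mean a k h \<in> borel_measurable M" for k h by (rule meas_M) measurable
    obtain x0 :: 'a where True by simp
    define g where "g L y = min (f y) (of_nat L) * indicator (ball x0 (real L)) y" for L y
    have g_meas: "g L \<in> borel_measurable borel" for L
      unfolding g_def [abs_def] by measurable
    have [measurable]: "g L \<in> borel_measurable M" for L by (rule meas_M [OF g_meas])
    have gf: "g L y \<le> f y" for L y by (auto simp: g_def split: split_indicator)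
    have gL: "g L y \<le> of_nat L * indicator (ball x0 (real L)) y" for L y
      by (auto simp: g_def split: split_indicator)
    have g_fin: "(\<integral>\<^sup>+x. g L x \<partial>M) < \<infinity>" for L
      using nn_integral_mono [of M "g L" f] gf fin by (auto intro: le_less_trans)
    have lim_g: "(\<lambda>n. \<integral>\<^sup>+x. mean a (int n) (g L) x - ennreal C * g L x \<partial>M) \<longlonglongrightarrow> 0" for L
    proof -
      have "(\<lambda>n. \<integral>\<^sup>+x. mean a (int n) (g L) x - ennreal C * g L x \<partial>M) \<longlonglongrightarrow> (\<integral>\<^sup>+x. 0 \<partial>M)"
      \<comment> \<open>At nonnegative scales the averaging ball has radius at most a and its center
        is at distance less than 1 from x, so the mean vanishes outside the enlarged ball.\<close>
      proof (rule nn_integral_dominated_convergence [where w = "\<lambda>x. of_nat L * indicator (ball x0 (real L + 1 + a)) x"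
            and u' = "\<lambda>x. 0" and u = "\<lambda>n x. mean a (int n) (g L) x - ennreal C * g L x"])
        have b: "ball x0 r \<in> sets M" for r by (rule sets_M) simp
        show "(\<lambda>x. of_nat L * indicator (ball x0 (real L + 1 + a)) x :: ennreal) \<in> borel_measurable M"
          using b by measurable
        show "(\<integral>\<^sup>+x. of_nat L * indicator (ball x0 (real L + 1 + a)) x \<partial>M) < \<infinity>"
          using b ball_finite [of x0 "real L + 1 + a"]
          by (simp add: nn_integral_cmult_indicator ennreal_mult_less_top of_nat_less_top)
        show "AE x in M. mean a (int n) (g L) x - ennreal C * g L x \<le> of_nat L * indicator (ball x0 (real L + 1 + a)) x" for n
        proof (rule AE_I2)
          fix x
          let ?B = "dball a (int n) (idx (int n) x)"
          have "mean a (int n) (g L) x \<le> of_nat L * indicator (ball x0 (real L + 1 + a)) x"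
          proof (cases "x \<in> ball x0 (real L + 1 + a)")
            case True
            have "(\<integral>\<^sup>+y\<in>?B. g L y \<partial>M) \<le> (\<integral>\<^sup>+y. of_nat L * indicator ?B y \<partial>M)"
              using gL by (intro nn_integral_mono) (auto split: split_indicator intro: order_trans [OF gL])
            also have "\<dots> = of_nat L * emeasure M ?B" by (simp add: nn_integral_cmult_indicator)
            finally have "mean a (int n) (g L) x \<le> of_nat L * emeasure M ?B / emeasure M ?B"
              unfolding mean_def by (rule divide_right_mono_ennreal)
            also have "\<dots> = of_nat L"
              using dball_pos [of a "int n" "idx (int n) x"] dball_finite [of a "int n" "idx (int n) x"] a
              by (simp add: ennreal_mult_divide_eq)
            finally show ?thesis using True by simp
          next
            case False
            have "g L y = 0" if "y \<in> ?B" for y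
            proof -
              have "(2::real) powi (- int n) \<le> 1" by (simp add: two_powi_minus_nat power_le_one)
              then have "a * 2 powi (- int n) \<le> a" using a by simp
              then have "dist (z (int n) (idx (int n) x)) y < a"
                using that by (simp add: dball_def)
              moreover have "dist (z (int n) (idx (int n) x)) x < 1"
                using dist_idx [of "int n" x] \<open>2 powi (- int n) \<le> 1\<close> by simp
              moreover have "dist x0 x \<ge> real L + 1 + a" using False by simp
              ultimately have "y \<notin> ball x0 (real L)"
                using dist_triangle [of x0 x y] dist_triangle [of y x "z (int n) (idx (int n) x)"]
                by (simp add: dist_commute)
              then show ?thesis by (simp add: g_def)
            qed
            then have "(\<integral>\<^sup>+y\<in>?B. g L y \<partial>M) = (\<integral>\<^sup>+y. 0 \<partial>M)"
              by (intro nn_integral_cong) (auto split: split_indicator)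
            then show ?thesis by (simp add: mean_def)
          qed
          then show "mean a (int n) (g L) x - ennreal C * g L x \<le> of_nat L * indicator (ball x0 (real L + 1 + a)) x"
            using diff_le_self_ennreal order_trans by blast
        qed
        show "AE x in M. (\<lambda>n. mean a (int n) (g L) x - ennreal C * g L x) \<longlonglongrightarrow> 0"
          using * [OF g_meas g_fin, of L]
        proof eventually_elim
          case (elim x)
          have "g L x \<le> of_nat L" using gL [of L x] by (auto split: split_indicator_asm)
          then have fin: "ennreal C * g L x < \<infinity>"
            by (simp add: ennreal_mult_less_top) (use of_nat_less_top le_less_trans in blast)
          show ?case
          proof (rule order_tendstoI)
            fix e :: ennreal assume "0 < e"
            then obtain d where d: "0 < d" "d < e" using dense by blast
            have "limsup (\<lambda>n. mean a (int n) (g L) x) < ennreal C * g L x + d"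
              using elim ennreal_less_add_pos [OF fin d(1)] by (rule le_less_trans)
            then have "\<forall>\<^sub>F n in sequentially. mean a (int n) (g L) x < ennreal C * g L x + d"
              by (rule Limsup_lessD)
            then show "\<forall>\<^sub>F n in sequentially. mean a (int n) (g L) x - ennreal C * g L x < e"
            proof eventually_elim
              case (elim n)
              have "mean a (int n) (g L) x - ennreal C * g L x \<le> d"
                using elim fin by (subst ennreal_minus_le_iff) (auto simp: add.commute)
              with d show ?case by simp
            qed
          qed simp
        qed
      qed measurable
      then show ?thesis by simp
    qed
    have lim_rest: "(\<lambda>L. \<integral>\<^sup>+x. f x - g L x \<partial>M) \<longlonglongrightarrow> 0"
    proof -
      have "(\<lambda>L. \<integral>\<^sup>+x. f x - g L x \<partial>M) \<longlonglongrightarrow> (\<integral>\<^sup>+x. 0 \<partial>M)"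
      proof (rule nn_integral_dominated_convergence [where w = f and u' = "\<lambda>x. 0" and u = "\<lambda>L x. f x - g L x"])
        have "AE x in M. f x \<noteq> \<infinity>" using fin by (intro nn_integral_PInf_AE) auto
        then show "AE x in M. (\<lambda>L. f x - g L x) \<longlonglongrightarrow> 0"
        proof eventually_elim
          case (elim x)
          then obtain y where y: "f x = ennreal y" "0 \<le> y" by (cases "f x") auto
          obtain L0 :: nat where L0: "max y (dist x0 x) < real L0" using reals_Archimedean2 by blast
          have "f x - g L x = 0" if "L0 \<le> L" for L
          proof -
            have "max y (dist x0 x) < real L" using L0 that by (smt (verit) of_nat_mono)
            then have "g L x = f x" by (simp add: g_def y ennreal_of_nat_eq_real_of_nat min_def)
            then show ?thesis using elim by simp
          qed
          then show ?case by (intro tendsto_eventually) (auto simp: eventually_sequentially)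
        qed
      qed (use fin diff_le_self_ennreal in auto)
      then show ?thesis by simp
    qed
    \<comment> \<open>For fixed L the truncated part disappears in the limit over the scales, which
      leaves the remainder; only then does L tend to infinity.\<close>
    have le: "limsup (\<lambda>n. \<integral>\<^sup>+x. mean a (int n) f x - ennreal C * f x \<partial>M) \<le> of_nat N * (\<integral>\<^sup>+x. f x - g L x \<partial>M)" for L
    proof -
      have "(\<integral>\<^sup>+x. mean a (int n) f x - ennreal C * f x \<partial>M)
          \<le> (\<integral>\<^sup>+x. mean a (int n) (g L) x - ennreal C * g L x \<partial>M) + of_nat N * (\<integral>\<^sup>+x. f x - g L x \<partial>M)" for n
      proof -
        have "(\<integral>\<^sup>+x. mean a (int n) f x - ennreal C * f x \<partial>M)
          \<le> (\<integral>\<^sup>+x. (mean a (int n) (g L) x - ennreal C * g L x) + mean a (int n) (\<lambda>y. f y - g L y) x \<partial>M)"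
        proof (rule nn_integral_mono)
          fix x
          let ?B = "dball a (int n) (idx (int n) x)"
          have "(\<integral>\<^sup>+y\<in>?B. f y \<partial>M) = (\<integral>\<^sup>+y. g L y * indicator ?B y + (f y - g L y) * indicator ?B y \<partial>M)"
            using gf by (intro nn_integral_cong) (auto simp: ennreal_diff_self add_diff_inverse_ennreal add_diff_eq_ennreal split: split_indicator)
          also have "\<dots> = (\<integral>\<^sup>+y\<in>?B. g L y \<partial>M) + (\<integral>\<^sup>+y\<in>?B. f y - g L y \<partial>M)"
            by (intro nn_integral_add) measurable
          finally have eq: "mean a (int n) f x = mean a (int n) (g L) x + mean a (int n) (\<lambda>y. f y - g L y) x"
            by (simp add: mean_def add_divide_distrib_ennreal)
          have "g L x \<le> of_nat L" using gL [of L x] by (auto split: split_indicator_asm)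
          then have "ennreal C * g L x < \<infinity>"
            by (simp add: ennreal_mult_less_top) (use of_nat_less_top le_less_trans in blast)
          then show "mean a (int n) f x - ennreal C * f x
              \<le> (mean a (int n) (g L) x - ennreal C * g L x) + mean a (int n) (\<lambda>y. f y - g L y) x"
            unfolding eq using gf by (intro ennreal_add_minus_le mult_left_mono) auto
        qed
        also have "\<dots> = (\<integral>\<^sup>+x. mean a (int n) (g L) x - ennreal C * g L x \<partial>M) + (\<integral>\<^sup>+x. mean a (int n) (\<lambda>y. f y - g L y) x \<partial>M)"
          by (intro nn_integral_add) measurable
        also have "\<dots> \<le> (\<integral>\<^sup>+x. mean a (int n) (g L) x - ennreal C * g L x \<partial>M) + of_nat N * (\<integral>\<^sup>+x. f x - g L x \<partial>M)"
          using g_meas by (intro add_left_mono N) auto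
        finally show ?thesis .
      qed
      then have "limsup (\<lambda>n. \<integral>\<^sup>+x. mean a (int n) f x - ennreal C * f x \<partial>M)
          \<le> limsup (\<lambda>n. (\<integral>\<^sup>+x. mean a (int n) (g L) x - ennreal C * g L x \<partial>M) + of_nat N * (\<integral>\<^sup>+x. f x - g L x \<partial>M))"
        by (intro Limsup_mono) auto
      also have "\<dots> = 0 + of_nat N * (\<integral>\<^sup>+x. f x - g L x \<partial>M)"
        by (intro lim_imp_Limsup tendsto_intros lim_g) auto
      finally show ?thesis by simp
    qed
    have "(\<lambda>L. of_nat N * (\<integral>\<^sup>+x. f x - g L x \<partial>M)) \<longlonglongrightarrow> of_nat N * 0"
      by (intro ennreal_tendsto_cmult lim_rest) (simp add: of_nat_less_top)
    then have "limsup (\<lambda>n. \<integral>\<^sup>+x. mean a (int n) f x - ennreal C * f x \<partial>M) \<le> of_nat N * 0"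
      by (rule tendsto_lowerbound) (use le in auto)
    then show ?thesis
      by (intro tendsto_0_if_Limsup_eq_0_ennreal) simp
  qed
  with C(1) show thesis by (rule that)
qed

end

section \<open>Estimates for extended powers, quotients and distances\<close>

lemma enn_powr_mono: "0 \<le> p \<Longrightarrow> x \<le> y \<Longrightarrow> enn_powr x p \<le> enn_powr y p"
  by (cases x; cases y) (auto simp: enn_powr_def powr_mono2 ennreal_leI top_unique)

lemma ennreal_divide_le_doubling:
  fixes X b d C :: ennreal
  assumes "d \<le> C * b" "0 < b" "b < \<infinity>" "0 < d" "d < \<infinity>"
  shows "X / b \<le> C * (X / d)"
proof -
  have "X = X / d * d" using assms by (simp add: ennreal_divide_times)
  also have "\<dots> \<le> X / d * (C * b)" using assms by (intro mult_left_mono) auto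
  finally have "X / b \<le> X / d * (C * b) / b" by (rule divide_right_mono_ennreal)
  also have "X / d * (C * b) = C * (X / d) * b" by (simp only: mult_ac)
  also have "C * (X / d) * b / b = C * (X / d)"
    using assms by (intro ennreal_mult_divide_eq) auto
  finally show ?thesis .
qed

lemma real_of_ereal_abs_le: "ennreal \<bar>real_of_ereal x\<bar> \<le> e2ennreal \<bar>x\<bar>"
  by (cases x) (auto simp: e2ennreal_enn2ereal)

lemma ennreal_abs_diff_le: "ennreal \<bar>a - b\<bar> \<le> ennreal \<bar>a\<bar> + ennreal \<bar>b :: real\<bar>"
  by (simp add: abs_triangle_ineq4 flip: ennreal_plus)

text \<open>Replacing infinite values by 0 can only lower the distance, since
  \<open>ext_dist\<close> is infinite there.\<close>

lemma ext_dist_ge: "ennreal \<bar>real_of_ereal x - c\<bar> \<le> ext_dist x (ereal c)"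
  by (cases x) (auto simp: ext_dist_real ext_dist_infinite)

context dyadic_doubling
begin

text \<open>\<open>F\<close> is C f plus the sum of the excesses along \<open>\<kappa>\<close>,
  whose integrals are at most 2^-j. The bound holds at every point and not just almost everywhere,
  because it is used along curves.\<close>

lemma dominated_subsequence:
  assumes a: "1 \<le> a" and f [measurable]: "f \<in> borel_measurable borel" and fin: "(\<integral>\<^sup>+x. f x \<partial>M) < \<infinity>"
  obtains \<kappa> :: "nat \<Rightarrow> nat" and F where "strict_mono \<kappa>" "F \<in> borel_measurable borel" "(\<integral>\<^sup>+x. F x \<partial>M) < \<infinity>"
    and "\<And>j x. mean a (int (\<kappa> j)) f x \<le> F x"
proof -
  obtain C where "\<And>f. f \<in> borel_measurable borel \<Longrightarrow> (\<integral>\<^sup>+x. f x \<partial>M) < \<infinity> \<Longrightarrow>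
      (\<lambda>n. \<integral>\<^sup>+x. mean a (int n) f x - ennreal C * f x \<partial>M) \<longlonglongrightarrow> 0"
    by (rule mean_excess_tendsto_0 [OF a]) (rule that)
  note lim = this [OF f fin]
  define e where "e n x = mean a (int n) f x - ennreal C * f x" for n x
  have [measurable]: "e n \<in> borel_measurable borel" for n
    unfolding e_def [abs_def] by measurable
  have [measurable]: "e n \<in> borel_measurable M" for n by (rule meas_M) measurable
  have fM [measurable]: "f \<in> borel_measurable M" by (rule meas_M) measurable
  have ex: "\<exists>n>N. (\<integral>\<^sup>+x. e n x \<partial>M) \<le> ennreal ((1 / 2) ^ j)" for N j
  proof -
    have "\<forall>\<^sub>F n in sequentially. (\<integral>\<^sup>+x. e n x \<partial>M) < ennreal ((1 / 2) ^ j)"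
      using lim unfolding e_def by (rule order_tendstoD) simp
    moreover have "\<forall>\<^sub>F n in sequentially. N < n" by (rule eventually_gt_at_top)
    ultimately have "\<forall>\<^sub>F n in sequentially. N < n \<and> (\<integral>\<^sup>+x. e n x \<partial>M) \<le> ennreal ((1 / 2) ^ j)"
      by eventually_elim auto
    then show ?thesis by (auto simp: eventually_sequentially)
  qed
  have "\<exists>\<kappa>. \<forall>j. (\<integral>\<^sup>+x. e (\<kappa> j) x \<partial>M) \<le> ennreal ((1 / 2) ^ j) \<and> \<kappa> j < \<kappa> (Suc j)"
  proof (rule dependent_nat_choice)
    show "\<exists>x. integral\<^sup>N M (e x) \<le> ennreal ((1 / 2) ^ 0)" using ex [of 0 0] by blast
  next
    fix x n
    show "\<exists>y. integral\<^sup>N M (e y) \<le> ennreal ((1 / 2) ^ Suc n) \<and> x < y" using ex [of x "Suc n"] by blast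
  qed
  then obtain \<kappa> where \<kappa>: "\<And>j. (\<integral>\<^sup>+x. e (\<kappa> j) x \<partial>M) \<le> ennreal ((1 / 2) ^ j)" "\<And>j. \<kappa> j < \<kappa> (Suc j)"
    by blast
  define F where "F x = ennreal C * f x + (\<Sum>j. e (\<kappa> j) x)" for x
  show thesis
  proof (rule that [of \<kappa> F])
    show "strict_mono \<kappa>" using \<kappa>(2) by (simp add: strict_mono_Suc_iff)
    show "F \<in> borel_measurable borel" unfolding F_def [abs_def] by measurable
    have "(\<integral>\<^sup>+x. F x \<partial>M) = ennreal C * (\<integral>\<^sup>+x. f x \<partial>M) + (\<Sum>j. \<integral>\<^sup>+x. e (\<kappa> j) x \<partial>M)"
      unfolding F_def by (simp add: nn_integral_add nn_integral_cmult nn_integral_suminf)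
    also have "\<dots> \<le> ennreal C * (\<integral>\<^sup>+x. f x \<partial>M) + (\<Sum>j. ennreal ((1 / 2) ^ j))"
      by (intro add_left_mono suminf_le \<kappa>) auto
    also have "(\<Sum>j. ennreal ((1 / 2) ^ j)) = ennreal 2"
      using geometric_sums [of "1 / 2 :: real"] by (intro suminf_ennreal_eq) auto
    also have "ennreal C * (\<integral>\<^sup>+x. f x \<partial>M) + ennreal 2 < \<infinity>"
      using fin by (simp add: ennreal_mult_less_top)
    finally show "(\<integral>\<^sup>+x. F x \<partial>M) < \<infinity>" .
    fix j x
    have "mean a (int (\<kappa> j)) f x \<le> ennreal C * f x + e (\<kappa> j) x"
    proof (cases "ennreal C * f x \<le> mean a (int (\<kappa> j)) f x")
      case True
      then show ?thesis
        unfolding e_def by (subst add.commute) (simp add: diff_add_cancel_ennreal)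
    next
      case False
      then show ?thesis by (auto intro: add_increasing2 less_imp_le simp: not_le)
    qed
    also have "e (\<kappa> j) x \<le> (\<Sum>j. e (\<kappa> j) x)"
      using sum_le_suminf [of "\<lambda>j. e (\<kappa> j) x" "{j}"] by simp
    finally show "mean a (int (\<kappa> j)) f x \<le> F x" by (simp add: F_def add_left_mono)
  qed
qed

text \<open>Jensen's inequality for the absolute value; the surrounding ball makes u integrable on
  B.\<close>

lemma average_diff_le:
  assumes u: "u \<in> borel_L1_loc M" and B: "B \<in> sets M" "B \<subseteq> ball x r" "0 < emeasure M B"
  shows "ennreal \<bar>average M B u - c\<bar> \<le> (\<integral>\<^sup>+y\<in>B. ennreal \<bar>real_of_ereal (u y) - c\<bar> \<partial>M) / emeasure M B"
proof -
  define U where "U y = real_of_ereal (u y)" for y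
  have [measurable]: "u \<in> borel_measurable borel" using u by (simp add: borel_L1_loc_def)
  have [measurable]: "U \<in> borel_measurable M"
    by (rule meas_M) (simp add: U_def [abs_def])
  note B(1) [measurable]
  have U_le: "ennreal \<bar>U y\<bar> \<le> e2ennreal \<bar>u y\<bar>" for y
    unfolding U_def by (rule real_of_ereal_abs_le)
  have "0 < r" using B by (metis ball_empty emeasure_empty less_irrefl not_le_imp_less subset_empty)
  have finB: "emeasure M B < \<infinity>"
    using emeasure_mono [of B "ball x r" M] B ball_finite [of x r] sets_M by (auto intro: le_less_trans)
  have "(\<integral>\<^sup>+y\<in>B. ennreal \<bar>U y\<bar> \<partial>M) \<le> (\<integral>\<^sup>+y\<in>ball x r. e2ennreal \<bar>u y\<bar> \<partial>M)"
    using B by (intro nn_integral_mono) (auto intro: U_le split: split_indicator)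
  also have "\<dots> < \<infinity>" using u \<open>0 < r\<close> by (simp add: borel_L1_loc_def)
  finally have fin: "(\<integral>\<^sup>+y\<in>B. ennreal \<bar>U y\<bar> \<partial>M) < \<infinity>" .
  have iU: "integrable M (\<lambda>y. indicator B y *\<^sub>R U y)"
  proof (rule integrableI_bounded)
    have "(\<integral>\<^sup>+y. ennreal (norm (indicator B y *\<^sub>R U y)) \<partial>M) = (\<integral>\<^sup>+y\<in>B. ennreal \<bar>U y\<bar> \<partial>M)"
      by (intro nn_integral_cong) (auto split: split_indicator)
    then show "(\<integral>\<^sup>+y. ennreal (norm (indicator B y *\<^sub>R U y)) \<partial>M) < \<infinity>" using fin by simp
  qed measurable
  have ic: "integrable M (\<lambda>y. indicator B y *\<^sub>R c)"
    using finB B(1) by (intro integrable_scaleR_left integrable_real_indicator) auto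
  have \<mu>: "emeasure M B = ennreal (measure M B)" "0 < measure M B"
    using finB B(3) by (auto simp: emeasure_eq_ennreal_measure zero_less_measure_iff)
  have "(\<integral>y. indicator B y *\<^sub>R (U y - c) \<partial>M) = (\<integral>y. indicator B y *\<^sub>R U y \<partial>M) - (\<integral>y. indicator B y *\<^sub>R c \<partial>M)"
    by (subst Bochner_Integration.integral_diff [symmetric, OF iU ic]) (simp add: right_diff_distrib)
  also have "(\<integral>y. indicator B y *\<^sub>R c \<partial>M) = measure M B * c"
    using finB B(1) by simp
  also have "(\<integral>y. indicator B y *\<^sub>R U y \<partial>M) - measure M B * c = measure M B * (average M B u - c)"
    using \<mu>(2) by (simp add: average_def set_lebesgue_integral_def U_def field_simps)
  finally have eq: "(\<integral>y. indicator B y *\<^sub>R (U y - c) \<partial>M) = measure M B * (average M B u - c)" .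
  have "ennreal (norm (\<integral>y. indicator B y *\<^sub>R (U y - c) \<partial>M)) \<le> (\<integral>\<^sup>+y. ennreal (norm (indicator B y *\<^sub>R (U y - c))) \<partial>M)"
    using Bochner_Integration.integrable_diff [OF iU ic]
    by (intro integral_norm_bound_ennreal) (simp add: right_diff_distrib)
  also have "\<dots> = (\<integral>\<^sup>+y\<in>B. ennreal \<bar>U y - c\<bar> \<partial>M)"
    by (intro nn_integral_cong) (auto split: split_indicator)
  finally have "emeasure M B * ennreal \<bar>average M B u - c\<bar> \<le> (\<integral>\<^sup>+y\<in>B. ennreal \<bar>U y - c\<bar> \<partial>M)"
    unfolding eq \<mu>(1) by (simp add: abs_mult ennreal_mult)
  then have "emeasure M B * ennreal \<bar>average M B u - c\<bar> / emeasure M B \<le> (\<integral>\<^sup>+y\<in>B. ennreal \<bar>U y - c\<bar> \<partial>M) / emeasure M B"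
    by (rule divide_right_mono_ennreal)
  then show ?thesis
    using finB B(3) unfolding U_def by (simp add: mult.commute [of "emeasure M B"] ennreal_mult_divide_eq)
qed

text \<open>Lebesgue's argument with rational constants: outside one null set all functions |u - q|
  satisfy the limsup bound. At such a point q is taken within e / (C + 1) of the value, and the
  error stays below C + 1 times this distance.\<close>

lemma averages_tendsto:
  assumes u: "u \<in> borel_L1_loc M"
  shows "AE x in M. (\<lambda>n. average M (cover_ball z (int n) (idx (int n) x)) u) \<longlonglongrightarrow> real_of_ereal (u x)"
proof -
  define U where "U y = real_of_ereal (u y)" for y
  have [measurable]: "u \<in> borel_measurable borel" using u by (simp add: borel_L1_loc_def)
  have [measurable]: "U \<in> borel_measurable borel" by (simp add: U_def [abs_def])
  have U_le: "ennreal \<bar>U y\<bar> \<le> e2ennreal \<bar>u y\<bar>" for y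
    unfolding U_def by (rule real_of_ereal_abs_le)
  have [measurable]: "U \<in> borel_measurable M" by (rule meas_M) measurable
  obtain C where C: "1 \<le> C" and *: "\<And>f. f \<in> borel_measurable borel \<Longrightarrow>
      (\<And>x r. (\<integral>\<^sup>+y\<in>ball x r. f y \<partial>M) < \<infinity>) \<Longrightarrow>
      AE x in M. limsup (\<lambda>n. mean 1 (int n) f x) \<le> ennreal C * f x"
    using limsup_mean_le_local [of 1] by auto
  have "AE x in M. limsup (\<lambda>n. mean 1 (int n) (\<lambda>y. ennreal \<bar>U y - of_rat q\<bar>) x) \<le> ennreal C * ennreal \<bar>U x - of_rat q\<bar>" for q
  proof (rule *)
    fix x :: 'a and r :: real
    show "(\<integral>\<^sup>+y\<in>ball x r. ennreal \<bar>U y - of_rat q\<bar> \<partial>M) < \<infinity>"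
    proof (cases "0 < r")
      case True
      have [measurable]: "ball x r \<in> sets M" by (simp add: sets_M)
      have "(\<integral>\<^sup>+y\<in>ball x r. ennreal \<bar>U y - of_rat q\<bar> \<partial>M)
          \<le> (\<integral>\<^sup>+y. ennreal \<bar>U y\<bar> * indicator (ball x r) y + ennreal \<bar>of_rat q\<bar> * indicator (ball x r) y \<partial>M)"
        using ennreal_abs_diff_le [of _ "of_rat q"]
        by (intro nn_integral_mono) (auto split: split_indicator)
      also have "\<dots> = (\<integral>\<^sup>+y\<in>ball x r. ennreal \<bar>U y\<bar> \<partial>M) + ennreal \<bar>of_rat q\<bar> * emeasure M (ball x r)"
        by (simp add: nn_integral_add nn_integral_cmult_indicator)
      also have "\<dots> \<le> (\<integral>\<^sup>+y\<in>ball x r. e2ennreal \<bar>u y\<bar> \<partial>M) + ennreal \<bar>of_rat q\<bar> * emeasure M (ball x r)"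
        by (intro add_right_mono nn_integral_mono mult_right_mono) (auto intro: U_le)
      also have "\<dots> < \<infinity>"
        using u True ball_finite [of x r] by (simp add: borel_L1_loc_def ennreal_mult_less_top)
      finally show ?thesis .
    qed (simp add: ball_empty)
  qed measurable
  then have "AE x in M. \<forall>q. limsup (\<lambda>n. mean 1 (int n) (\<lambda>y. ennreal \<bar>U y - of_rat q\<bar>) x) \<le> ennreal C * ennreal \<bar>U x - of_rat q\<bar>"
    by (simp add: AE_all_countable)
  then show ?thesis
  proof eventually_elim
    case (elim x)
    show ?case
    proof (rule LIMSEQ_I)
      fix e :: real assume "0 < e"
      define d where "d = e / (C + 1)"
      have "0 < d" using \<open>0 < e\<close> C by (simp add: d_def)
      obtain q where q: "U x - d < of_rat q" "of_rat q < U x" using of_rat_dense [of "U x - d" "U x"] \<open>0 < d\<close> by auto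
      then have Uq: "\<bar>U x - of_rat q\<bar> < d" by simp
      have "limsup (\<lambda>n. mean 1 (int n) (\<lambda>y. ennreal \<bar>U y - of_rat q\<bar>) x) \<le> ennreal C * ennreal \<bar>U x - of_rat q\<bar>"
        using elim by blast
      also have "\<dots> < ennreal (C * d)"
        using C Uq \<open>0 < d\<close> by (simp add: ennreal_less_iff flip: ennreal_mult)
      finally have "\<forall>\<^sub>F n in sequentially. mean 1 (int n) (\<lambda>y. ennreal \<bar>U y - of_rat q\<bar>) x < ennreal (C * d)"
        by (rule Limsup_lessD)
      then have "\<forall>\<^sub>F n in sequentially. norm (average M (cover_ball z (int n) (idx (int n) x)) u - real_of_ereal (u x)) < e"
      proof eventually_elim
        case (elim n)
        let ?B = "dball 1 (int n) (idx (int n) x)"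
        have B: "cover_ball z (int n) (idx (int n) x) = ?B" by (simp add: cover_ball_def dball_def)
        have "ennreal \<bar>average M ?B u - of_rat q\<bar> \<le> mean 1 (int n) (\<lambda>y. ennreal \<bar>U y - of_rat q\<bar>) x"
          unfolding mean_def U_def
          by (rule average_diff_le [OF u _ _ dball_pos, where x = "z (int n) (idx (int n) x)" and r = "1 * 2 powi (- int n)"])
            (simp_all add: dball_def sets_M)
        also note elim
        finally have "\<bar>average M ?B u - of_rat q\<bar> < C * d"
          by (simp add: ennreal_less_iff)
        then have "\<bar>average M ?B u - U x\<bar> < C * d + d" using Uq by linarith
        also have "C * d + d = (C + 1) * d" by (simp add: distrib_right)
        also have "\<dots> = e" using C by (simp add: d_def)
        finally show ?case unfolding B U_def by simp
      qed
      then show "\<exists>no. \<forall>n\<ge>no. norm (average M (cover_ball z (int n) (idx (int n) x)) u - real_of_ereal (u x)) < e"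
        by (simp add: eventually_sequentially)
    qed
  qed
qed

end


section \<open>The Poincare inequality at dyadic scales\<close>

lemma diameter_ball_le:
  fixes x :: "'a::metric_space"
  assumes "0 \<le> r"
  shows "diameter (ball x r) \<le> 2 * r"
proof (cases "ball x r = {}")
  case True
  then show ?thesis using assms by simp
next
  case False
  have "dist y w \<le> 2 * r" if "y \<in> ball x r" "w \<in> ball x r" for y w
    using that dist_triangle [of y w x] by (simp add: dist_commute)
  then show ?thesis
    using False by (auto simp: diameter_def intro!: cSUP_least)
qed

context dyadic_doubling
begin

text \<open>One radius for each of the two balls and one for the gap between them.\<close>

lemma neighbors_dist:
  assumes "neighbors z k j i"
  shows "dist (z k j) (z k i) < 3 * 2 powi (- k)"
proof -
  have "cover_ball z k j \<noteq> {}" "cover_ball z k i \<noteq> {}" by (simp_all add: cover_ball_def not_le)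
  with assms obtain y w where "y \<in> cover_ball z k j" "w \<in> cover_ball z k i" "dist y w < 2 powi (- k)"
    unfolding neighbors_def by (metis setdist_ltE)
  then have "dist (z k j) y < 2 powi (- k)" "dist (z k i) w < 2 powi (- k)" "dist y w < 2 powi (- k)"
    by (simp_all add: cover_ball_def)
  then show ?thesis
    using dist_triangle [of "z k j" "z k i" y] dist_triangle [of y "z k i" w] by (simp add: dist_commute)
qed

lemma neighbors_bounded:
  obtains N :: nat where "\<And>k i. finite {j \<in> cover_index m k. neighbors z k j i}"
    "\<And>k i. card {j \<in> cover_index m k. neighbors z k j i} \<le> N"
proof -
  obtain N where N: "\<And>k x. finite {i \<in> cover_index m k. dist (z k i) x < 3 * 2 powi (- k)}"
    "\<And>k x. card {i \<in> cover_index m k. dist (z k i) x < 3 * 2 powi (- k)} \<le> N"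
    by (rule bounded_overlap [of 3]) (rule that)
  have sub: "{j \<in> cover_index m k. neighbors z k j i} \<subseteq> {j \<in> cover_index m k. dist (z k j) (z k i) < 3 * 2 powi (- k)}" for k i
    using neighbors_dist by blast
  show thesis
    by (rule that [of N]) (use finite_subset [OF sub N(1)] card_mono [OF N(1) sub] N(2) order_trans in blast)+
qed

text \<open>All neighbours lie in the fourfold dilate of the ball of x, so a single application of
  the Poincare inequality there compares their averages with the average A over the dilate. The
  diameter, of order 2^-k, cancels the factor 2^k in the operator.\<close>

lemma abs_T_bound:
  assumes PI: "poincare_inequality M p" and p: "0 < p"
  obtains a K :: real where "1 \<le> a" "0 < K"
    and "\<And>u g k x. u \<in> borel_L1_loc M \<Longrightarrow> upper_gradient u g \<Longrightarrow>
      enn_powr (ennreal (abs_T M m z k u x)) p \<le> ennreal K * mean a k (\<lambda>y. enn_powr (g y) p) x"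
proof -
  obtain cPI \<sigma> where c: "0 < cPI" "1 \<le> \<sigma>" and PI': "\<And>x r u g. 0 < r \<Longrightarrow> u \<in> borel_L1_loc M \<Longrightarrow> upper_gradient u g \<Longrightarrow>
           (\<integral>\<^sup>+y\<in>ball x r. ext_dist (u y) (ereal (average M (ball x r) u)) \<partial>M)
               / emeasure M (ball x r)
           \<le> ennreal (cPI * diameter (ball x r)) *
              enn_powr ((\<integral>\<^sup>+y\<in>ball x (\<sigma> * r). enn_powr (g y) p \<partial>M)
                          / emeasure M (ball x (\<sigma> * r))) (1 / p)"
    using PI unfolding poincare_inequality_def by blast
  \<comment> \<open>The ball of radius 4 r lies in the sevenfold dilate of every neighbour, whose
    center is less than 3 r away.\<close>
  obtain C where C: "1 \<le> C" "\<And>x r. 0 < r \<Longrightarrow> emeasure M (ball x (7 * r)) \<le> ennreal C * emeasure M (ball x r)"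
    by (rule doubling_iterate [of 7]) (rule that)
  obtain N where fin: "\<And>k i. finite {j \<in> cover_index m k. neighbors z k j i}"
    and N: "\<And>k i. card {j \<in> cover_index m k. neighbors z k j i} \<le> N"
    by (rule neighbors_bounded) (rule that)
  \<comment> \<open>16 is 2 times 8: two averages are compared with A, and the diameter is at most 8
    r. C is the price for passing from the large ball to a neighbour, and \<open>Suc N\<close> keeps
    K0 positive.\<close>
  define K0 where "K0 = real (Suc N) * (16 * C * cPI)"
  have K0: "0 < K0" using C c by (simp add: K0_def)
  have main: "ennreal (abs_T M m z k u x) \<le> ennreal K0 * enn_powr (mean (4 * \<sigma>) k (\<lambda>y. enn_powr (g y) p) x) (1 / p)"
    if u: "u \<in> borel_L1_loc M" and g: "upper_gradient u g" for u g k x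
  proof -
    define i where "i = idx k x"
    define r where "r = (2::real) powi (- k)"
    have r: "0 < r" by (simp add: r_def)
    define B where "B = ball (z k i) (4 * r)"
    define A where "A = average M B u"
    define I where "I = mean (4 * \<sigma>) k (\<lambda>y. enn_powr (g y) p) x"
    define X where "X = (\<integral>\<^sup>+y\<in>B. ennreal \<bar>real_of_ereal (u y) - A\<bar> \<partial>M)"
    have B: "0 < emeasure M B" "emeasure M B < \<infinity>"
      unfolding B_def by (rule ball_pos, simp add: r) (rule ball_finite)
    have "X / emeasure M B \<le> (\<integral>\<^sup>+y\<in>B. ext_dist (u y) (ereal A) \<partial>M) / emeasure M B"
      unfolding X_def by (intro divide_right_mono_ennreal nn_integral_mono mult_right_mono ext_dist_ge) simp
    also have "\<dots> \<le> ennreal (cPI * diameter B) * enn_powr I (1 / p)"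
      using PI' [of "4 * r" u g "z k i"] u g r
      by (simp add: A_def B_def I_def mean_def dball_def r_def i_def mult.assoc mult.left_commute [of \<sigma> 4])
    also have "\<dots> \<le> ennreal (cPI * (8 * r)) * enn_powr I (1 / p)"
      using diameter_ball_le [of "4 * r" "z k i"] r c unfolding B_def
      by (intro mult_right_mono ennreal_leI mult_left_mono) auto
    finally have osc: "X / emeasure M B \<le> ennreal (cPI * (8 * r)) * enn_powr I (1 / p)" .
    have avg: "ennreal \<bar>average M (cover_ball z k j) u - A\<bar> \<le> ennreal (8 * C * cPI * r) * enn_powr I (1 / p)"
      if "neighbors z k j i \<or> j = i" for j
    proof -
      let ?Bj = "cover_ball z k j"
      have Bj: "?Bj = ball (z k j) r" by (simp add: cover_ball_def r_def)
      have d: "dist (z k j) (z k i) < 3 * r"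
        using that neighbors_dist [of k j i] r by (auto simp: r_def)
      have pos: "0 < emeasure M ?Bj" "emeasure M ?Bj < \<infinity>"
        unfolding Bj by (rule ball_pos, rule r) (rule ball_finite)
      have sub: "?Bj \<subseteq> B"
      proof
        fix y assume "y \<in> ?Bj"
        then show "y \<in> B"
          using d dist_triangle [of "z k i" y "z k j"] by (simp add: Bj B_def dist_commute)
      qed
      have "B \<subseteq> ball (z k j) (7 * r)"
      proof
        fix y assume "y \<in> B"
        then show "y \<in> ball (z k j) (7 * r)"
          using d dist_triangle [of "z k j" y "z k i"] by (simp add: B_def)
      qed
      then have "emeasure M B \<le> emeasure M (ball (z k j) (7 * r))"
        by (intro emeasure_mono sets_M) auto
      also have "\<dots> \<le> ennreal C * emeasure M ?Bj" unfolding Bj using C(2) r by simp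
      finally have dbl: "emeasure M B \<le> ennreal C * emeasure M ?Bj" .
      have "ennreal \<bar>average M ?Bj u - A\<bar> \<le> (\<integral>\<^sup>+y\<in>?Bj. ennreal \<bar>real_of_ereal (u y) - A\<bar> \<partial>M) / emeasure M ?Bj"
        by (rule average_diff_le [OF u _ sub [unfolded B_def] pos(1)]) (simp add: Bj sets_M)
      also have "\<dots> \<le> X / emeasure M ?Bj"
        unfolding X_def using sub
        by (intro divide_right_mono_ennreal nn_integral_mono) (auto split: split_indicator)
      also have "\<dots> \<le> ennreal C * (X / emeasure M B)"
        by (rule ennreal_divide_le_doubling [OF dbl pos B])
      also have "\<dots> \<le> ennreal C * (ennreal (cPI * (8 * r)) * enn_powr I (1 / p))"
        by (intro mult_left_mono osc) simp
      also have "\<dots> = ennreal (8 * C * cPI * r) * enn_powr I (1 / p)"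
        using C c r by (simp add: mult.assoc [symmetric] flip: ennreal_mult) (simp add: mult_ac)
      finally show ?thesis .
    qed
    let ?J = "{j \<in> cover_index m k. neighbors z k j i}"
    have diff: "ennreal \<bar>average M (cover_ball z k i) u - average M (cover_ball z k j) u\<bar>
        \<le> ennreal (16 * C * cPI * r) * enn_powr I (1 / p)" if "j \<in> ?J" for j
    proof -
      have "ennreal \<bar>average M (cover_ball z k i) u - average M (cover_ball z k j) u\<bar>
          \<le> ennreal (\<bar>average M (cover_ball z k i) u - A\<bar> + \<bar>average M (cover_ball z k j) u - A\<bar>)"
        by (intro ennreal_leI) linarith
      also have "\<dots> \<le> ennreal (8 * C * cPI * r) * enn_powr I (1 / p) + ennreal (8 * C * cPI * r) * enn_powr I (1 / p)"
        using that by (simp add: add_mono avg)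
      also have "\<dots> = ennreal (16 * C * cPI * r) * enn_powr I (1 / p)"
        using C c r by (simp add: distrib_right [symmetric] flip: ennreal_plus)
      finally show ?thesis .
    qed
    have "ennreal (abs_T M m z k u x)
        = ennreal (2 powi k) * (\<Sum>j\<in>?J. ennreal \<bar>average M (cover_ball z k i) u - average M (cover_ball z k j) u\<bar>)"
      by (simp add: abs_T_def i_def ennreal_mult sum_nonneg)
    also have "\<dots> \<le> ennreal (2 powi k) * (\<Sum>j\<in>?J. ennreal (16 * C * cPI * r) * enn_powr I (1 / p))"
      by (intro mult_left_mono sum_mono diff) auto
    also have "\<dots> = ennreal (2 powi k) * (of_nat (card ?J) * (ennreal (16 * C * cPI * r) * enn_powr I (1 / p)))"
      by simp
    also have "\<dots> \<le> ennreal (2 powi k) * (of_nat (Suc N) * (ennreal (16 * C * cPI * r) * enn_powr I (1 / p)))"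
      using N [of k i] by (intro mult_left_mono mult_right_mono of_nat_mono) auto
    also have "\<dots> = ennreal (2 powi k * (real (Suc N) * (16 * C * cPI * r))) * enn_powr I (1 / p)"
    proof -
      have *: "ennreal w * (of_nat n * (ennreal y * e)) = ennreal (w * (real n * y)) * e"
        if "0 \<le> w" "0 \<le> y" for w y :: real and n :: nat and e
        using that by (simp add: ennreal_of_nat_eq_real_of_nat ennreal_mult mult.assoc)
      show ?thesis by (rule *) (use C c r in auto)
    qed
    also have "2 powi k * (real (Suc N) * (16 * C * cPI * r)) = K0 * (2 powi k * r)"
      by (simp add: K0_def mult_ac)
    also have "2 powi k * r = 1" by (simp add: r_def power_int_minus)
    finally show ?thesis by (simp add: I_def)
  qed
  show thesis
  proof (rule that [of "4 * \<sigma>" "K0 powr p"])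
    show "1 \<le> 4 * \<sigma>" "0 < K0 powr p" using c K0 by auto
    fix u g k x assume "u \<in> borel_L1_loc M" "upper_gradient u g"
    from enn_powr_mono [OF _ main [OF this], of p k x] p
    show "enn_powr (ennreal (abs_T M m z k u x)) p \<le> ennreal (K0 powr p) * mean (4 * \<sigma>) k (\<lambda>y. enn_powr (g y) p) x"
      by (simp add: enn_powr_cmult [OF K0 p] enn_powr_inverse [OF p])
  qed
qed

section \<open>Measurability and oscillation of the dyadic averages\<close>

lemma abs_T_nonneg: "0 \<le> abs_T M m z k u x"
  by (simp add: abs_T_def sum_nonneg)

lemma abs_T_borel [measurable]: "abs_T M m z k u \<in> borel_measurable borel"
proof -
  have "(\<lambda>i. 2 powi k * (\<Sum>j \<in> {j \<in> cover_index m k. neighbors z k j i}.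
      \<bar>average M (cover_ball z k i) u - average M (cover_ball z k j) u\<bar>)) \<circ> idx k \<in> borel_measurable borel"
    by (rule measurable_comp [OF idx_measurable]) simp
  then show ?thesis by (simp add: abs_T_def [abs_def] comp_def)
qed

lemma dyadic_average_borel [measurable]:
  "(\<lambda>x. average M (cover_ball z k (idx k x)) u) \<in> borel_measurable borel"
proof -
  have "(\<lambda>i. average M (cover_ball z k i) u) \<circ> idx k \<in> borel_measurable borel"
    by (rule measurable_comp [OF idx_measurable]) simp
  then show ?thesis by (simp add: comp_def)
qed

lemma dyadic_average_diff_le:
  assumes "dist x y < 2 powi (- k)"
  shows "\<bar>average M (cover_ball z k (idx k x)) u - average M (cover_ball z k (idx k y)) u\<bar>
    \<le> 2 powi (- k) * abs_T M m z k u x"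
proof -
  obtain N where fin: "\<And>k i. finite {j \<in> cover_index m k. neighbors z k j i}"
    by (rule neighbors_bounded) (rule that)
  let ?i = "idx k x" and ?j = "idx k y"
  have "setdist (cover_ball z k ?j) (cover_ball z k ?i) \<le> dist y x"
    by (rule setdist_le_dist [OF idx_ball idx_ball])
  then have "?j \<in> {j \<in> cover_index m k. neighbors z k j ?i}"
    using assms idx_in by (simp add: neighbors_def dist_commute)
  then have "\<bar>average M (cover_ball z k ?i) u - average M (cover_ball z k ?j) u\<bar>
      \<le> (\<Sum>j\<in>{j \<in> cover_index m k. neighbors z k j ?i}. \<bar>average M (cover_ball z k ?i) u - average M (cover_ball z k j) u\<bar>)"
    by (intro member_le_sum [of ?j _ "\<lambda>j. \<bar>average M (cover_ball z k ?i) u - average M (cover_ball z k j) u\<bar>"] fin) auto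
  also have "\<dots> = 2 powi (- k) * abs_T M m z k u x"
    by (simp add: abs_T_def power_int_minus)
  finally show ?thesis .
qed

end


section \<open>Curve families of modulus zero\<close>

lemma enn_powr_inverse': "0 < p \<Longrightarrow> enn_powr (enn_powr x p) (1 / p) = x"
  using enn_powr_inverse [of "1 / p" x] by simp

lemma enn_powr_less_top_iff: "enn_powr x p < \<infinity> \<longleftrightarrow> x < \<infinity>"
  by (auto simp: enn_powr_def less_top)

lemma enn_powr_zero [simp]: "enn_powr 0 p = 0"
  by (simp add: enn_powr_def)

text \<open>Combining densities by maxima keeps their energies subadditive.\<close>

lemma enn_powr_max_le: "enn_powr (max x y) p \<le> enn_powr x p + enn_powr y p"
  by (cases "x \<le> y") (auto simp: max_def)

text \<open>A monotone surjection has no jumps, and surjectivity comes from the inverse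
  power.\<close>

lemma enn_powr_continuous: "0 < p \<Longrightarrow> continuous_on UNIV (\<lambda>x. enn_powr x p)"
proof (rule continuous_onI_mono)
  assume "0 < p"
  have "surj (\<lambda>x. enn_powr x p)"
    by (rule surjI [of _ "\<lambda>x. enn_powr x (1 / p)"]) (rule enn_powr_inverse [OF \<open>0 < p\<close>])
  then show "open ((\<lambda>x. enn_powr x p) ` UNIV)" by simp
qed (simp add: enn_powr_mono)

text \<open>Makes L^p functions integrable on balls, where the constant 1 is integrable.\<close>

lemma le_one_plus_enn_powr: "1 \<le> p \<Longrightarrow> x \<le> 1 + enn_powr x p"
proof (cases x)
  case (real r)
  assume p: "1 \<le> p"
  have "r \<le> 1 + r powr p"
  proof (cases "r \<le> 1")
    case True
    then show ?thesis by (simp add: add_increasing2)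
  next
    case False
    then have "r powr 1 \<le> r powr p" using p by (intro powr_mono) auto
    then show ?thesis using False by simp
  qed
  then have "ennreal r \<le> ennreal (1 + r powr p)" by (rule ennreal_leI)
  also have "\<dots> = 1 + ennreal (r powr p)" by simp
  finally show ?thesis using real by (simp add: enn_powr_def)
qed (simp add: enn_powr_def)

lemma ext_dist_ge': "ennreal \<bar>real_of_ereal a - real_of_ereal b\<bar> \<le> ext_dist a b"
  by (cases a; cases b) (auto simp: ext_dist_real ext_dist_infinite)

lemma ext_dist_finite:
  "ext_dist a b < \<infinity> \<Longrightarrow> ext_dist a b = ennreal \<bar>real_of_ereal a - real_of_ereal b\<bar>"
  by (cases a; cases b) (auto simp: ext_dist_real ext_dist_infinite)

lemma curve_integral_mono: "(\<And>x. f x \<le> g x) \<Longrightarrow> curve_integral f c \<le> curve_integral g c"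
  by (cases c) (auto simp: curve_integral_def intro!: nn_integral_mono mult_right_mono)

text \<open>Every positive multiple of \<open>\<rho>\<close> is admissible, and the energy of small
  multiples is arbitrarily small.\<close>

lemma curve_modulus_zeroI:
  assumes M: "\<And>f :: 'a::metric_space \<Rightarrow> ennreal. f \<in> borel_measurable borel \<Longrightarrow> f \<in> borel_measurable M"
    and p: "0 < p" and \<rho>: "\<rho> \<in> borel_measurable borel" "(\<integral>\<^sup>+x. enn_powr (\<rho> x) p \<partial>M) < \<infinity>"
    and inf: "\<And>c. c \<in> \<Gamma> \<Longrightarrow> curve_integral \<rho> c = \<infinity>"
  shows "curve_modulus M p \<Gamma> = 0"
proof -
  note \<rho>(1) [measurable]
  have [measurable]: "(\<lambda>x. enn_powr (\<rho> x) p) \<in> borel_measurable M" by (rule M) measurable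
  obtain K where K: "(\<integral>\<^sup>+x. enn_powr (\<rho> x) p \<partial>M) = ennreal K" "0 \<le> K"
    using \<rho>(2) by (cases "\<integral>\<^sup>+x. enn_powr (\<rho> x) p \<partial>M") auto
  have le: "curve_modulus M p \<Gamma> \<le> ennreal d * ennreal K" if "0 < d" for d
  proof -
    define e where "e = d powr (1 / p)"
    have e: "0 < e" "e powr p = d" using that p by (auto simp: e_def powr_powr)
    have "curve_modulus M p \<Gamma> \<le> (\<integral>\<^sup>+x. enn_powr (ennreal e * \<rho> x) p \<partial>M)"
      unfolding curve_modulus_def
    proof (rule INF_lower, intro CollectI conjI ballI)
      show "(\<lambda>x. ennreal e * \<rho> x) \<in> borel_measurable borel" by measurable
      fix c assume "c \<in> \<Gamma>"
      then have "\<infinity> \<le> curve_integral (\<lambda>x. ennreal e * \<rho> x) c"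
        using curve_integral_cmult_le [of "ennreal e" \<rho> c] inf e by (simp add: ennreal_mult_top)
      then show "1 \<le> curve_integral (\<lambda>x. ennreal e * \<rho> x) c" by (simp add: top_unique)
    qed
    also have "\<dots> = ennreal d * ennreal K"
      using e p by (simp add: enn_powr_cmult nn_integral_cmult K)
    finally show ?thesis .
  qed
  have "curve_modulus M p \<Gamma> \<le> 0 + ennreal e" if "0 < e" for e
  proof -
    have "curve_modulus M p \<Gamma> \<le> ennreal (e / (K + 1)) * ennreal K"
      by (rule le) (use K that in simp)
    also have "\<dots> = ennreal (e / (K + 1) * K)"
      using K that by (intro ennreal_mult [symmetric]) auto
    also have "\<dots> \<le> ennreal e"
      using K that by (intro ennreal_leI) (simp add: field_simps)
    finally show ?thesis by simp
  qed
  then have "curve_modulus M p \<Gamma> \<le> 0" by (rule ennreal_le_epsilon)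
  then show ?thesis by simp
qed

text \<open>The witness is \<open>sup\<^sub>n 2\<^sup>n \<rho>\<^sub>n\<close> with admissible \<open>\<rho>\<^sub>n\<close> whose energies decay fast; the supremum
  avoids Minkowski's inequality.\<close>

lemma curve_modulus_zeroE:
  assumes M: "\<And>f :: 'a::metric_space \<Rightarrow> ennreal. f \<in> borel_measurable borel \<Longrightarrow> f \<in> borel_measurable M"
    and p: "0 < p" and zero: "curve_modulus M p \<Gamma> = 0"
  obtains \<rho> where "\<rho> \<in> borel_measurable borel" "(\<integral>\<^sup>+x. enn_powr (\<rho> x) p \<partial>M) < \<infinity>"
    "\<And>c. c \<in> \<Gamma> \<Longrightarrow> curve_integral \<rho> c = \<infinity>"
proof -
  \<comment> \<open>Chosen so that multiplying the density by 2^n turns this energy bound into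
    2^-n.\<close>
  define \<delta> where "\<delta> n = (1 / 2) ^ n / (2 ^ n) powr p" for n :: nat
  have "\<exists>\<rho>. \<rho> \<in> borel_measurable borel \<and> (\<forall>c\<in>\<Gamma>. 1 \<le> curve_integral \<rho> c) \<and>
      (\<integral>\<^sup>+x. enn_powr (\<rho> x) p \<partial>M) < ennreal (\<delta> n)" for n
  proof -
    have "curve_modulus M p \<Gamma> < ennreal (\<delta> n)" unfolding zero by (simp add: \<delta>_def)
    then show ?thesis unfolding curve_modulus_def INF_less_iff by blast
  qed
  then obtain r where r [measurable]: "\<And>n. r n \<in> borel_measurable borel"
    and adm: "\<And>n c. c \<in> \<Gamma> \<Longrightarrow> 1 \<le> curve_integral (r n) c"
    and small: "\<And>n. (\<integral>\<^sup>+x. enn_powr (r n x) p \<partial>M) < ennreal (\<delta> n)"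
    by metis
  have [measurable]: "(\<lambda>x. enn_powr (r n x) p) \<in> borel_measurable M" for n by (rule M) measurable
  define s where "s n x = ennreal (2 ^ n) * r n x" for n x
  define \<rho> where "\<rho> x = (SUP n. s n x)" for x
  have [measurable]: "(\<lambda>x. enn_powr (s n x) p) \<in> borel_measurable M" for n
    unfolding s_def by (rule M) measurable
  show thesis
  proof (rule that [of \<rho>])
    show "\<rho> \<in> borel_measurable borel" unfolding \<rho>_def s_def by measurable
    have "enn_powr (\<rho> x) p \<le> (\<Sum>n. enn_powr (s n x) p)" for x
    proof -
      have "s n x \<le> enn_powr (\<Sum>n. enn_powr (s n x) p) (1 / p)" for n
      proof -
        have "enn_powr (s n x) p \<le> (\<Sum>n. enn_powr (s n x) p)"
          using sum_le_suminf [of "\<lambda>n. enn_powr (s n x) p" "{n}"] by simp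
        from enn_powr_mono [OF _ this, of "1 / p"] p show ?thesis by (simp add: enn_powr_inverse')
      qed
      then have "\<rho> x \<le> enn_powr (\<Sum>n. enn_powr (s n x) p) (1 / p)"
        unfolding \<rho>_def by (rule SUP_least)
      from enn_powr_mono [OF _ this, of p] p show ?thesis by (simp add: enn_powr_inverse)
    qed
    then have "(\<integral>\<^sup>+x. enn_powr (\<rho> x) p \<partial>M) \<le> (\<integral>\<^sup>+x. (\<Sum>n. enn_powr (s n x) p) \<partial>M)"
      by (rule nn_integral_mono)
    also have "\<dots> = (\<Sum>n. \<integral>\<^sup>+x. enn_powr (s n x) p \<partial>M)" by (rule nn_integral_suminf) measurable
    also have "\<dots> \<le> (\<Sum>n. ennreal ((1 / 2) ^ n))"
    proof (rule suminf_le)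
      fix n
      have "(\<integral>\<^sup>+x. enn_powr (s n x) p \<partial>M) = ennreal ((2 ^ n) powr p) * (\<integral>\<^sup>+x. enn_powr (r n x) p \<partial>M)"
        unfolding s_def using p by (simp add: enn_powr_cmult nn_integral_cmult)
      also have "\<dots> \<le> ennreal ((2 ^ n) powr p) * ennreal (\<delta> n)"
        using small [of n] by (intro mult_left_mono less_imp_le) auto
      also have "\<dots> = ennreal ((1 / 2) ^ n)"
        by (simp add: \<delta>_def flip: ennreal_mult)
      finally show "(\<integral>\<^sup>+x. enn_powr (s n x) p \<partial>M) \<le> ennreal ((1 / 2) ^ n)" .
    qed auto
    also have "\<dots> = ennreal 2"
      using geometric_sums [of "1 / 2 :: real"] by (intro suminf_ennreal_eq) auto
    finally show "(\<integral>\<^sup>+x. enn_powr (\<rho> x) p \<partial>M) < \<infinity>"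
      by (rule le_less_trans) simp
    fix c assume c: "c \<in> \<Gamma>"
    have ge: "ennreal (2 ^ n) \<le> curve_integral \<rho> c" for n
    proof -
      have "ennreal (2 ^ n) * 1 \<le> ennreal (2 ^ n) * curve_integral (r n) c"
        using adm [OF c] by (intro mult_left_mono) auto
      also have "\<dots> \<le> curve_integral (s n) c"
        unfolding s_def by (rule curve_integral_cmult_le)
      also have "\<dots> \<le> curve_integral \<rho> c"
        unfolding \<rho>_def by (intro curve_integral_mono SUP_upper) simp
      finally show ?thesis by simp
    qed
    show "curve_integral \<rho> c = \<infinity>"
    proof (rule ccontr)
      assume "curve_integral \<rho> c \<noteq> \<infinity>"
      then obtain y where y: "curve_integral \<rho> c = ennreal y" "0 \<le> y"
        by (cases "curve_integral \<rho> c") auto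
      obtain n where "y < 2 ^ n" using real_arch_pow [of 2 y] by auto
      with ge [of n] y show False by simp
    qed
  qed
qed

text \<open>However small e is, the added term has infinite integral along the exceptional curves;
  along the others the right hand side only grows.\<close>

lemma weak_upper_gradient_perturb:
  assumes g: "g \<in> borel_measurable borel" and \<rho>: "\<rho> \<in> borel_measurable borel" and e: "0 < e"
    and inf: "\<And>c. c \<in> rectifiable_curves \<Longrightarrow> \<not> grad_ineq u g c \<Longrightarrow> curve_integral \<rho> c = \<infinity>"
  shows "upper_gradient u (\<lambda>x. g x + ennreal e * \<rho> x)"
  unfolding upper_gradient_def
proof (intro conjI ballI)
  show "(\<lambda>x. g x + ennreal e * \<rho> x) \<in> borel_measurable borel" using g \<rho> by measurable
  fix c :: "'a curve" assume c: "c \<in> rectifiable_curves"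
  show "grad_ineq u (\<lambda>x. g x + ennreal e * \<rho> x) c"
  proof (cases "grad_ineq u g c")
    case True
    have "curve_integral g c \<le> curve_integral (\<lambda>x. g x + ennreal e * \<rho> x) c"
      by (intro curve_integral_mono) (simp add: add_increasing2)
    with True show ?thesis by (auto simp: grad_ineq_def split: prod.splits)
  next
    case False
    have "ennreal e * curve_integral \<rho> c \<le> curve_integral (\<lambda>x. ennreal e * \<rho> x) c"
      by (rule curve_integral_cmult_le)
    also have "\<dots> \<le> curve_integral (\<lambda>x. g x + ennreal e * \<rho> x) c"
      by (intro curve_integral_mono) (simp add: add_increasing)
    finally have "curve_integral (\<lambda>x. g x + ennreal e * \<rho> x) c = \<infinity>"
      using inf [OF c False] e by (simp add: ennreal_mult_top top_unique)
    then show ?thesis by (auto simp: grad_ineq_def split: prod.splits)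
  qed
qed

section \<open>Local integrability and the upper bound\<close>

context dyadic_doubling
begin

lemma newtonian_L1_loc:
  assumes p: "1 \<le> p" and u: "u \<in> newtonian_functions M p"
  shows "u \<in> borel_L1_loc M"
    and "\<exists>g. upper_gradient u g \<and> (\<integral>\<^sup>+x. enn_powr (g x) p \<partial>M) < \<infinity>"
proof -
  have "0 < p" using p by simp
  have [measurable]: "u \<in> borel_measurable borel" using u by (simp add: newtonian_functions_def)
  have [measurable]: "(\<lambda>x. enn_powr (e2ennreal \<bar>u x\<bar>) p) \<in> borel_measurable M"
    by (rule meas_M) measurable
  have "(\<integral>\<^sup>+x. enn_powr (e2ennreal \<bar>u x\<bar>) p \<partial>M) + (INF g \<in> {g. upper_gradient u g}. \<integral>\<^sup>+x. enn_powr (g x) p \<partial>M) < \<infinity>"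
    using u unfolding newtonian_functions_def newtonian_norm_def
    by (simp only: enn_powr_Lp_norm [OF \<open>0 < p\<close>] mem_Collect_eq enn_powr_less_top_iff)
  then have fin: "(\<integral>\<^sup>+x. enn_powr (e2ennreal \<bar>u x\<bar>) p \<partial>M) < \<infinity>"
      "(INF g \<in> {g. upper_gradient u g}. \<integral>\<^sup>+x. enn_powr (g x) p \<partial>M) < \<infinity>"
    by (auto simp: less_top [symmetric])
  show "\<exists>g. upper_gradient u g \<and> (\<integral>\<^sup>+x. enn_powr (g x) p \<partial>M) < \<infinity>"
    using fin(2) unfolding INF_less_iff by blast
  have "(\<integral>\<^sup>+y\<in>ball x r. e2ennreal \<bar>u y\<bar> \<partial>M) < \<infinity>" for x r
  proof -
    have [measurable]: "ball x r \<in> sets M" by (simp add: sets_M)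
    have "(\<integral>\<^sup>+y\<in>ball x r. e2ennreal \<bar>u y\<bar> \<partial>M) \<le> (\<integral>\<^sup>+y. indicator (ball x r) y + enn_powr (e2ennreal \<bar>u y\<bar>) p \<partial>M)"
      using le_one_plus_enn_powr [OF p] by (intro nn_integral_mono) (auto split: split_indicator)
    also have "\<dots> = emeasure M (ball x r) + (\<integral>\<^sup>+y. enn_powr (e2ennreal \<bar>u y\<bar>) p \<partial>M)"
      by (simp add: nn_integral_add)
    also have "\<dots> < \<infinity>" using fin(1) ball_finite [of x r] by simp
    finally show ?thesis .
  qed
  then show "u \<in> borel_L1_loc M" by (simp add: borel_L1_loc_def)
qed

text \<open>\<open>abs_T_bound\<close> is stated for genuine upper gradients. The estimate is
  therefore proved for these first and applied to the perturbations \<open>h n\<close> of g, which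
  converge to g wherever \<open>\<rho>\<close> is finite, that is, almost everywhere.\<close>

lemma limsup_abs_T_le:
  assumes PI: "poincare_inequality M p" and p: "1 \<le> p"
  obtains C :: real where "0 < C" "\<And>u g. u \<in> newtonian_functions M p \<Longrightarrow> weak_upper_gradient M p u g \<Longrightarrow>
    Lp_norm M p g < \<infinity> \<Longrightarrow> AE x in M. limsup (\<lambda>n. ennreal (abs_T M m z (int n) u x)) \<le> ennreal C * g x"
proof -
  have p0: "0 < p" using p by simp
  obtain a K where a: "1 \<le> a" and K: "0 < K" and T: "\<And>u g k x. u \<in> borel_L1_loc M \<Longrightarrow> upper_gradient u g \<Longrightarrow>
      enn_powr (ennreal (abs_T M m z k u x)) p \<le> ennreal K * mean a k (\<lambda>y. enn_powr (g y) p) x"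
    by (rule abs_T_bound [OF PI p0]) (rule that)
  obtain C0 where C0: "1 \<le> C0" and lim: "\<And>f. f \<in> borel_measurable borel \<Longrightarrow> (\<integral>\<^sup>+x. f x \<partial>M) < \<infinity> \<Longrightarrow>
    AE x in M. limsup (\<lambda>n. mean a (int n) f x) \<le> ennreal C0 * f x"
    by (rule limsup_mean_le [OF a]) (rule that)
  \<comment> \<open>K comes from the bound on \<open>abs_T\<close> and C0 from the differentiation
    theorem; both concern p-th powers, hence the root.\<close>
  define C where "C = (K * C0) powr (1 / p)"
  have KC: "0 < K * C0" using K C0 by simp
  have ug: "AE x in M. limsup (\<lambda>n. ennreal (abs_T M m z (int n) u x)) \<le> ennreal C * g x"
    if u: "u \<in> newtonian_functions M p" and g: "upper_gradient u g" and fin: "(\<integral>\<^sup>+x. enn_powr (g x) p \<partial>M) < \<infinity>" for u g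
  proof -
    have [measurable]: "g \<in> borel_measurable borel" using g by (simp add: upper_gradient_def)
    have "AE x in M. limsup (\<lambda>n. mean a (int n) (\<lambda>y. enn_powr (g y) p) x) \<le> ennreal C0 * enn_powr (g x) p"
      using fin by (intro lim) measurable
    then show ?thesis
    proof eventually_elim
      case (elim x)
      let ?A = "\<lambda>n. mean a (int n) (\<lambda>y. enn_powr (g y) p) x"
      have "ennreal (abs_T M m z (int n) u x) \<le> enn_powr (ennreal K * ?A n) (1 / p)" for n
        using enn_powr_mono [OF _ T [OF newtonian_L1_loc(1) [OF p u] g], of "1 / p" "int n" x] p
        by (simp add: enn_powr_inverse' [OF p0])
      then have "limsup (\<lambda>n. ennreal (abs_T M m z (int n) u x)) \<le> limsup (\<lambda>n. enn_powr (ennreal K * ?A n) (1 / p))"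
        by (intro Limsup_mono) auto
      \<comment> \<open>Continuous increasing maps commute with the limit superior.\<close>
      also have "\<dots> = enn_powr (limsup (\<lambda>n. ennreal K * ?A n)) (1 / p)"
        using p0 by (intro Limsup_compose_continuous_mono enn_powr_continuous monoI enn_powr_mono) auto
      also have "limsup (\<lambda>n. ennreal K * ?A n) = ennreal K * limsup ?A"
        by (rule Limsup_compose_continuous_mono)
          (auto intro!: ennreal_continuous_on_cmult continuous_on_id monoI mult_left_mono)
      also have "enn_powr (ennreal K * limsup ?A) (1 / p) \<le> enn_powr (ennreal K * (ennreal C0 * enn_powr (g x) p)) (1 / p)"
        using p0 elim by (intro enn_powr_mono mult_left_mono) auto
      also have "\<dots> = enn_powr (ennreal (K * C0) * enn_powr (g x) p) (1 / p)"
        using K C0 by (simp add: ennreal_mult mult.assoc)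
      also have "\<dots> = ennreal C * g x"
        using p0 by (simp add: enn_powr_cmult [OF KC] enn_powr_inverse' C_def)
      finally show ?case .
    qed
  qed
  show thesis
  proof (rule that [of C])
    show "0 < C" using K C0 by (simp add: C_def)
    fix u g assume u: "u \<in> newtonian_functions M p" and g: "weak_upper_gradient M p u g" and fin: "Lp_norm M p g < \<infinity>"
    have gI: "(\<integral>\<^sup>+x. enn_powr (g x) p \<partial>M) < \<infinity>"
      using fin by (simp add: Lp_norm_def enn_powr_less_top_iff del: infinity_ennreal_def)
    have gb [measurable]: "g \<in> borel_measurable borel" using g by (simp add: weak_upper_gradient_def)
    have mod0: "curve_modulus M p {c \<in> rectifiable_curves. \<not> grad_ineq u g c} = 0"
      using g by (simp add: weak_upper_gradient_def)
    obtain \<rho> where \<rho>b [measurable]: "\<rho> \<in> borel_measurable borel" and \<rho>: "(\<integral>\<^sup>+x. enn_powr (\<rho> x) p \<partial>M) < \<infinity>"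
      and inf: "\<And>c. c \<in> {c \<in> rectifiable_curves. \<not> grad_ineq u g c} \<Longrightarrow> curve_integral \<rho> c = \<infinity>"
      by (rule curve_modulus_zeroE [OF meas_M p0 mod0], assumption) (rule that)
    have [measurable]: "(\<lambda>x. enn_powr (g x) p) \<in> borel_measurable M" "(\<lambda>x. enn_powr (\<rho> x) p) \<in> borel_measurable M"
      by (rule meas_M; measurable)+
    define h where "h n x = g x + ennreal (1 / real (Suc n)) * \<rho> x" for n x
    have "AE x in M. limsup (\<lambda>k. ennreal (abs_T M m z (int k) u x)) \<le> ennreal C * h n x" for n
    proof (rule ug [OF u])
      show "upper_gradient u (h n)"
        unfolding h_def [abs_def] by (rule weak_upper_gradient_perturb [OF gb \<rho>b _ inf]) auto
      \<comment> \<open>The weight of \<open>\<rho>\<close> is at most 1, so \<open>h n\<close> is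
        at most twice the maximum of g and \<open>\<rho>\<close>; this gives integrability without
        Minkowski's inequality.\<close>
      have "enn_powr (h n x) p \<le> ennreal (2 powr p) * (enn_powr (g x) p + enn_powr (\<rho> x) p)" for x
      proof -
        have "ennreal (1 / real (Suc n)) * \<rho> x \<le> 1 * \<rho> x"
          by (intro mult_right_mono) (auto simp: ennreal_le_1)
        then have "h n x \<le> max (g x) (\<rho> x) + max (g x) (\<rho> x)"
          unfolding h_def by (intro add_mono) (auto simp: le_max_iff_disj)
        also have "\<dots> = ennreal 2 * max (g x) (\<rho> x)" by (simp add: mult_2)
        finally have "enn_powr (h n x) p \<le> enn_powr (ennreal 2 * max (g x) (\<rho> x)) p"
          using p0 by (intro enn_powr_mono) auto
        also have "\<dots> = ennreal (2 powr p) * enn_powr (max (g x) (\<rho> x)) p"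
          using p0 by (intro enn_powr_cmult) auto
        also have "\<dots> \<le> ennreal (2 powr p) * (enn_powr (g x) p + enn_powr (\<rho> x) p)"
          by (intro mult_left_mono enn_powr_max_le) simp
        finally show ?thesis .
      qed
      then have "(\<integral>\<^sup>+x. enn_powr (h n x) p \<partial>M) \<le> (\<integral>\<^sup>+x. ennreal (2 powr p) * (enn_powr (g x) p + enn_powr (\<rho> x) p) \<partial>M)"
        by (rule nn_integral_mono)
      also have "\<dots> = ennreal (2 powr p) * ((\<integral>\<^sup>+x. enn_powr (g x) p \<partial>M) + (\<integral>\<^sup>+x. enn_powr (\<rho> x) p \<partial>M))"
        by (simp add: nn_integral_cmult nn_integral_add)
      also have "\<dots> < \<infinity>" using gI \<rho> by (simp add: ennreal_mult_less_top)
      finally show "(\<integral>\<^sup>+x. enn_powr (h n x) p \<partial>M) < \<infinity>" .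
    qed
    then have "AE x in M. \<forall>n. limsup (\<lambda>k. ennreal (abs_T M m z (int k) u x)) \<le> ennreal C * h n x"
      by (simp add: AE_all_countable)
    moreover have "AE x in M. enn_powr (\<rho> x) p \<noteq> \<infinity>"
      using \<rho> by (intro nn_integral_PInf_AE) auto
    ultimately show "AE x in M. limsup (\<lambda>k. ennreal (abs_T M m z (int k) u x)) \<le> ennreal C * g x"
    proof eventually_elim
      case (elim x)
      then have "enn_powr (\<rho> x) p < \<infinity>" by (simp add: less_top)
      then have "\<rho> x < \<infinity>" by (simp only: enn_powr_less_top_iff)
      have "(\<lambda>n. 1 / real (Suc n)) \<longlonglongrightarrow> 0" by (rule LIMSEQ_Suc) (rule lim_const_over_n)
      then have "(\<lambda>n. ennreal (1 / real (Suc n))) \<longlonglongrightarrow> ennreal 0" by (rule tendsto_ennrealI)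
      then have "(\<lambda>n. \<rho> x * ennreal (1 / real (Suc n))) \<longlonglongrightarrow> \<rho> x * ennreal 0"
        using \<open>\<rho> x < \<infinity>\<close> by (intro ennreal_tendsto_cmult) simp
      then have "(\<lambda>n. g x + \<rho> x * ennreal (1 / real (Suc n))) \<longlonglongrightarrow> g x + \<rho> x * ennreal 0"
        by (rule tendsto_add [OF tendsto_const])
      then have "(\<lambda>n. ennreal C * h n x) \<longlonglongrightarrow> ennreal C * g x"
        unfolding h_def by (intro ennreal_tendsto_cmult) (simp_all add: mult.commute)
      then show ?case
        by (rule tendsto_lowerbound) (use elim in auto)
    qed
  qed
qed

end


section \<open>Lower bound\<close>

context dyadic_doubling
begin

text \<open>Borel regularity enlarges the null set to a Borel one, whose indicator may enter the
  Borel densities that define the modulus.\<close>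

lemma AE_borel_exceptional_set:
  assumes "AE x in M. P x"
  obtains E where "E \<in> sets borel" "emeasure M E = 0" "\<And>x. x \<notin> E \<Longrightarrow> P x"
proof -
  obtain N where N: "N \<in> null_sets M" "{x \<in> space M. \<not> P x} \<subseteq> N"
    using assms by (auto simp: eventually_ae_filter)
  then obtain E where "E \<in> sets borel" "N \<subseteq> E" "emeasure M E = emeasure M N"
    using reg unfolding borel_regular_measure_def null_sets_def by blast
  then show thesis using N by (intro that [of E]) auto
qed

text \<open>Finiteness of the integral of \<open>g\<close> makes \<open>u\<close> continuous along the curve, that of \<open>\<infinity> \<cdot> 1\<^sub>E\<close> makes
  the dyadic averages converge to \<open>u\<close> almost everywhere on it, and that of \<open>\<Phi>\<close> permits reverse Fatou.\<close>

lemma grad_ineq_limsup_abs_T: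
  assumes u [measurable]: "u \<in> borel_measurable borel" and g: "upper_gradient u g"
    and \<kappa>: "strict_mono \<kappa>"
    and E [measurable]: "E \<in> sets borel"
    and conv: "\<And>x. x \<notin> E \<Longrightarrow> (\<lambda>n. average M (cover_ball z (int n) (idx (int n) x)) u) \<longlonglongrightarrow> real_of_ereal (u x)"
    and \<Phi> [measurable]: "\<Phi> \<in> borel_measurable borel" and T\<Phi>: "\<And>j x. ennreal (abs_T M m z (int (\<kappa> j)) u x) \<le> \<Phi> x"
    and c: "c \<in> rectifiable_curves"
    and fin: "curve_integral g c < \<infinity>" "curve_integral \<Phi> c < \<infinity>" "curve_integral (\<lambda>x. \<infinity> * indicator E x) c < \<infinity>"
  shows "grad_ineq u (\<lambda>x. 2 * limsup (\<lambda>j. ennreal (abs_T M m z (int (\<kappa> j)) u x))) c"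
proof -
  obtain \<gamma> a b where c_eq: "c = (\<gamma>, a, b)" by (cases c)
  have [measurable]: "g \<in> borel_measurable borel" using g by (simp add: upper_gradient_def)
  obtain l \<sigma> where l: "0 < l" and ends: "\<sigma> 0 = \<gamma> a" "\<sigma> l = \<gamma> b"
    and lip: "\<And>s t. dist (\<sigma> s) (\<sigma> t) \<le> \<bar>s - t\<bar>"
    and int: "\<And>\<rho>. curve_integral \<rho> (\<gamma>, a, b) = (\<integral>\<^sup>+s\<in>{0..l}. \<rho> (\<sigma> s) \<partial>lborel)"
    and sub: "\<And>s1 s2. 0 \<le> s1 \<Longrightarrow> s1 < s2 \<Longrightarrow> s2 \<le> l \<Longrightarrow>
      \<exists>t1 t2. (\<gamma>, t1, t2) \<in> rectifiable_curves \<and> \<gamma> t1 = \<sigma> s1 \<and> \<gamma> t2 = \<sigma> s2 \<and>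
        (\<forall>\<rho>\<in>borel_measurable borel. curve_integral \<rho> (\<gamma>, t1, t2) = (\<integral>\<^sup>+s\<in>{s1..s2}. \<rho> (\<sigma> s) \<partial>lborel))"
    by (rule rectifiable_curve_arc_length [OF c [unfolded c_eq]]) (rule that)
  have "continuous_on UNIV \<sigma>"
    using lip by (intro lipschitz_on_continuous_on [of 1] lipschitz_onI) (auto simp: dist_real_def)
  then have [measurable]: "\<sigma> \<in> borel_measurable borel"
    by (rule borel_measurable_continuous_onI)
  define w where "w s = real_of_ereal (u (\<sigma> s))" for s
  define v where "v j s = average M (cover_ball z (int (\<kappa> j)) (idx (int (\<kappa> j)) (\<sigma> s))) u" for j s
  define \<tau> where "\<tau> j s = ennreal (abs_T M m z (int (\<kappa> j)) u (\<sigma> s))" for j s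
  define r where "r j = (2::real) powi (- int (\<kappa> j))" for j
  have main: "ennreal \<bar>w 0 - w l\<bar> \<le> 2 * (\<integral>\<^sup>+s\<in>{0..l}. limsup (\<lambda>j. \<tau> j s) \<partial>lborel)"
  proof (rule chaining_limit [where v = v and G = "\<lambda>s. g (\<sigma> s)" and \<Phi> = "\<lambda>s. \<Phi> (\<sigma> s)"
        and E = "\<sigma> -` E" and r = r])
    show "w \<in> borel_measurable borel" unfolding w_def by measurable
    show "v j \<in> borel_measurable borel" for j
      unfolding v_def by (rule measurable_compose [OF _ dyadic_average_borel]) measurable
    show "\<tau> j \<in> borel_measurable borel" for j
      unfolding \<tau>_def by measurable
    show "(\<lambda>s. g (\<sigma> s)) \<in> borel_measurable borel" "(\<lambda>s. \<Phi> (\<sigma> s)) \<in> borel_measurable borel"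
      by measurable
    show "\<sigma> -` E \<in> sets borel"
      using measurable_sets [OF \<open>\<sigma> \<in> borel_measurable borel\<close> E] by simp
    show "0 < l" by fact
    show "0 < r j" for j by (simp add: r_def)
    have "(\<lambda>n. (1 / 2 :: real) ^ n) \<longlonglongrightarrow> 0" by (rule LIMSEQ_power_zero) simp
    from LIMSEQ_subseq_LIMSEQ [OF this \<kappa>] show "r \<longlonglongrightarrow> 0"
      by (simp add: r_def [abs_def] two_powi_minus_nat comp_def)
    show "ennreal \<bar>v j s - v j t\<bar> \<le> ennreal (r j) * \<tau> j s" if "\<bar>s - t\<bar> < r j" for j s t
    proof -
      have "dist (\<sigma> s) (\<sigma> t) < 2 powi (- int (\<kappa> j))"
        using lip [of s t] that by (simp add: r_def)
      then have "\<bar>v j s - v j t\<bar> \<le> r j * abs_T M m z (int (\<kappa> j)) u (\<sigma> s)"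
        unfolding v_def r_def by (rule dyadic_average_diff_le)
      then have "ennreal \<bar>v j s - v j t\<bar> \<le> ennreal (r j * abs_T M m z (int (\<kappa> j)) u (\<sigma> s))"
        by (rule ennreal_leI)
      also have "\<dots> = ennreal (r j) * \<tau> j s"
        by (simp add: \<tau>_def ennreal_mult abs_T_nonneg r_def)
      finally show ?thesis .
    qed
    have "AE s in lborel. \<infinity> * indicator E (\<sigma> s) * indicator {0..l} s \<noteq> (\<infinity> :: ennreal)"
    proof (rule nn_integral_PInf_AE)
      show "(\<integral>\<^sup>+s. \<infinity> * indicator E (\<sigma> s) * indicator {0..l} s \<partial>lborel) \<noteq> \<infinity>"
        using fin(3) by (simp add: c_eq int)
    qed measurable
    then show "AE s in lborel. s \<notin> \<sigma> -` E \<inter> {0..l}"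
      by eventually_elim (auto simp: ennreal_mult_top)
    show "(\<lambda>j. v j s) \<longlonglongrightarrow> w s" if "s \<notin> \<sigma> -` E" for s
      using LIMSEQ_subseq_LIMSEQ [OF conv \<kappa>, of "\<sigma> s"] that by (simp add: v_def w_def comp_def)
    show "(\<integral>\<^sup>+s\<in>{0..l}. g (\<sigma> s) \<partial>lborel) < \<infinity>" "(\<integral>\<^sup>+s\<in>{0..l}. \<Phi> (\<sigma> s) \<partial>lborel) < \<infinity>"
      using fin by (simp_all add: c_eq int)
    show "\<tau> j s \<le> \<Phi> (\<sigma> s)" for j s unfolding \<tau>_def by (rule T\<Phi>)
    \<comment> \<open>As g is an upper gradient along all rectifiable curves, its inequality is
      available on every subarc of c as well.\<close>
    show "ennreal \<bar>w s - w t\<bar> \<le> (\<integral>\<^sup>+x\<in>{s..t}. g (\<sigma> x) \<partial>lborel)" if st: "0 \<le> s" "s < t" "t \<le> l" for s t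
    proof -
      obtain t1 t2 where t: "(\<gamma>, t1, t2) \<in> rectifiable_curves" "\<gamma> t1 = \<sigma> s" "\<gamma> t2 = \<sigma> t"
        "\<forall>\<rho>\<in>borel_measurable borel. curve_integral \<rho> (\<gamma>, t1, t2) = (\<integral>\<^sup>+x\<in>{s..t}. \<rho> (\<sigma> x) \<partial>lborel)"
        using sub [OF st] by blast
      have "ennreal \<bar>w s - w t\<bar> \<le> ext_dist (u (\<gamma> t1)) (u (\<gamma> t2))"
        unfolding w_def t(2,3) by (rule ext_dist_ge')
      also have "\<dots> \<le> curve_integral g (\<gamma>, t1, t2)"
        using g t(1) unfolding upper_gradient_def grad_ineq_def by blast
      also have "\<dots> = (\<integral>\<^sup>+x\<in>{s..t}. g (\<sigma> x) \<partial>lborel)" using t(4) by simp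
      finally show ?thesis .
    qed
  qed
  \<comment> \<open>Finiteness of the integral of g excludes infinite values of u at both ends, so
    passing to the real function w loses nothing.\<close>
  have "ext_dist (u (\<gamma> a)) (u (\<gamma> b)) \<le> curve_integral g c"
    using g c unfolding upper_gradient_def grad_ineq_def c_eq by blast
  also have "\<dots> < \<infinity>" by (rule fin)
  finally have "ext_dist (u (\<gamma> a)) (u (\<gamma> b)) = ennreal \<bar>w 0 - w l\<bar>"
    unfolding w_def ends by (rule ext_dist_finite)
  also note main
  also have "2 * (\<integral>\<^sup>+s\<in>{0..l}. limsup (\<lambda>j. \<tau> j s) \<partial>lborel) = (\<integral>\<^sup>+s\<in>{0..l}. 2 * limsup (\<lambda>j. \<tau> j s) \<partial>lborel)"
    unfolding \<tau>_def by (subst nn_integral_cmult [symmetric]) (auto simp: mult.assoc)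
  also have "\<dots> = curve_integral (\<lambda>x. 2 * limsup (\<lambda>j. ennreal (abs_T M m z (int (\<kappa> j)) u x))) c"
    by (simp add: c_eq int \<tau>_def)
  finally show ?thesis by (simp add: grad_ineq_def c_eq)
qed

lemma minimal_weak_upper_gradient_le_limsup:
  assumes PI: "poincare_inequality M p" and p: "1 \<le> p"
    and u: "u \<in> newtonian_functions M p" and min: "minimal_weak_upper_gradient M p u g"
  shows "AE x in M. g x \<le> 2 * limsup (\<lambda>n. ennreal (abs_T M m z (int n) u x))"
proof -
  have p0: "0 < p" using p by simp
  have ub [measurable]: "u \<in> borel_measurable borel" using u by (simp add: newtonian_functions_def)
  have uL: "u \<in> borel_L1_loc M" by (rule newtonian_L1_loc [OF p u])
  obtain G where G: "upper_gradient u G" and GI: "(\<integral>\<^sup>+x. enn_powr (G x) p \<partial>M) < \<infinity>"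
    using newtonian_L1_loc(2) [OF p u] by blast
  have [measurable]: "G \<in> borel_measurable borel" using G by (simp add: upper_gradient_def)
  obtain a K where a: "1 \<le> a" and K: "0 < K" and T: "\<And>u g k x. u \<in> borel_L1_loc M \<Longrightarrow> upper_gradient u g \<Longrightarrow>
      enn_powr (ennreal (abs_T M m z k u x)) p \<le> ennreal K * mean a k (\<lambda>y. enn_powr (g y) p) x"
    by (rule abs_T_bound [OF PI p0]) (rule that)
  have fb: "(\<lambda>y. enn_powr (G y) p) \<in> borel_measurable borel" by measurable
  obtain \<kappa> :: "nat \<Rightarrow> nat" and F where \<kappa>: "strict_mono \<kappa>" and F [measurable]: "F \<in> borel_measurable borel"
    and FI: "(\<integral>\<^sup>+x. F x \<partial>M) < \<infinity>" and dom: "\<And>j x. mean a (int (\<kappa> j)) (\<lambda>y. enn_powr (G y) p) x \<le> F x"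
    by (rule dominated_subsequence [OF a fb GI]) (rule that)
  have [measurable]: "F \<in> borel_measurable M" by (rule meas_M) measurable
  \<comment> \<open>The root undoes the p-th power in the bound T, so that \<open>\<Phi>\<close>
    lies in L^p.\<close>
  define \<Phi> where "\<Phi> x = enn_powr (ennreal K * F x) (1 / p)" for x
  have \<Phi> [measurable]: "\<Phi> \<in> borel_measurable borel" unfolding \<Phi>_def by measurable
  have \<Phi>I: "(\<integral>\<^sup>+x. enn_powr (\<Phi> x) p \<partial>M) < \<infinity>"
    using FI by (simp add: \<Phi>_def enn_powr_inverse [OF p0] nn_integral_cmult ennreal_mult_less_top)
  have T\<Phi>: "ennreal (abs_T M m z (int (\<kappa> j)) u x) \<le> \<Phi> x" for j x
  proof -
    have "enn_powr (ennreal (abs_T M m z (int (\<kappa> j)) u x)) p \<le> ennreal K * F x"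
      using T [OF uL G] mult_left_mono [OF dom] by (rule order_trans) simp
    from enn_powr_mono [OF _ this, of "1 / p"] p0 show ?thesis
      by (simp add: \<Phi>_def enn_powr_inverse' [OF p0])
  qed
  obtain E where E [measurable]: "E \<in> sets borel" "emeasure M E = 0"
    and conv: "\<And>x. x \<notin> E \<Longrightarrow> (\<lambda>n. average M (cover_ball z (int n) (idx (int n) x)) u) \<longlonglongrightarrow> real_of_ereal (u x)"
    by (rule AE_borel_exceptional_set [OF averages_tendsto [OF uL]]) (rule that)
  define h where "h x = limsup (\<lambda>j. ennreal (abs_T M m z (int (\<kappa> j)) u x))" for x
  have h [measurable]: "h \<in> borel_measurable borel" unfolding h_def by measurable
  \<comment> \<open>The energy is zero because E is null, while a finite integral along a curve
    means that the curve spends no length in E.\<close>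
  define \<theta> where "\<theta> x = (\<infinity> * indicator E x :: ennreal)" for x
  \<comment> \<open>A curve with finite integral of \<open>\<rho>\<close> meets all three finiteness
    conditions of \<open>grad_ineq_limsup_abs_T\<close>; the remaining curves form a family of
    modulus zero.\<close>
  define \<rho> where "\<rho> x = max (max (G x) (\<Phi> x)) (\<theta> x)" for x
  have \<theta> [measurable]: "\<theta> \<in> borel_measurable borel" unfolding \<theta>_def by measurable
  have \<rho> [measurable]: "\<rho> \<in> borel_measurable borel" unfolding \<rho>_def by measurable
  have [measurable]: "(\<lambda>x. enn_powr (G x) p) \<in> borel_measurable M" "(\<lambda>x. enn_powr (\<Phi> x) p) \<in> borel_measurable M"
    "(\<lambda>x. enn_powr (\<theta> x) p) \<in> borel_measurable M"
    by (rule meas_M; measurable)+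
  have "AE x in M. x \<notin> E"
    using E sets_M [OF E(1)] by (intro AE_not_in null_setsI)
  then have "AE x in M. enn_powr (\<theta> x) p = 0"
    by eventually_elim (simp add: \<theta>_def)
  then have "(\<integral>\<^sup>+x. enn_powr (\<theta> x) p \<partial>M) = (\<integral>\<^sup>+x. 0 \<partial>M)" by (rule nn_integral_cong_AE)
  then have \<theta>I: "(\<integral>\<^sup>+x. enn_powr (\<theta> x) p \<partial>M) = 0" by simp
  have "enn_powr (\<rho> x) p \<le> (enn_powr (G x) p + enn_powr (\<Phi> x) p) + enn_powr (\<theta> x) p" for x
    unfolding \<rho>_def by (intro order_trans [OF enn_powr_max_le] add_mono enn_powr_max_le order_refl)
  then have "(\<integral>\<^sup>+x. enn_powr (\<rho> x) p \<partial>M) \<le> (\<integral>\<^sup>+x. (enn_powr (G x) p + enn_powr (\<Phi> x) p) + enn_powr (\<theta> x) p \<partial>M)"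
    by (rule nn_integral_mono)
  also have "\<dots> < \<infinity>" using GI \<Phi>I \<theta>I by (simp add: nn_integral_add)
  finally have \<rho>I: "(\<integral>\<^sup>+x. enn_powr (\<rho> x) p \<partial>M) < \<infinity>" .
  have "weak_upper_gradient M p u (\<lambda>x. 2 * h x)"
    unfolding weak_upper_gradient_def
  proof
    show "(\<lambda>x. 2 * h x) \<in> borel_measurable borel" by measurable
    show "curve_modulus M p {c \<in> rectifiable_curves. \<not> grad_ineq u (\<lambda>x. 2 * h x) c} = 0"
    proof (rule curve_modulus_zeroI [OF meas_M p0 \<rho> \<rho>I])
      fix c assume c: "c \<in> {c \<in> rectifiable_curves. \<not> grad_ineq u (\<lambda>x. 2 * h x) c}"
      show "curve_integral \<rho> c = \<infinity>"
      proof (rule ccontr)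
        assume "curve_integral \<rho> c \<noteq> \<infinity>"
        then have fin: "curve_integral \<rho> c < \<infinity>" by (simp add: less_top)
        have le: "curve_integral G c \<le> curve_integral \<rho> c" "curve_integral \<Phi> c \<le> curve_integral \<rho> c"
            "curve_integral \<theta> c \<le> curve_integral \<rho> c"
          by (auto intro!: curve_integral_mono simp: \<rho>_def le_max_iff_disj)
        have "grad_ineq u (\<lambda>x. 2 * h x) c"
          unfolding h_def
        proof (rule grad_ineq_limsup_abs_T [OF ub G \<kappa> E(1) conv \<Phi> T\<Phi>])
          show "c \<in> rectifiable_curves" using c by simp
          show "curve_integral (\<lambda>x. \<infinity> * indicator E x) c < \<infinity>"
            using le_less_trans [OF le(3) fin] by (simp add: \<theta>_def [abs_def])
        qed (use le_less_trans [OF le(1) fin] le_less_trans [OF le(2) fin] in auto)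
        with c show False by simp
      qed
    qed
  qed
  \<comment> \<open>Minimality compares g only with weak upper gradients in L^p; the majorant
    \<open>\<Phi>\<close> supplies this integrability.\<close>
  moreover have "Lp_norm M p (\<lambda>x. 2 * h x) < \<infinity>"
  proof -
    have "h x \<le> \<Phi> x" for x
      unfolding h_def using T\<Phi> by (intro Limsup_bounded) auto
    then have "enn_powr (2 * h x) p \<le> ennreal (2 powr p) * enn_powr (\<Phi> x) p" for x
      using enn_powr_mono [of p "ennreal 2 * h x" "ennreal 2 * \<Phi> x"]
        enn_powr_cmult [of 2 p "\<Phi> x"] p0 by (simp add: mult_left_mono)
    then have "(\<integral>\<^sup>+x. enn_powr (2 * h x) p \<partial>M) \<le> (\<integral>\<^sup>+x. ennreal (2 powr p) * enn_powr (\<Phi> x) p \<partial>M)"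
      by (rule nn_integral_mono)
    also have "\<dots> < \<infinity>" using \<Phi>I by (simp add: nn_integral_cmult ennreal_mult_less_top)
    finally show ?thesis by (simp add: Lp_norm_def enn_powr_less_top_iff del: infinity_ennreal_def)
  qed
  ultimately have "AE x in M. g x \<le> 2 * h x"
    using min unfolding minimal_weak_upper_gradient_def by blast
  then show ?thesis
  proof eventually_elim
    case (elim x)
    have "h x \<le> limsup (\<lambda>n. ennreal (abs_T M m z (int n) u x))"
      using limsup_subseq_mono [OF \<kappa>, of "\<lambda>n. ennreal (abs_T M m z (int n) u x)"] by (simp add: h_def comp_def)
    then have "2 * h x \<le> 2 * limsup (\<lambda>n. ennreal (abs_T M m z (int n) u x))" by (rule mult_left_mono) simp
    with elim show ?case by (rule order_trans)
  qed
qed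

end

theorem theorem1p3:
  fixes M :: "'a::metric_space measure" and p :: real
    and m :: "int \<Rightarrow> enat" and z :: "int \<Rightarrow> nat \<Rightarrow> 'a"
  assumes "complete (UNIV :: 'a set)"
    and "borel_regular_measure M"
    and "balls_pos_finite M"
    and "doubling_measure M"
    and "1 < p"
    and "poincare_inequality M p"
    and "dyadic_coverings m z"
  shows "\<exists>C::real. 1 \<le> C \<and>
    (\<forall>U \<in> newtonian_space M p. \<forall>u \<in> U. \<forall>g. minimal_weak_upper_gradient M p u g \<longrightarrow>
      (AE x in M.
         ennreal (1 / C) * g x \<le> Limsup at_top (\<lambda>k::int. ennreal (abs_T M m z k u x)) \<and>
         Limsup at_top (\<lambda>k::int. ennreal (abs_T M m z k u x)) \<le> ennreal C * g x))"
proof -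
  interpret dyadic_doubling M m z by unfold_locales fact+
  have p: "1 \<le> p" using \<open>1 < p\<close> by simp
  note PI = \<open>poincare_inequality M p\<close>
  obtain C where "0 < C" and upper: "\<And>u g. u \<in> newtonian_functions M p \<Longrightarrow> weak_upper_gradient M p u g \<Longrightarrow>
    Lp_norm M p g < \<infinity> \<Longrightarrow> AE x in M. limsup (\<lambda>n. ennreal (abs_T M m z (int n) u x)) \<le> ennreal C * g x"
    by (rule limsup_abs_T_le [OF PI p]) (rule that)
  \<comment> \<open>2 serves the lower bound and C the upper one; the 2 also gives D >= 1.\<close>
  define D where "D = max 2 C"
  have D: "2 \<le> D" "C \<le> D" by (auto simp: D_def)
  show ?thesis
  proof (intro exI [of _ D] conjI ballI allI impI)
    show "1 \<le> D" using D by simp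
    fix U u g assume "U \<in> newtonian_space M p" "u \<in> U" and min: "minimal_weak_upper_gradient M p u g"
    \<comment> \<open>Every representative of a class is itself a Newtonian function, so the
      estimates apply to it directly.\<close>
    then have u: "u \<in> newtonian_functions M p"
      using Union_newtonian_space [of M p] \<open>borel_regular_measure M\<close> p by auto
    have "AE x in M. limsup (\<lambda>n. ennreal (abs_T M m z (int n) u x)) \<le> ennreal C * g x"
      using min by (intro upper u) (auto simp: minimal_weak_upper_gradient_def)
    moreover have "AE x in M. g x \<le> 2 * limsup (\<lambda>n. ennreal (abs_T M m z (int n) u x))"
      by (rule minimal_weak_upper_gradient_le_limsup [OF PI p u min])
    ultimately show "AE x in M.
         ennreal (1 / D) * g x \<le> Limsup at_top (\<lambda>k::int. ennreal (abs_T M m z k u x)) \<and>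
         Limsup at_top (\<lambda>k::int. ennreal (abs_T M m z k u x)) \<le> ennreal D * g x"
      unfolding Limsup_at_top_int
    proof eventually_elim
      case (elim x)
      let ?L = "limsup (\<lambda>n. ennreal (abs_T M m z (int n) u x))"
      have "g x \<le> ennreal D * ?L"
        using elim(2) D by (intro order_trans [OF _ mult_right_mono [of 2 "ennreal D" ?L]]) (auto simp flip: ennreal_numeral intro: ennreal_leI)
      then have "ennreal (1 / D) * g x \<le> ennreal (1 / D) * (ennreal D * ?L)"
        by (rule mult_left_mono) simp
      also have "\<dots> = ?L"
        using D by (simp add: mult.assoc [symmetric] flip: ennreal_mult)
      finally have "ennreal (1 / D) * g x \<le> ?L" .
      moreover have "?L \<le> ennreal D * g x"
        using elim(1) D by (intro order_trans [OF elim(1)] mult_right_mono ennreal_leI) auto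
      ultimately show ?case by blast
    qed
  qed
qed

end
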